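(* Let $\beta > 1/2$ be constant and let $\Gamma$ be a graph on $n$ vertices with minimum degree $\delta(\Gamma) \geq \beta n$. Let $\Gamma_t$, $0\le t\le m$, be the Erd\H{o}s--R\'enyi graph process with host $\Gamma$ (where $m=|E(\Gamma)|$), and let $$\tau_2 = \min\{t : \delta(\Gamma_t) \geq 2\}, \qquad \tau_H = \min\{t : \Gamma_t \text{ contains a Hamilton cycle}\}.$$ Then $\tau_H = \tau_2$ with high probability; that is, for any sequence $(\Gamma_n)$ of graphs where $\Gamma_n$ has $n$ vertices and $\delta(\Gamma_n)\ge \beta n$, $\Pr\{\tau_H = \tau_2\} \to 1$ as $n \to \infty$.
   Context: All graphs are finite and simple, and $\delta(G)$ denotes the minimum degree of $G$. Given a graph $\Gamma = (V,E)$ with $n$ vertices and $m$ edges, the Erd\H{o}s--R\'enyi graph process with host $\Gamma$ is defined as follows: a permutation $e_1,\dots,e_m$ of $E$ is chosen uniformly at random, and $\Gamma_t = (V,\{e_1,\dots,e_t\})$ for $t\le m$. An event $\mathcal{E}_n$ holds with high probability if $\Pr\{\mathcal{E}_n\}\to 1$ as $n\to\infty$. *)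

theory Defs
  imports
    "HOL-Probability.Probability"
    "HOL-Combinatorics.Multiset_Permutations"
    "HOL-Library.Extended_Nat"
begin

type_synonym 'a graph = "'a set \<times> 'a set set"

abbreviation verts :: "'a graph \<Rightarrow> 'a set" where
  "verts G \<equiv> fst G"

abbreviation edges :: "'a graph \<Rightarrow> 'a set set" where
  "edges G \<equiv> snd G"

definition finite_simple_graph :: "'a graph \<Rightarrow> bool" where
  "finite_simple_graph G \<longleftrightarrow>
     finite (verts G) \<and> (\<forall>e\<in>edges G. e \<subseteq> verts G \<and> card e = 2)"

definition degree :: "'a graph \<Rightarrow> 'a \<Rightarrow> nat" where
  "degree G v = card {e \<in> edges G. v \<in> e}"

(* Unspecified for the graph without vertices. *)
definition min_degree :: "'a graph \<Rightarrow> nat" where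
  "min_degree G = Min (degree G ` verts G)"

(* A cycle is given by the list of its vertices in cyclic order; the first vertex is not
   repeated at the end, and the index taken modulo the length supplies the closing edge. *)
definition is_cycle :: "'a graph \<Rightarrow> 'a list \<Rightarrow> bool" where
  "is_cycle G vs \<longleftrightarrow>
     3 \<le> length vs \<and> distinct vs \<and> set vs \<subseteq> verts G \<and>
     (\<forall>i<length vs. {vs ! i, vs ! (Suc i mod length vs)} \<in> edges G)"

definition hamiltonian :: "'a graph \<Rightarrow> bool" where
  "hamiltonian G \<longleftrightarrow> (\<exists>vs. is_cycle G vs \<and> set vs = verts G)"

(* The uniformly random ordering e_1, ..., e_m of the edges of the host, as a list. *)
definition edge_order :: "'a graph \<Rightarrow> 'a set list pmf" where
  "edge_order \<Gamma> = pmf_of_set (permutations_of_set (edges \<Gamma>))"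

definition process_at :: "'a graph \<Rightarrow> 'a set list \<Rightarrow> nat \<Rightarrow> 'a graph" where
  "process_at \<Gamma> es t = (verts \<Gamma>, set (take t es))"

(* Equal to infinity if no graph of the process has the property P. *)
definition hitting_time :: "('a graph \<Rightarrow> bool) \<Rightarrow> 'a graph \<Rightarrow> 'a set list \<Rightarrow> enat" where
  "hitting_time P \<Gamma> es =
     Inf {enat t | t. t \<le> card (edges \<Gamma>) \<and> P (process_at \<Gamma> es t)}"

definition tau_2 :: "'a graph \<Rightarrow> 'a set list \<Rightarrow> enat" where
  "tau_2 = hitting_time (\<lambda>G. min_degree G \<ge> 2)"

definition tau_H :: "'a graph \<Rightarrow> 'a set list \<Rightarrow> enat" where
  "tau_H = hitting_time hamiltonian"

end

theory Submission
  imports Defs "HOL-Real_Asymp.Real_Asymp"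
begin

text \<open>
  Let \<epsilon> > 0 be such that all host degrees are at least (1/2 + \<epsilon>) n, and call the graph formed by the
  first \<theta> m ln n / n of the m edges the snapshot of density \<theta>. A Hamilton cycle forces minimum degree two, so
  the point is that the graph G at time \<tau>_2 is Hamiltonian. Host degrees lie between (1/2 + \<epsilon>) n and n, so
  with high probability \<tau>_2 falls between the snapshot of density 1 - \<epsilon>, which still has isolated vertices
  (\<open>prob_no_isolated\<close>, by the second moment), and the snapshot of density 8 (\<open>prob_small_degree\<close>). Everything
  that is needed about G can therefore be read off from these two snapshots.

  G contains an expander R with only \<alpha> n ln n edges, where \<alpha> is as small as desired (\<open>sparse_skeleton\<close>,
  \<open>expanderI\<close>). Sets of vertices of degree at least \<delta> ln n expand because no small vertex set is dense in the
  snapshot of density 8 (\<open>prob_dense_spot\<close>). The vertices whose degree in the early snapshot is lower than that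
  are pairwise far apart (\<open>prob_close_pair\<close>): two given vertices both have low degree with
  probability at most about n to the power -(1 + 2\<epsilon>)(1 - \<epsilon>), and the expected number of short paths in the
  snapshot of density 8 is only about n times a power of ln n. The exponent exceeds 1, and it does so because the host degrees exceed n/2. Sets of linear size expand
  because the sparse part of R meets every cut that has a quadratic number of host edges.

  Starting from H = R, add two edges of G at a time so that the longest path of H grows
  (\<open>hamiltonian_by_boosters\<close>); this can happen at most n times, so H remains sparse, and it stops only at a
  Hamilton cycle. Posa's rotations give linearly many ends a, and for each a linearly many other ends s, of
  longest paths on the same vertex set. If the host were complete, the edge as would close such a path; here
  the pair as need not be a host edge. Instead, if z follows y on the path from a to s, the two edges sy and az
  together close it to a cycle, and since the degrees of a and s add up to at least (1 + 2\<epsilon>) n, the count behind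
  Dirac's theorem gives at least 2\<epsilon>n such z (\<open>card_crossings\<close>); vertices z outside the path, for which az alone
  lengthens it, are counted among them. Averaging over s, for each a there are
  \<epsilon>n vertices z for which linearly many s will do (\<open>popular_crossings\<close>, \<open>booster_structure_exists\<close>).
  A snapshot of small density \<theta> then contains a suitable edge sy for all but few of these z. So the second edge az may
  be any of a quadratic number of host edges (\<open>many_boosters\<close>), one of which is in the snapshot of density 1 - \<epsilon>.

  Both searches succeed for all sparse H at once, by a union bound (\<open>sprinkling\<close>). The expected number of
  subgraphs with at most \<alpha> n ln n edges in the snapshot of density 8 is at most exp (c n ln n), where c tends to 0
  with \<alpha>, whereas a snapshot of density \<theta> misses \<eta> n^2 given edges with probability at most about
  exp (- \<eta> \<theta> n ln n). It is thus enough that \<alpha> is small compared with \<eta> \<theta>. The snapshot that supplies sy has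
  to be sparse as well, because it becomes part of the graphs over which the second union bound runs.
\<close>

section \<open>Uniformly random edge orders\<close>

definition order_prob :: "'e set \<Rightarrow> ('e list \<Rightarrow> bool) \<Rightarrow> real" where
  "order_prob E \<Phi> = measure_pmf.prob (pmf_of_set (permutations_of_set E)) {es. \<Phi> es}"

lemma order_prob_card:
  assumes "finite E"
  shows "order_prob E \<Phi> = real (card {es \<in> permutations_of_set E. \<Phi> es}) / fact (card E)"
proof -
  have "permutations_of_set E \<inter> {es. \<Phi> es} = {es \<in> permutations_of_set E. \<Phi> es}" by auto
  then show ?thesis using assms
    by (simp add: order_prob_def measure_pmf_of_set card_permutations_of_set
        permutations_of_set_empty_iff)
qed

lemma order_prob_mono:
  assumes "finite E" "\<And>es. es \<in> permutations_of_set E \<Longrightarrow> \<Phi> es \<Longrightarrow> \<Psi> es"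
  shows "order_prob E \<Phi> \<le> order_prob E \<Psi>"
proof -
  have "card {es \<in> permutations_of_set E. \<Phi> es} \<le> card {es \<in> permutations_of_set E. \<Psi> es}"
    using assms by (intro card_mono) auto
  then show ?thesis using assms(1) by (simp add: order_prob_card divide_right_mono)
qed

lemma order_prob_union_bound:
  assumes "finite E" "finite I"
    and "\<And>es. es \<in> permutations_of_set E \<Longrightarrow> \<Psi> es \<Longrightarrow> \<exists>i\<in>I. \<Phi> i es"
  shows "order_prob E \<Psi> \<le> (\<Sum>i\<in>I. order_prob E (\<Phi> i))"
proof -
  have "order_prob E \<Psi> \<le> order_prob E (\<lambda>es. \<exists>i\<in>I. \<Phi> i es)"
    using assms by (intro order_prob_mono) auto
  also have "\<dots> = measure_pmf.prob (pmf_of_set (permutations_of_set E)) (\<Union>i\<in>I. {es. \<Phi> i es})"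
    unfolding order_prob_def by (rule arg_cong[where f = "measure_pmf.prob _"]) auto
  also have "\<dots> \<le> (\<Sum>i\<in>I. order_prob E (\<Phi> i))"
    unfolding order_prob_def using assms(2)
    by (intro measure_pmf.finite_measure_subadditive_finite) auto
  finally show ?thesis .
qed

lemma order_prob_nonneg: "order_prob E \<Phi> \<ge> 0" by (simp add: order_prob_def)

text \<open>
  An edge order is encoded by the positions of the edges, and a constraint on the order by a set of allowed
  positions for each edge. Unlike orders, such injections can be built up one edge at a time.
\<close>

definition placements :: "('e \<Rightarrow> nat set) \<Rightarrow> nat \<Rightarrow> 'e set \<Rightarrow> ('e \<Rightarrow> nat) set" where
  "placements A m D = {\<pi> \<in> D \<rightarrow>\<^sub>E {..<m}. inj_on \<pi> D \<and> (\<forall>e\<in>D. \<pi> e \<in> A e)}"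

lemma finite_placements: "finite D \<Longrightarrow> finite (placements A m D)"
  unfolding placements_def by (rule finite_subset[of _ "D \<rightarrow>\<^sub>E {..<m}"]) (auto intro: finite_PiE)

lemma placements_empty: "placements A m {} = {\<lambda>_. undefined}"
  by (auto simp: placements_def)

text \<open>
  Once the edges of D have been placed, x can go to any allowed position that is still free.
\<close>

lemma card_placements_insert:
  assumes "finite D" "x \<notin> D"
  shows "card (placements A m (insert x D)) =
    (\<Sum>\<pi>\<in>placements A m D. card ((A x \<inter> {..<m}) - \<pi> ` D))"
proof -
  let ?S = "SIGMA \<pi>:placements A m D. (A x \<inter> {..<m}) - \<pi> ` D"
  let ?g = "\<lambda>(\<pi>, j). \<pi>(x := j)"
  have undef: "\<pi> x = undefined" if "\<pi> \<in> placements A m D" for \<pi>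
    using that assms(2) by (auto simp: placements_def PiE_def extensional_def)
  have inj: "inj_on ?g ?S"
  proof (rule inj_onI, clarify)
    fix \<pi> j \<pi>' j'
    assume *: "\<pi> \<in> placements A m D" "\<pi>' \<in> placements A m D" "\<pi>(x := j) = \<pi>'(x := j')"
    have "j = j'" using fun_cong[OF *(3), of x] by simp
    moreover have "\<pi> = \<pi>'"
    proof
      fix y show "\<pi> y = \<pi>' y"
        using fun_cong[OF *(3), of y] undef[OF *(1)] undef[OF *(2)] by (cases "y = x") auto
    qed
    ultimately show "\<pi> = \<pi>' \<and> j = j'" by simp
  qed
  have "placements A m (insert x D) = ?g ` ?S"
  proof (intro equalityI subsetI)
    fix \<pi> assume p: "\<pi> \<in> placements A m (insert x D)"
    let ?r = "restrict \<pi> D"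
    have 1: "?r \<in> placements A m D"
      using p by (auto simp: placements_def PiE_def Pi_def inj_on_def)
    have 2: "?r ` D = \<pi> ` D" by auto
    have 3: "\<pi> x \<in> (A x \<inter> {..<m}) - \<pi> ` D"
      using p assms(2) by (auto simp: placements_def PiE_def Pi_def inj_on_def)
    have "\<pi> = ?r(x := \<pi> x)"
    proof
      fix y show "\<pi> y = (?r(x := \<pi> x)) y"
        using p by (cases "y \<in> insert x D") (auto simp: placements_def PiE_def extensional_def)
    qed
    then show "\<pi> \<in> ?g ` ?S" using 1 2 3
      by (intro image_eqI[of _ _ "(?r, \<pi> x)"]) auto
  next
    fix \<pi> assume "\<pi> \<in> ?g ` ?S"
    then obtain \<rho> j where r: "\<rho> \<in> placements A m D" "j \<in> (A x \<inter> {..<m}) - \<rho> ` D" "\<pi> = \<rho>(x := j)"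
      by auto
    have "inj_on \<pi> (insert x D)"
      using r assms(2) by (auto simp: placements_def inj_on_def)
    then show "\<pi> \<in> placements A m (insert x D)"
      using r assms(2) by (auto simp: placements_def PiE_def Pi_def extensional_def)
  qed
  then have "card (placements A m (insert x D)) = card ?S" using inj by (simp add: card_image)
  also have "\<dots> = (\<Sum>\<pi>\<in>placements A m D. card ((A x \<inter> {..<m}) - \<pi> ` D))"
    by (rule card_SigmaI) (use assms finite_placements in auto)
  finally show ?thesis .
qed

definition pos :: "'e list \<Rightarrow> 'e \<Rightarrow> nat" where
  "pos es e = (THE i. i < length es \<and> es ! i = e)"

lemma pos_nth: "distinct es \<Longrightarrow> i < length es \<Longrightarrow> pos es (es ! i) = i"
  unfolding pos_def by (rule the_equality) (auto simp: nth_eq_iff_index_eq)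

lemma pos_less: "distinct es \<Longrightarrow> e \<in> set es \<Longrightarrow> pos es e < length es"
  by (metis in_set_conv_nth pos_nth)

lemma nth_pos: "distinct es \<Longrightarrow> e \<in> set es \<Longrightarrow> es ! pos es e = e"
  by (metis in_set_conv_nth pos_nth)

lemma in_take_iff_pos:
  assumes "distinct es" "e \<in> set es"
  shows "e \<in> set (take t es) \<longleftrightarrow> pos es e < t"
  using assms by (metis in_set_conv_nth length_take min_less_iff_conj nth_pos nth_take pos_less pos_nth)

text \<open>
  Reading off positions is a bijection from orders to injections. It turns probabilities of events about initial
  segments into counts of placements, which the following lemmas evaluate.
\<close>

lemma card_orders_eq_placements:
  assumes "finite E"
  shows "card {es \<in> permutations_of_set E. \<forall>e\<in>E. pos es e \<in> A e} = card (placements A (card E) E)"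
proof -
  let ?m = "card E"
  have "bij_betw (\<lambda>es. restrict (pos es) E) {es \<in> permutations_of_set E. \<forall>e\<in>E. pos es e \<in> A e}
      (placements A ?m E)"
    unfolding bij_betw_def
  proof (intro conjI equalityI subsetI inj_onI)
    fix es fs
    assume *: "es \<in> {es \<in> permutations_of_set E. \<forall>e\<in>E. pos es e \<in> A e}"
      "fs \<in> {es \<in> permutations_of_set E. \<forall>e\<in>E. pos es e \<in> A e}"
      "restrict (pos es) E = restrict (pos fs) E"
    have d: "distinct es" "set es = E" "distinct fs" "set fs = E"
      using * by (auto simp: permutations_of_set_def)
    have l: "length es = length fs" using d by (metis distinct_card)
    have "es ! i = fs ! i" if "i < length es" for i
    proof -
      have "es ! i \<in> E" using nth_mem[OF that] d(2) by blast
      have "pos es (es ! i) = i" using pos_nth[OF d(1) that] .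
      moreover have "pos es (es ! i) = pos fs (es ! i)"
        using fun_cong[OF *(3), of "es ! i"] \<open>es ! i \<in> E\<close> by simp
      ultimately have "pos fs (es ! i) = i" by simp
      then show ?thesis using nth_pos[OF d(3), of "es ! i"] \<open>es ! i \<in> E\<close> d by simp
    qed
    then show "es = fs" using l by (simp add: list_eq_iff_nth_eq)
  next
    fix \<pi> assume "\<pi> \<in> (\<lambda>es. restrict (pos es) E) ` {es \<in> permutations_of_set E. \<forall>e\<in>E. pos es e \<in> A e}"
    then obtain es where es: "distinct es" "set es = E" "\<forall>e\<in>E. pos es e \<in> A e" "\<pi> = restrict (pos es) E"
      by (auto simp: permutations_of_set_def)
    have l: "length es = ?m" using es by (metis distinct_card)
    have "inj_on (pos es) E"
      using es(2) nth_pos[OF es(1)] by (intro inj_on_inverseI[of _ "\<lambda>i. es ! i"]) auto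
    then show "\<pi> \<in> placements A ?m E" using es l pos_less[OF es(1)]
      by (auto simp: placements_def inj_on_def)
  next
    fix \<pi> assume p: "\<pi> \<in> placements A ?m E"
    have bij: "bij_betw \<pi> E {..<?m}"
      unfolding bij_betw_def
    proof
      show i: "inj_on \<pi> E" using p by (auto simp: placements_def)
      have "\<pi> ` E \<subseteq> {..<?m}" using p by (auto simp: placements_def)
      then show "\<pi> ` E = {..<?m}" using i by (intro card_subset_eq) (auto simp: card_image)
    qed
    let ?h = "inv_into E \<pi>"
    let ?es = "map ?h [0..<?m]"
    have bh: "bij_betw ?h {..<?m} E" using bij by (rule bij_betw_inv_into)
    have d: "distinct ?es" using bh by (auto simp: distinct_map bij_betw_def atLeast0LessThan)
    have s: "set ?es = E" using bh by (auto simp: bij_betw_def atLeast0LessThan)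
    have ps: "pos ?es e = \<pi> e" if "e \<in> E" for e
    proof -
      have "\<pi> e < ?m" using that bij by (auto simp: bij_betw_def)
      moreover have "?es ! \<pi> e = e" using that bij calculation
        by (simp add: bij_betw_def)
      ultimately show ?thesis using pos_nth[OF d, of "\<pi> e"] by simp
    qed
    have "\<pi> = restrict (pos ?es) E"
      using p ps by (auto simp: placements_def PiE_def extensional_def restrict_def)
    moreover have "?es \<in> {es \<in> permutations_of_set E. \<forall>e\<in>E. pos es e \<in> A e}"
      using d s ps p by (auto simp: permutations_of_set_def placements_def)
    ultimately show "\<pi> \<in> (\<lambda>es. restrict (pos es) E) ` {es \<in> permutations_of_set E. \<forall>e\<in>E. pos es e \<in> A e}"
      by blast
  qed
  then show ?thesis by (rule bij_betw_same_card)
qed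

lemma card_placements_free:
  assumes "finite D" "finite Z" "D \<inter> Z = {}" "card D + card Z \<le> m" "\<And>e. e \<in> Z \<Longrightarrow> A e = UNIV"
  shows "real (card (placements A m (D \<union> Z))) =
    real (card (placements A m D)) * (fact (m - card D) / fact (m - card D - card Z))"
  using assms(2,1,3-)
proof (induction Z rule: finite_induct)
  case empty
  then show ?case by simp
next
  case (insert x Z)
  have "real (card (placements A m (D \<union> insert x Z))) = real (card (placements A m (insert x (D \<union> Z))))"
    by simp
  also have "\<dots> = (\<Sum>\<pi>\<in>placements A m (D \<union> Z). real (card ((A x \<inter> {..<m}) - \<pi> ` (D \<union> Z))))"
    using insert by (subst card_placements_insert) auto
  also have "\<dots> = (\<Sum>\<pi>\<in>placements A m (D \<union> Z). real (m - card D - card Z))"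
  proof (rule sum.cong[OF refl])
    fix \<pi> assume p: "\<pi> \<in> placements A m (D \<union> Z)"
    have "card (\<pi> ` (D \<union> Z)) = card D + card Z"
      using p insert by (subst card_image) (auto simp: placements_def card_Un_disjoint)
    moreover have "A x = UNIV" using insert by auto
    moreover have "\<pi> ` (D \<union> Z) \<subseteq> {..<m}" using p by (auto simp: placements_def)
    ultimately show "real (card ((A x \<inter> {..<m}) - \<pi> ` (D \<union> Z))) = real (m - card D - card Z)"
      using insert by (simp add: card_Diff_subset)
  qed
  also have "\<dots> = real (m - card D - card Z) * (real (card (placements A m D)) * (fact (m - card D) / fact (m - card D - card Z)))"
    using insert by simp
  also have "\<dots> = real (card (placements A m D)) * (fact (m - card D) / fact (m - card D - card (insert x Z)))"
  proof -
    have "m - card D - card Z = Suc (m - card D - card (insert x Z))" using insert by simp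
    then have "(fact (m - card D - card Z) :: real) = real (m - card D - card Z) * fact (m - card D - card (insert x Z))"
      by (metis fact_Suc of_nat_id)
    moreover have "real (m - card D - card Z) \<noteq> 0" using insert by simp
    ultimately show ?thesis by simp
  qed
  finally show ?case .
qed

lemma card_placements_early:
  assumes "finite F" "card F \<le> m" "t \<le> m" "\<And>e. e \<in> F \<Longrightarrow> A e = {..<t}"
  shows "real (card (placements A m F)) \<le> (real t / m) ^ card F * (fact m / fact (m - card F))"
  using assms
proof (induction F rule: finite_induct)
  case empty
  then show ?case by (simp add: placements_empty)
next
  case (insert x F)
  have "real (card (placements A m (insert x F))) = (\<Sum>\<pi>\<in>placements A m F. real (card ((A x \<inter> {..<m}) - \<pi> ` F)))"
    using insert by (subst card_placements_insert) auto
  also have "\<dots> \<le> (\<Sum>\<pi>\<in>placements A m F. real t / m * real (m - card F))"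
  proof (rule sum_mono)
    fix \<pi> assume p: "\<pi> \<in> placements A m F"
    have "card (\<pi> ` F) = card F" using p by (auto simp: placements_def card_image)
    moreover have "\<pi> ` F \<subseteq> {..<t}" using p insert.prems by (auto simp: placements_def)
    moreover have "A x \<inter> {..<m} = {..<t}" using insert.prems by auto
    ultimately have e: "card ((A x \<inter> {..<m}) - \<pi> ` F) = t - card F" "card F \<le> t"
      using insert.hyps by (simp_all add: card_Diff_subset) (metis card_lessThan card_mono finite_lessThan)
    have "0 < m" using insert by simp
    have "real t * real (card F) \<le> real m * real (card F)" using insert.prems by (intro mult_right_mono) auto
    then have "(real t - card F) * m \<le> real t * (real m - card F)" by (simp add: algebra_simps)
    then have "real t - card F \<le> real t / m * (real m - card F)" using \<open>0 < m\<close>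
      by (simp add: field_simps)
    then show "real (card ((A x \<inter> {..<m}) - \<pi> ` F)) \<le> real t / m * real (m - card F)"
      using e insert by (simp add: of_nat_diff)
  qed
  also have "\<dots> = real t / m * real (m - card F) * real (card (placements A m F))" by simp
  also have "\<dots> \<le> real t / m * real (m - card F) * ((real t / m) ^ card F * (fact m / fact (m - card F)))"
    using insert by (intro mult_left_mono) auto
  also have "\<dots> = (real t / m) ^ card (insert x F) * (fact m / fact (m - card (insert x F)))"
  proof -
    have "m - card F = Suc (m - card (insert x F))" using insert by simp
    then have "(fact (m - card F) :: real) = real (m - card F) * fact (m - card (insert x F))"
      by (metis fact_Suc of_nat_id)
    moreover have "real (m - card F) \<noteq> 0" using insert by simp
    ultimately show ?thesis using insert by simp
  qed
  finally show ?case .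
qed

lemma card_placements_late:
  assumes "finite X" "finite F" "F \<inter> X = {}" "card F + card X \<le> m" "card F \<le> t" "card F < m" "t \<le> m"
    "\<And>e. e \<in> X \<Longrightarrow> A e = {t..}"
  shows "real (card (placements A m (F \<union> X))) \<le>
    real (card (placements A m F)) * (real (m - t) / real (m - card F)) ^ card X * (fact (m - card F) / fact (m - card F - card X))"
  using assms
proof (induction X rule: finite_induct)
  case empty
  then show ?case by simp
next
  case (insert x X)
  let ?f = "card F"
  have "real (card (placements A m (F \<union> insert x X))) = real (card (placements A m (insert x (F \<union> X))))" by simp
  also have "\<dots> = (\<Sum>\<pi>\<in>placements A m (F \<union> X). real (card ((A x \<inter> {..<m}) - \<pi> ` (F \<union> X))))"
    using insert by (subst card_placements_insert) auto
  also have "\<dots> \<le> (\<Sum>\<pi>\<in>placements A m (F \<union> X). real (m - t) / real (m - ?f) * real (m - ?f - card X))"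
  proof (rule sum_mono)
    fix \<pi> assume p: "\<pi> \<in> placements A m (F \<union> X)"
    have inj: "inj_on \<pi> X" using p by (auto simp: placements_def inj_on_def)
    have "\<pi> e \<in> {t..} \<and> \<pi> e < m" if "e \<in> X" for e
      using p that insert.prems(7)[of e] by (auto simp: placements_def)
    then have sub: "\<pi> ` X \<subseteq> {t..<m}" by auto
    have "A x = {t..}" using insert.prems by auto
    then have "card ((A x \<inter> {..<m}) - \<pi> ` (F \<union> X)) \<le> card ({t..<m} - \<pi> ` X)"
      by (intro card_mono) auto
    also have "\<dots> = m - t - card X"
      using sub inj insert.hyps by (simp add: card_Diff_subset card_image)
    finally have e: "card ((A x \<inter> {..<m}) - \<pi> ` (F \<union> X)) \<le> m - t - card X" .
    have xle: "card X \<le> m - t" using sub inj by (metis card_atLeastLessThan card_image card_mono finite_atLeastLessThan)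
    have "real (m - t) * real (card X) \<le> real (m - ?f) * real (card X)" using insert.prems by (intro mult_right_mono) auto
    then have "(real (m - t) - card X) * real (m - ?f) \<le> real (m - t) * (real (m - ?f) - card X)"
      by (simp add: algebra_simps)
    then have "real (m - t) - card X \<le> real (m - t) / real (m - ?f) * (real (m - ?f) - card X)"
      using insert.prems by (simp add: field_simps)
    moreover have "card X \<le> m - ?f" using insert by simp
    ultimately have "real (m - t - card X) \<le> real (m - t) / real (m - ?f) * real (m - ?f - card X)"
      using of_nat_diff[OF xle, where 'a = real] of_nat_diff[of "card X" "m - ?f", where 'a = real] by presburger
    then show "real (card ((A x \<inter> {..<m}) - \<pi> ` (F \<union> X))) \<le> real (m - t) / real (m - ?f) * real (m - ?f - card X)"
      using e by linarith
  qed
  also have "\<dots> = real (m - t) / real (m - ?f) * real (m - ?f - card X) * real (card (placements A m (F \<union> X)))" by simp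
  also have "\<dots> \<le> real (m - t) / real (m - ?f) * real (m - ?f - card X) *
     (real (card (placements A m F)) * (real (m - t) / real (m - ?f)) ^ card X * (fact (m - ?f) / fact (m - ?f - card X)))"
    using insert by (intro mult_left_mono) auto
  also have "\<dots> = real (card (placements A m F)) * (real (m - t) / real (m - ?f)) ^ card (insert x X) * (fact (m - ?f) / fact (m - ?f - card (insert x X)))"
  proof -
    have "m - ?f - card X = Suc (m - ?f - card (insert x X))" using insert by simp
    then have "(fact (m - ?f - card X) :: real) = real (m - ?f - card X) * fact (m - ?f - card (insert x X))"
      by (metis fact_Suc of_nat_id)
    moreover have "real (m - ?f - card X) \<noteq> 0" using insert by simp
    ultimately show ?thesis using insert by simp
  qed
  finally show ?case .
qed

text \<open>
  The only probabilistic estimate on which the union bounds rest. The edges of F are placed first: each meets a fraction of at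
  most t1 / m of the free positions. Given where they are, each edge of X then avoids the first t0 positions with
  conditional probability at most (m - t0) / (m - card F), wherever F went. The bound thus holds although the two
  events are correlated, and it allows two different times.
\<close>

lemma prob_contain_avoid:
  assumes fin: "finite E" and sub: "F \<subseteq> E" "X \<subseteq> E" "F \<inter> X = {}" and t: "card F \<le> t0" "t0 \<le> card E" "t1 \<le> card E"
  shows "order_prob E (\<lambda>es. F \<subseteq> set (take t1 es) \<and> X \<inter> set (take t0 es) = {})
    \<le> (real t1 / card E) ^ card F * exp (- (real (card X) * (real t0 - card F) / card E))"
proof -
  let ?m = "card E" and ?f = "card F" and ?x = "card X"
  define A where "A e = (if e \<in> F then {..<t1} else if e \<in> X then {t0..} else (UNIV :: nat set))" for e
  have finF: "finite F" "finite X" using fin sub finite_subset by blast+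
  have le: "?f + ?x \<le> ?m" using sub fin finF by (metis card_Un_disjoint card_mono le_sup_iff)
  have "{es \<in> permutations_of_set E. F \<subseteq> set (take t1 es) \<and> X \<inter> set (take t0 es) = {}}
      \<subseteq> {es \<in> permutations_of_set E. \<forall>e\<in>E. pos es e \<in> A e}"
  proof clarify
    fix es e assume *: "es \<in> permutations_of_set E" "F \<subseteq> set (take t1 es)" "X \<inter> set (take t0 es) = {}" "e \<in> E"
    have d: "distinct es" "e \<in> set es" using * by (auto simp: permutations_of_set_def)
    show "pos es e \<in> A e" using * d in_take_iff_pos[OF d, of t1] in_take_iff_pos[OF d, of t0] by (auto simp: A_def)
  qed
  then have c: "card {es \<in> permutations_of_set E. F \<subseteq> set (take t1 es) \<and> X \<inter> set (take t0 es) = {}} \<le> card (placements A ?m E)"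
    unfolding card_orders_eq_placements[OF fin, symmetric] by (intro card_mono) auto
  have Fm: "real (card (placements A ?m F)) \<le> (real t1 / ?m) ^ ?f * (fact ?m / fact (?m - ?f))"
    using finF le t by (intro card_placements_early) (auto simp: A_def)
  have FX: "real (card (placements A ?m (F \<union> X))) \<le> (real t1 / ?m) ^ ?f * exp (- (real ?x * (real t0 - ?f) / ?m)) * (fact ?m / fact (?m - ?f - ?x))"
  proof (cases "?f < ?m")
    case True
    have base: "real (?m - t0) / real (?m - ?f) \<le> exp (- ((real t0 - ?f) / ?m))"
    proof -
      have "real (?m - t0) / real (?m - ?f) = 1 - (real t0 - ?f) / (real ?m - ?f)"
        using True t by (simp add: of_nat_diff field_simps)
      also have "\<dots> \<le> exp (- ((real t0 - ?f) / (real ?m - ?f)))"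
        using exp_ge_add_one_self[of "- ((real t0 - ?f) / (real ?m - ?f))"] by simp
      also have "\<dots> \<le> exp (- ((real t0 - ?f) / ?m))"
        using True t by (auto intro!: divide_left_mono mult_pos_pos)
      finally show ?thesis .
    qed
    have "real (card (placements A ?m (F \<union> X))) \<le> real (card (placements A ?m F)) * (real (?m - t0) / real (?m - ?f)) ^ ?x * (fact (?m - ?f) / fact (?m - ?f - ?x))"
      using finF sub le t True by (intro card_placements_late) (auto simp: A_def)
    also have "\<dots> \<le> real (card (placements A ?m F)) * exp (- ((real t0 - ?f) / ?m)) ^ ?x * (fact (?m - ?f) / fact (?m - ?f - ?x))"
      using base by (intro mult_right_mono mult_left_mono power_mono) auto
    also have "\<dots> \<le> ((real t1 / ?m) ^ ?f * (fact ?m / fact (?m - ?f))) * exp (- ((real t0 - ?f) / ?m)) ^ ?x * (fact (?m - ?f) / fact (?m - ?f - ?x))"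
      using Fm by (intro mult_right_mono) auto
    also have "\<dots> = (real t1 / ?m) ^ ?f * exp (- (real ?x * (real t0 - ?f) / ?m)) * (fact ?m / fact (?m - ?f - ?x))"
      by (simp add: exp_of_nat_mult[symmetric])
    finally show ?thesis .
  next
    case False
    then have "card X = 0" using le by linarith
    then have "X = {}" using finF by simp
    then show ?thesis using Fm by simp
  qed
  have FXE: "F \<union> X \<subseteq> E" using sub by auto
  have cFX: "card (F \<union> X) = ?f + ?x" using finF sub by (simp add: card_Un_disjoint)
  have "real (card (placements A ?m ((F \<union> X) \<union> (E - (F \<union> X))))) =
      real (card (placements A ?m (F \<union> X))) * (fact (?m - card (F \<union> X)) / fact (?m - card (F \<union> X) - card (E - (F \<union> X))))"
    using fin finF FXE by (intro card_placements_free) (auto simp: A_def card_Diff_subset card_mono)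
  moreover have "(F \<union> X) \<union> (E - (F \<union> X)) = E" using FXE by auto
  moreover have "?m - card (F \<union> X) - card (E - (F \<union> X)) = 0" using fin finF FXE by (simp add: card_Diff_subset)
  ultimately have "real (card (placements A ?m E)) = real (card (placements A ?m (F \<union> X))) * fact (?m - ?f - ?x)"
    using cFX by simp
  also have "\<dots> \<le> (real t1 / ?m) ^ ?f * exp (- (real ?x * (real t0 - ?f) / ?m)) * (fact ?m / fact (?m - ?f - ?x)) * fact (?m - ?f - ?x)"
    using FX by (intro mult_right_mono) auto
  also have "\<dots> = (real t1 / ?m) ^ ?f * exp (- (real ?x * (real t0 - ?f) / ?m)) * fact ?m" by simp
  finally have "real (card {es \<in> permutations_of_set E. F \<subseteq> set (take t1 es) \<and> X \<inter> set (take t0 es) = {}})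
      \<le> (real t1 / ?m) ^ ?f * exp (- (real ?x * (real t0 - ?f) / ?m)) * fact ?m" using c by linarith
  then show ?thesis using fin by (simp add: order_prob_card divide_le_eq)
qed

lemma card_placements_avoid:
  assumes "finite X" "t + card X \<le> m" "\<And>e. e \<in> X \<Longrightarrow> A e = {t..}"
  shows "real (card (placements A m X)) = (\<Prod>i<card X. real m - t - i)"
  using assms
proof (induction X rule: finite_induct)
  case empty
  then show ?case by (simp add: placements_empty)
next
  case (insert x X)
  have "real (card (placements A m (insert x X))) = (\<Sum>\<pi>\<in>placements A m X. real (card ((A x \<inter> {..<m}) - \<pi> ` X)))"
    using insert by (subst card_placements_insert) auto
  also have "\<dots> = (\<Sum>\<pi>\<in>placements A m X. real m - t - card X)"
  proof (rule sum.cong[OF refl])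
    fix \<pi> assume p: "\<pi> \<in> placements A m X"
    have inj: "inj_on \<pi> X" using p by (auto simp: placements_def inj_on_def)
    have sub: "\<pi> ` X \<subseteq> {t..<m}" using p insert.prems by (auto simp: placements_def)
    have "A x \<inter> {..<m} = {t..<m}" using insert.prems by auto
    then have "card ((A x \<inter> {..<m}) - \<pi> ` X) = m - t - card X"
      using sub inj insert.hyps by (simp add: card_Diff_subset card_image)
    then show "real (card ((A x \<inter> {..<m}) - \<pi> ` X)) = real m - t - card X"
      using insert by (simp add: of_nat_diff)
  qed
  finally show ?case using insert by simp
qed

lemma prod_real_diff_eq_fact:
  "x \<le> m \<Longrightarrow> (\<Prod>i<x. real m - real i) = fact m / fact (m - x)"
proof (induction x)
  case (Suc x)
  have "m - x = Suc (m - Suc x)" using Suc by simp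
  then have "(fact (m - x) :: real) = real (m - x) * fact (m - Suc x)" by (metis fact_Suc of_nat_id)
  then show ?case using Suc by (simp add: of_nat_diff)
qed simp

text \<open>
  For a single time the count is exact. The second moment argument needs lower bounds on such probabilities too.
\<close>

lemma prob_avoid_exact:
  assumes fin: "finite E" and sub: "X \<subseteq> E" and t: "t + card X \<le> card E"
  shows "order_prob E (\<lambda>es. X \<inter> set (take t es) = {}) = (\<Prod>i<card X. (real (card E) - t - i) / (real (card E) - i))"
proof -
  let ?m = "card E"
  define A where "A e = (if e \<in> X then {t..} else (UNIV :: nat set))" for e
  have "{es \<in> permutations_of_set E. X \<inter> set (take t es) = {}}
      = {es \<in> permutations_of_set E. \<forall>e\<in>E. pos es e \<in> A e}"
  proof -
    have "X \<inter> set (take t es) = {} \<longleftrightarrow> (\<forall>e\<in>E. pos es e \<in> A e)" if "es \<in> permutations_of_set E" for es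
    proof -
      have d: "distinct es" "set es = E" using that by (auto simp: permutations_of_set_def)
      have "e \<in> set (take t es) \<longleftrightarrow> pos es e < t" if "e \<in> X" for e
        using in_take_iff_pos[OF d(1), of e t] that sub d(2) by auto
      then show ?thesis using sub by (auto simp: A_def not_less)
    qed
    then show ?thesis by auto
  qed
  then have c: "card {es \<in> permutations_of_set E. X \<inter> set (take t es) = {}} = card (placements A ?m E)"
    using card_orders_eq_placements[OF fin] by simp
  have finX: "finite X" using sub fin finite_subset by blast
  have "real (card (placements A ?m (X \<union> (E - X)))) = real (card (placements A ?m X)) * (fact (?m - card X) / fact (?m - card X - card (E - X)))"
    using fin finX sub t by (intro card_placements_free) (auto simp: A_def card_Diff_subset card_mono)
  moreover have "X \<union> (E - X) = E" using sub by auto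
  moreover have "?m - card X - card (E - X) = 0" using fin finX sub by (simp add: card_Diff_subset)
  moreover have "real (card (placements A ?m X)) = (\<Prod>i<card X. real ?m - t - i)"
    using finX t by (intro card_placements_avoid) (auto simp: A_def)
  ultimately have "real (card (placements A ?m E)) = (\<Prod>i<card X. real ?m - t - i) * fact (?m - card X)" by simp
  then show ?thesis using c fin prod_real_diff_eq_fact[of "card X" ?m] t
    by (simp add: order_prob_card prod_dividef)
qed

section \<open>Rotations of longest paths\<close>

definition gpath :: "'a set set \<Rightarrow> 'a list \<Rightarrow> bool" where
  "gpath H vs \<longleftrightarrow> vs \<noteq> [] \<and> distinct vs \<and> successively (\<lambda>x y. {x, y} \<in> H) vs"

fun path_edges :: "'a list \<Rightarrow> 'a set set" where
  "path_edges (x # y # zs) = insert {x, y} (path_edges (y # zs))"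
| "path_edges _ = {}"

lemma path_edges_append:
  "path_edges (xs @ ys) = path_edges xs \<union> path_edges ys \<union>
     (if xs \<noteq> [] \<and> ys \<noteq> [] then {{last xs, hd ys}} else {})"
proof (induction xs rule: path_edges.induct)
  case (1 x y zs)
  then show ?case by auto
next
  case ("2_2" v)
  then show ?case by (cases ys) auto
qed auto

lemma path_edges_rev: "path_edges (rev xs) = path_edges xs"
proof (induction xs)
  case (Cons x xs)
  show ?case
  proof (cases xs)
    case (Cons y ys)
    have "path_edges (rev (x # xs)) = path_edges (rev xs @ [x])" by simp
    also have "\<dots> = path_edges (rev xs) \<union> {{y, x}}"
      unfolding path_edges_append using Cons by (simp add: last_rev)
    also have "\<dots> = path_edges (x # xs)" using Cons Cons.IH by (simp add: insert_commute)
    finally show ?thesis .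
  qed simp
qed simp

lemma path_edges_nth: "e \<in> path_edges xs \<Longrightarrow> \<exists>i. Suc i < length xs \<and> e = {xs ! i, xs ! Suc i}"
proof (induction xs rule: path_edges.induct)
  case (1 x y zs)
  then show ?case
  proof (cases "e = {x, y}")
    case True then show ?thesis by (intro exI[of _ 0]) auto
  next
    case False
    then obtain i where "Suc i < length (y # zs)" "e = {(y # zs) ! i, (y # zs) ! Suc i}" using 1 by auto
    then show ?thesis by (intro exI[of _ "Suc i"]) auto
  qed
qed auto

text \<open>
  Posa's rotations with the first vertex fixed: if y is a neighbour of the last vertex, reverse the part of the
  path after y. The vertex after y becomes the new end.
\<close>

inductive rotations :: "'a set set \<Rightarrow> 'a list \<Rightarrow> 'a list \<Rightarrow> bool" for H P where
  start: "rotations H P P"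
| rotate: "rotations H P (p @ y # q) \<Longrightarrow> q \<noteq> [] \<Longrightarrow> {y, last q} \<in> H \<Longrightarrow> rotations H P (p @ y # rev q)"

lemma rotations_path:
  assumes "rotations H P Q" "gpath H P"
  shows "gpath H Q \<and> set Q = set P \<and> hd Q = hd P"
  using assms
proof (induction rule: rotations.induct)
  case (rotate p y q)
  then have IH: "gpath H (p @ y # q)" "set (p @ y # q) = set P" "hd (p @ y # q) = hd P" by auto
  have "successively (\<lambda>x y. {x, y} \<in> H) (rev q)"
    using IH(1) by (auto simp: gpath_def successively_append_iff successively_Cons insert_commute)
  then have "gpath H (p @ y # rev q)"
    using IH(1) rotate(2,3) by (auto simp: gpath_def successively_append_iff successively_Cons hd_rev)
  moreover have "set (p @ y # rev q) = set P" using IH(2) by auto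
  moreover have "hd (p @ y # rev q) = hd P" using IH(3) by (cases p) auto
  ultimately show ?case by blast
qed auto

definition endpoints :: "'a set set \<Rightarrow> 'a list \<Rightarrow> 'a set" where
  "endpoints H P = {last Q | Q. rotations H P Q}"

lemma endpoints_memI: "rotations H P Q \<Longrightarrow> last Q \<in> endpoints H P"
  unfolding endpoints_def by blast

definition nbhd :: "'a set set \<Rightarrow> 'a set \<Rightarrow> 'a set" where
  "nbhd H S = {w. w \<notin> S \<and> (\<exists>v\<in>S. {v, w} \<in> H)}"

definition longest_path :: "'a set \<Rightarrow> 'a set set \<Rightarrow> 'a list \<Rightarrow> bool" where
  "longest_path V H P \<longleftrightarrow> gpath H P \<and> set P \<subseteq> V \<and> (\<forall>Q. gpath H Q \<longrightarrow> set Q \<subseteq> V \<longrightarrow> length Q \<le> length P)"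

text \<open>
  A rotation changes the path edges only at its pivot y, at the old end and at the new end. Both ends belong to
  the set of endpoints, and the new end is the path neighbour that y loses. A vertex which is neither an endpoint nor
  a neighbour on P of one is therefore never affected.
\<close>

lemma rotations_keep_edges:
  assumes "rotations H P Q" "x \<notin> endpoints H P" "\<not> (\<exists>s\<in>endpoints H P. {s, x} \<in> path_edges P)"
  shows "{e \<in> path_edges Q. x \<in> e} = {e \<in> path_edges P. x \<in> e}"
  using assms
proof (induction rule: rotations.induct)
  case (rotate p y q)
  let ?S = "endpoints H P"
  have new: "rotations H P (p @ y # rev q)" by (rule rotations.rotate[OF rotate(1,2,3)])
  have l: "last q \<in> ?S" using endpoints_memI[OF rotate(1)] rotate(2) by simp
  have h: "hd q \<in> ?S" using endpoints_memI[OF new] rotate(2) by (simp add: last_rev)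
  have IH: "{e \<in> path_edges (p @ y # q). x \<in> e} = {e \<in> path_edges P. x \<in> e}" using rotate by auto
  have pe1: "path_edges (p @ y # q) = path_edges (p @ [y]) \<union> path_edges q \<union> {{y, hd q}}"
    using rotate(2) path_edges_append[of "p @ [y]" q] by simp
  have pe2: "path_edges (p @ y # rev q) = path_edges (p @ [y]) \<union> path_edges q \<union> {{y, last q}}"
    using rotate(2) path_edges_append[of "p @ [y]" "rev q"] by (simp add: path_edges_rev hd_rev)
  have "x \<noteq> y"
  proof
    assume "x = y"
    then have "{y, hd q} \<in> {e \<in> path_edges P. x \<in> e}" using IH pe1 by auto
    then show False using h rotate.prems \<open>x = y\<close> by (auto simp: insert_commute)
  qed
  moreover have "x \<noteq> last q" "x \<noteq> hd q" using l h rotate.prems by auto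
  ultimately have "{e \<in> path_edges (p @ y # rev q). x \<in> e} = {e \<in> path_edges (p @ y # q). x \<in> e}"
    unfolding pe1 pe2 by blast
  then show ?case using IH by (rule trans)
qed auto

text \<open>
  A neighbour x of an endpoint lies on the path, since the path is longest. Rotating at x makes
  the successor of x an endpoint. If x were not next to an endpoint on P, then it would have kept its path edges,
  including the one to this successor.
\<close>

lemma nbhd_endpoints:
  assumes P: "longest_path V H P" and E: "\<And>e. e \<in> H \<Longrightarrow> e \<subseteq> V"
  shows "nbhd H (endpoints H P) \<subseteq> {x. \<exists>s\<in>endpoints H P. {s, x} \<in> path_edges P}"
proof
  fix x assume "x \<in> nbhd H (endpoints H P)"
  then obtain Q where x: "x \<notin> endpoints H P" and Q: "rotations H P Q" and b: "{last Q, x} \<in> H"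
    by (auto simp: nbhd_def endpoints_def)
  have QP: "gpath H Q" "set Q = set P" using rotations_path[OF Q] P by (auto simp: longest_path_def)
  have len: "length Q = length P" using QP P
    by (metis distinct_card gpath_def longest_path_def)
  have "x \<in> set Q"
  proof (rule ccontr)
    assume "x \<notin> set Q"
    then have "gpath H (Q @ [x])" using QP b by (auto simp: gpath_def successively_append_iff)
    moreover have "set (Q @ [x]) \<subseteq> V" using QP P E[OF b] by (auto simp: longest_path_def)
    ultimately show False using P len by (force simp: longest_path_def)
  qed
  then obtain p q where pq: "Q = p @ x # q" by (meson split_list)
  have "last Q \<in> endpoints H P" using Q by (auto simp: endpoints_def)
  then have "q \<noteq> []" using pq x by auto
  then have new: "rotations H P (p @ x # rev q)"
    using rotations.rotate[of H P p x q] Q b pq by (simp add: insert_commute)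
  then have z: "hd q \<in> endpoints H P"
    using endpoints_memI[OF new] \<open>q \<noteq> []\<close> by (simp add: last_rev)
  have in_Q: "{x, hd q} \<in> path_edges Q" using \<open>q \<noteq> []\<close> pq path_edges_append[of "p @ [x]" q] by simp
  show "x \<in> {x. \<exists>s\<in>endpoints H P. {s, x} \<in> path_edges P}"
  proof (rule ccontr)
    assume "x \<notin> {x. \<exists>s\<in>endpoints H P. {s, x} \<in> path_edges P}"
    then have "{x, hd q} \<in> path_edges P" using rotations_keep_edges[OF Q x] in_Q by auto
    then show False using z \<open>x \<notin> {x. \<exists>s\<in>endpoints H P. {s, x} \<in> path_edges P}\<close> by (auto simp: insert_commute)
  qed
qed

text \<open>
  Each vertex of S contributes its predecessor and its successor, and the last vertex of P has no
  successor; hence the strict inequality.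
\<close>

lemma card_path_neighbours:
  assumes d: "distinct P" and S: "S \<subseteq> set P" "last P \<in> S"
  shows "finite {x. \<exists>s\<in>S. {s, x} \<in> path_edges P}" "card {x. \<exists>s\<in>S. {s, x} \<in> path_edges P} < 2 * card S"
proof -
  define I where "I = {i. i < length P \<and> P ! i \<in> S}"
  have finI: "finite I" unfolding I_def by auto
  have "bij_betw (\<lambda>i. P ! i) I S"
    unfolding bij_betw_def
  proof
    show "inj_on (\<lambda>i. P ! i) I" unfolding I_def using d by (auto simp: inj_on_def nth_eq_iff_index_eq)
    show "(\<lambda>i. P ! i) ` I = S"
    proof (intro equalityI subsetI)
      fix s assume "s \<in> S"
      then obtain i where "i < length P" "s = P ! i" using S by (metis in_set_conv_nth subsetD)
      then show "s \<in> (\<lambda>i. P ! i) ` I" using \<open>s \<in> S\<close> by (auto simp: I_def)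
    qed (auto simp: I_def)
  qed
  then have cI: "card I = card S" by (rule bij_betw_same_card)
  have "P \<noteq> []" using S by auto
  then have lI: "length P - 1 \<in> I" using S by (auto simp: I_def last_conv_nth)
  have sub: "{x. \<exists>s\<in>S. {s, x} \<in> path_edges P} \<subseteq> (\<lambda>i. P ! Suc i) ` (I - {length P - 1}) \<union> (\<lambda>i. P ! (i - 1)) ` I"
  proof clarify
    fix x s assume "s \<in> S" "{s, x} \<in> path_edges P" and no: "x \<notin> (\<lambda>i. P ! (i - 1)) ` I"
    then obtain i where i: "Suc i < length P" "{s, x} = {P ! i, P ! Suc i}" using path_edges_nth by blast
    then have "(s = P ! i \<and> x = P ! Suc i) \<or> (s = P ! Suc i \<and> x = P ! i)" by (auto simp: doubleton_eq_iff)
    then show "x \<in> (\<lambda>i. P ! Suc i) ` (I - {length P - 1})"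
    proof
      assume "s = P ! i \<and> x = P ! Suc i"
      then show ?thesis using i \<open>s \<in> S\<close> by (intro image_eqI[of _ _ i]) (auto simp: I_def)
    next
      assume a: "s = P ! Suc i \<and> x = P ! i"
      then have "Suc i \<in> I" using i \<open>s \<in> S\<close> by (auto simp: I_def)
      then have "x \<in> (\<lambda>i. P ! (i - 1)) ` I" using a by (intro image_eqI[of _ _ "Suc i"]) auto
      then show ?thesis using no by blast
    qed
  qed
  then show "finite {x. \<exists>s\<in>S. {s, x} \<in> path_edges P}" using finI finite_subset by blast
  have "card {x. \<exists>s\<in>S. {s, x} \<in> path_edges P} \<le> card ((\<lambda>i. P ! Suc i) ` (I - {length P - 1}) \<union> (\<lambda>i. P ! (i - 1)) ` I)"
    using sub finI by (intro card_mono) auto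
  also have "\<dots> \<le> card ((\<lambda>i. P ! Suc i) ` (I - {length P - 1})) + card ((\<lambda>i. P ! (i - 1)) ` I)" by (rule card_Un_le)
  also have "\<dots> \<le> card (I - {length P - 1}) + card I" using finI by (intro add_mono card_image_le) auto
  also have "\<dots> < 2 * card S" using card_Diff1_less[OF finI lI] cI by linarith
  finally show "card {x. \<exists>s\<in>S. {s, x} \<in> path_edges P} < 2 * card S" .
qed

text \<open>
  Posa's lemma: the set of endpoints expands by a factor less than two, so in a graph whose small sets expand by
  a factor two it must be large.
\<close>

lemma posa_lemma:
  assumes P: "longest_path V H P" and E: "\<And>e. e \<in> H \<Longrightarrow> e \<subseteq> V"
  shows "card (nbhd H (endpoints H P)) < 2 * card (endpoints H P)"
    and "endpoints H P \<subseteq> set P" and "endpoints H P \<noteq> {}"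
proof -
  have g: "gpath H P" using P by (simp add: longest_path_def)
  show sub: "endpoints H P \<subseteq> set P"
  proof
    fix x assume "x \<in> endpoints H P"
    then obtain Q where "rotations H P Q" "x = last Q" by (auto simp: endpoints_def)
    then show "x \<in> set P" using rotations_path[OF _ g, of Q] last_in_set[of Q] by (auto simp: gpath_def)
  qed
  have l: "last P \<in> endpoints H P" using endpoints_memI[OF rotations.start] .
  then show "endpoints H P \<noteq> {}" by auto
  have "card (nbhd H (endpoints H P)) \<le> card {x. \<exists>s\<in>endpoints H P. {s, x} \<in> path_edges P}"
    using nbhd_endpoints[OF P E] card_path_neighbours(1)[OF _ sub l] g by (intro card_mono) (auto simp: gpath_def)
  also have "\<dots> < 2 * card (endpoints H P)" using card_path_neighbours(2)[OF _ sub l] g by (auto simp: gpath_def)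
  finally show "card (nbhd H (endpoints H P)) < 2 * card (endpoints H P)" .
qed

lemma cycle_of_path:
  assumes c: "gpath H c" "{last c, hd c} \<in> H" "3 \<le> length c" "set c \<subseteq> V"
  shows "is_cycle (V, H) c"
  unfolding is_cycle_def
proof (intro conjI allI impI)
  fix i assume i: "i < length c"
  show "{c ! i, c ! (Suc i mod length c)} \<in> edges (V, H)"
  proof (cases "Suc i < length c")
    case True
    then show ?thesis using c(1) by (auto simp: gpath_def dest: successively_nth)
  next
    case False
    then have "i = length c - 1" using i by simp
    then show ?thesis using c i by (auto simp: last_conv_nth hd_conv_nth gpath_def)
  qed
qed (use c in \<open>auto simp: gpath_def\<close>)

text \<open>
  Cutting the cycle open next to a vertex with a neighbour w outside leaves a path that continues to w.
\<close>

lemma extend_cycle: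
  assumes c: "gpath H c" "{last c, hd c} \<in> H" and x: "x \<in> set c" "w \<notin> set c" "{x, w} \<in> H"
  shows "\<exists>Q. gpath H Q \<and> set Q = insert w (set c) \<and> length Q = Suc (length c)"
proof -
  obtain c1 c2 where "c = c1 @ x # c2" using x by (meson split_list)
  then obtain A where A: "c = A @ c2" "A \<noteq> []" "last A = x" by (intro that[of "c1 @ [x]"]) auto
  have "gpath H (c2 @ A @ [w])"
  proof (cases "c2 = []")
    case True
    then show ?thesis using c(1) x A by (auto simp: gpath_def successively_append_iff)
  next
    case False
    then have "{last c2, hd A} \<in> H" using c(2) A by simp
    then show ?thesis using False c(1) x A by (auto simp: gpath_def successively_append_iff)
  qed
  moreover have "set (c2 @ A @ [w]) = insert w (set c)" using A by auto
  moreover have "length (c2 @ A @ [w]) = Suc (length c)" using A by auto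
  ultimately show ?thesis by blast
qed

text \<open>
  The closing move of Dirac's theorem: cut the path into p and r, and join the last vertex of r to the last
  vertex of p and the two first vertices to each other.
\<close>

lemma crossing_cycle:
  assumes Q: "gpath H (p @ r)" and ne: "p \<noteq> []" "r \<noteq> []"
    and e: "{last r, last p} \<in> H" "{hd p, hd r} \<in> H"
  shows "gpath H (p @ rev r)" "{last (p @ rev r), hd (p @ rev r)} \<in> H"
proof -
  have "successively (\<lambda>x y. {x, y} \<in> H) (rev r)"
    unfolding successively_rev using Q by (simp add: gpath_def successively_append_iff insert_commute)
  then show "gpath H (p @ rev r)"
    using Q ne e(1) by (auto simp: gpath_def successively_append_iff hd_rev insert_commute)
  show "{last (p @ rev r), hd (p @ rev r)} \<in> H"
    using e(2) ne by (simp add: last_rev insert_commute)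
qed

section \<open>Crossings and boosters in a Dirac host\<close>

lemma split_at_unique:
  assumes "distinct (p @ y # r)" "p @ y # r = p' @ y # r'"
  shows "p = p' \<and> r = r'"
proof -
  have "takeWhile (\<lambda>x. x \<noteq> y) (p @ y # r) = p"
    using assms(1) by (subst takeWhile_append2) auto
  moreover have "takeWhile (\<lambda>x. x \<noteq> y) (p' @ y # r') = p'"
    using assms(1) unfolding assms(2) by (subst takeWhile_append2) auto
  ultimately have "p = p'" using assms(2) by simp
  then show ?thesis using assms(2) by simp
qed

text \<open>
  Passing from ordered pairs of vertices to edges costs a factor two. This is applied with lower bounds on the number of pairs.
\<close>

lemma card_ordered_pairs_le:
  assumes "finite X"
  shows "card {(u, v). {u, v} \<in> X} \<le> 2 * card X" "finite {(u, v). {u, v} \<in> X}"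
proof -
  have two: "finite {(u, v). {u, v} = e} \<and> card {(u, v). {u, v} = e} \<le> 2" for e :: "'a set"
  proof (cases "\<exists>a b. e = {a, b}")
    case True
    then obtain a b where "e = {a, b}" by blast
    then have "{(u, v). {u, v} = e} \<subseteq> {(a, b), (b, a)}" by (auto simp: doubleton_eq_iff)
    then have sub: "{(u, v). {u, v} = e} \<subseteq> set [(a, b), (b, a)]" by simp
    then have "card {(u, v). {u, v} = e} \<le> card (set [(a, b), (b, a)])" by (rule card_mono[rotated]) simp
    moreover have "card (set [(a, b), (b, a)]) \<le> 2" using card_length[of "[(a, b), (b, a)]"] by simp
    ultimately show ?thesis using finite_subset[OF sub] by simp
  next
    case False
    then have "{(u, v). {u, v} = e} = {}" by auto
    then show ?thesis by simp
  qed
  have U: "{(u, v). {u, v} \<in> X} = (\<Union>e\<in>X. {(u, v). {u, v} = e})" by auto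
  show "finite {(u, v). {u, v} \<in> X}" unfolding U using assms two by blast
  have "card {(u, v). {u, v} \<in> X} \<le> (\<Sum>e\<in>X. card {(u, v). {u, v} = e})"
    unfolding U by (rule card_UN_le[OF assms])
  also have "\<dots> \<le> (\<Sum>e\<in>X. 2)" using two by (intro sum_mono) auto
  finally show "card {(u, v). {u, v} \<in> X} \<le> 2 * card X" by simp
qed

text \<open>
  The bound 24 \<le> n ensures that a path with more than n / 8 endpoints has at least three vertices, as a cycle
  must have.
\<close>

locale dirac_host =
  fixes V :: "'a set" and E :: "'a set set" and \<epsilon> :: real and n :: nat
  assumes finite_V: "finite V" and card_V: "card V = n"
    and simple: "\<And>e. e \<in> E \<Longrightarrow> e \<subseteq> V \<and> card e = 2"
    and eps: "0 < \<epsilon>" "\<epsilon> \<le> 1 / 4"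
    and host_degree: "\<And>v. v \<in> V \<Longrightarrow> (1 / 2 + \<epsilon>) * n \<le> real (card {z. {v, z} \<in> E})"
    and large: "24 \<le> n"
begin

lemma finite_E: "finite E"
  using simple finite_V by (intro finite_subset[of E "Pow V"]) auto

lemma host_nbrs: "{z. {v, z} \<in> E} \<subseteq> V - {v}"
  using simple by (fastforce simp: card_2_iff)

lemma finite_host_nbrs: "finite {z. {v, z} \<in> E}"
  using host_nbrs finite_V by (meson finite_Diff finite_subset)

text \<open>
  D is good for H if adding it makes H Hamiltonian or lengthens its longest paths.
\<close>

definition improves :: "'a set set \<Rightarrow> 'a set set \<Rightarrow> bool" where
  "improves H D \<longleftrightarrow> hamiltonian (V, H \<union> D) \<or>
     (\<exists>Q. gpath (H \<union> D) Q \<and> set Q \<subseteq> V \<and> (\<forall>P. gpath H P \<longrightarrow> set P \<subseteq> V \<longrightarrow> length P < length Q))"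

lemma gpath_mono: "gpath H Q \<Longrightarrow> H \<subseteq> H' \<Longrightarrow> gpath H' Q"
  unfolding gpath_def by (auto elim: successively_mono)

lemma hamiltonian_mono: "hamiltonian (V, H) \<Longrightarrow> H \<subseteq> H' \<Longrightarrow> hamiltonian (V, H')"
  unfolding hamiltonian_def is_cycle_def by auto

lemma improves_mono:
  assumes "improves H D" "D \<subseteq> D'"
  shows "improves H D'"
proof -
  have sub: "H \<union> D \<subseteq> H \<union> D'" using assms(2) by auto
  show ?thesis using assms(1) hamiltonian_mono[OF _ sub] gpath_mono[OF _ sub] unfolding improves_def by blast
qed

text \<open>
  The last condition states that H is connected; it lets a cycle that misses a vertex be turned into a longer path.
\<close>

definition expander :: "'a set set \<Rightarrow> bool" where
  "expander H \<longleftrightarrow> H \<subseteq> E \<and>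
     (\<forall>S\<subseteq>V. S \<noteq> {} \<longrightarrow> 8 * card S \<le> n \<longrightarrow> 2 * card S \<le> card (nbhd H S)) \<and>
     (\<forall>S\<subseteq>V. S \<noteq> {} \<longrightarrow> S \<noteq> V \<longrightarrow> nbhd H S \<noteq> {})"

lemma expander_edges: "expander H \<Longrightarrow> e \<in> H \<Longrightarrow> e \<subseteq> V"
  using simple by (auto simp: expander_def)

lemma many_endpoints:
  assumes "expander H" "longest_path V H P"
  shows "n < 8 * card (endpoints H P)"
proof (rule ccontr)
  assume "\<not> n < 8 * card (endpoints H P)"
  moreover have "endpoints H P \<subseteq> V"
    using posa_lemma(2)[OF assms(2) expander_edges[OF assms(1)]] assms(2) by (auto simp: longest_path_def)
  ultimately have "2 * card (endpoints H P) \<le> card (nbhd H (endpoints H P))"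
    using assms posa_lemma(3)[OF assms(2) expander_edges[OF assms(1)]] by (simp add: expander_def)
  then show False using posa_lemma(1)[OF assms(2) expander_edges[OF assms(1)]] by simp
qed

lemma longest_path_longest:
  "longest_path V H P \<Longrightarrow> gpath H Q \<Longrightarrow> set Q = set P \<Longrightarrow> longest_path V H Q"
  by (metis distinct_card gpath_def longest_path_def)

lemma improves_leaving:
  assumes Q: "longest_path V H Q" and z: "z \<in> V" "z \<notin> set Q" "{hd Q, z} \<in> D"
  shows "improves H D"
proof -
  have "gpath (H \<union> D) Q" using Q gpath_mono[of H Q "H \<union> D"] by (auto simp: longest_path_def)
  then have "gpath (H \<union> D) (z # Q)"
    using z by (auto simp: gpath_def successively_Cons insert_commute)
  moreover have "set (z # Q) \<subseteq> V" using Q z by (auto simp: longest_path_def)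
  moreover have "\<forall>P. gpath H P \<longrightarrow> set P \<subseteq> V \<longrightarrow> length P < length (z # Q)"
    using Q by (force simp: longest_path_def)
  ultimately show ?thesis unfolding improves_def by blast
qed

text \<open>
  The two edges close a longest path Q to a cycle on the same vertices. Either this is a Hamilton
  cycle, or by connectivity some edge of H leaves it and yields a path with one more vertex.
\<close>

lemma improves_closing:
  assumes H: "expander H" and Q: "longest_path V H Q" and ne: "Q = p @ r" "p \<noteq> []" "r \<noteq> []"
    and e: "{last r, last p} \<in> H \<union> D" "{hd p, hd r} \<in> H \<union> D" and len: "3 \<le> length Q"
  shows "improves H D"
proof -
  let ?c = "p @ rev r"
  have "gpath (H \<union> D) (p @ r)" using Q gpath_mono[of H Q "H \<union> D"] ne by (auto simp: longest_path_def)
  then have c: "gpath (H \<union> D) ?c" "{last ?c, hd ?c} \<in> H \<union> D"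
    using crossing_cycle[OF _ ne(2,3) e] by blast+
  have s: "set ?c = set Q" "length ?c = length Q" using ne by auto
  show ?thesis
  proof (cases "set Q = V")
    case True
    then have "is_cycle (V, H \<union> D) ?c"
      using c s len by (intro cycle_of_path) auto
    then show ?thesis using True s by (auto simp: improves_def hamiltonian_def)
  next
    case False
    have "set Q \<subseteq> V" "set Q \<noteq> {}" using Q by (auto simp: longest_path_def gpath_def)
    then have "nbhd H (set Q) \<noteq> {}" using False H by (auto simp: expander_def)
    then obtain x w where xw: "x \<in> set Q" "w \<notin> set Q" "{x, w} \<in> H" by (auto simp: nbhd_def)
    have "w \<in> V" using expander_edges[OF H xw(3)] by auto
    obtain Q' where Q': "gpath (H \<union> D) Q'" "set Q' = insert w (set ?c)" "length Q' = Suc (length ?c)"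
      using extend_cycle[OF c, of x w] xw s by auto
    have "set Q' \<subseteq> V" using Q' s \<open>w \<in> V\<close> \<open>set Q \<subseteq> V\<close> by auto
    moreover have "\<forall>P. gpath H P \<longrightarrow> set P \<subseteq> V \<longrightarrow> length P < length Q'"
      using Q Q'(3) s by (force simp: longest_path_def)
    ultimately show ?thesis using Q'(1) unfolding improves_def by blast
  qed
qed

text \<open>
  The vertices z for which one more edge at the last vertex of Q makes the edge from hd Q to z useful. A vertex z outside
  the path needs no further edge.
\<close>

definition crossings :: "'a list \<Rightarrow> 'a set" where
  "crossings Q = {z. {hd Q, z} \<in> E \<and> (z \<notin> set Q \<or> (\<exists>p y q. Q = p @ y # z # q \<and> {last Q, y} \<in> E))}"

text \<open>
  Dirac's count. The successors J of the neighbours of the last vertex b and the neighbours of the first vertex a on the path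
  share the vertices of the path; the neighbours of b outside the path are no more than the vertices that
  the path misses, and those of a outside count in full. So at most n vertices share deg a + deg b
  \<ge> (1 + 2\<epsilon>) n incidences.
\<close>

lemma card_crossings:
  assumes Q: "distinct Q" "Q \<noteq> []" "set Q \<subseteq> V"
  shows "2 * \<epsilon> * n \<le> card (crossings Q)"
proof -
  let ?a = "hd Q" and ?b = "last Q"
  let ?Na = "{z. {?a, z} \<in> E}" and ?Nb = "{z. {?b, z} \<in> E}"
  define I where "I = {i. Suc i < length Q \<and> {?b, Q ! i} \<in> E}"
  define J where "J = (\<lambda>i. Q ! Suc i) ` I"
  have finI: "finite I" unfolding I_def by (rule finite_subset[of _ "{..<length Q}"]) auto
  have "card J = card I"
    unfolding J_def by (rule card_image) (use Q in \<open>auto simp: inj_on_def I_def nth_eq_iff_index_eq\<close>)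
  moreover have "(\<lambda>i. Q ! i) ` I = ?Nb \<inter> set Q"
  proof (intro equalityI subsetI)
    fix x assume x: "x \<in> ?Nb \<inter> set Q"
    then obtain i where i: "i < length Q" "x = Q ! i" by (metis IntD2 in_set_conv_nth)
    have "x \<noteq> ?b" using x host_nbrs[of ?b] by auto
    then have "Suc i < length Q" using i Q by (metis Suc_lessI diff_Suc_1 last_conv_nth)
    then show "x \<in> (\<lambda>i. Q ! i) ` I" using i x by (auto simp: I_def)
  qed (auto simp: I_def)
  moreover have "card ((\<lambda>i. Q ! i) ` I) = card I"
    by (rule card_image) (use Q in \<open>auto simp: inj_on_def I_def nth_eq_iff_index_eq\<close>)
  ultimately have cJ: "card J = card (?Nb \<inter> set Q)" by simp
  have Jsub: "J \<subseteq> set Q" by (auto simp: J_def I_def)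
  have sub: "(?Na - set Q) \<union> (?Na \<inter> J) \<subseteq> crossings Q"
  proof
    fix z assume "z \<in> (?Na - set Q) \<union> (?Na \<inter> J)"
    then consider "z \<in> ?Na - set Q" | i where "z \<in> ?Na" "Suc i < length Q" "{?b, Q ! i} \<in> E" "z = Q ! Suc i"
      by (auto simp: J_def I_def)
    then show "z \<in> crossings Q"
    proof cases
      case 2
      then have "Q = take i Q @ Q ! i # z # drop (Suc (Suc i)) Q"
        by (metis Cons_nth_drop_Suc Suc_lessD id_take_nth_drop)
      then show ?thesis using 2 unfolding crossings_def by blast
    qed (auto simp: crossings_def)
  qed
  have finQ: "finite (set Q)" by simp
  have fa: "finite ?Na" "finite ?Nb" by (rule finite_host_nbrs)+
  have "card (?Na - set Q) + card (?Na \<inter> set Q) = card ?Na"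
    using fa by (metis Int_commute card_Diff_subset_Int add.commute card_Int_Diff)
  moreover have "card (?Nb - set Q) + card (?Nb \<inter> set Q) = card ?Nb"
    using fa by (metis Int_commute card_Diff_subset_Int add.commute card_Int_Diff)
  moreover have "card (?Nb - set Q) + card (set Q) \<le> n"
  proof -
    have "card (?Nb - set Q) + card (set Q) = card ((?Nb - set Q) \<union> set Q)"
      using fa by (subst card_Un_disjoint) auto
    also have "\<dots> \<le> card V" using host_nbrs Q finite_V by (intro card_mono) auto
    finally show ?thesis by (simp add: card_V)
  qed
  moreover have "card (?Na \<inter> set Q) + card J \<le> card (set Q) + card (?Na \<inter> J)"
  proof -
    have "card (?Na \<inter> set Q) + card J = card ((?Na \<inter> set Q) \<union> J) + card ((?Na \<inter> set Q) \<inter> J)"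
      by (rule card_Un_Int) (use finI J_def in auto)
    also have "(?Na \<inter> set Q) \<inter> J = ?Na \<inter> J" using Jsub by auto
    also have "card ((?Na \<inter> set Q) \<union> J) \<le> card (set Q)" using Jsub by (intro card_mono) auto
    finally show ?thesis by simp
  qed
  moreover have "card (?Na - set Q) + card (?Na \<inter> J) \<le> card (crossings Q)"
  proof -
    have "card (?Na - set Q) + card (?Na \<inter> J) = card ((?Na - set Q) \<union> (?Na \<inter> J))"
      using fa Jsub by (subst card_Un_disjoint) auto
    also have "\<dots> \<le> card (crossings Q)"
      using sub fa by (intro card_mono) (auto simp: crossings_def)
    finally show ?thesis .
  qed
  ultimately have "card ?Na + card ?Nb \<le> card (crossings Q) + n" using cJ by linarith
  then have "real (card ?Na) + real (card ?Nb) \<le> real (card (crossings Q)) + n" by linarith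
  moreover have "(1 / 2 + \<epsilon>) * n \<le> card ?Na" "(1 / 2 + \<epsilon>) * n \<le> card ?Nb"
    using host_degree[of ?a] host_degree[of ?b] Q hd_in_set[OF Q(2)] last_in_set[OF Q(2)] by blast+
  ultimately have "(1 / 2 + \<epsilon>) * n + (1 / 2 + \<epsilon>) * n \<le> real (card (crossings Q)) + n" by linarith
  then show ?thesis by (simp add: algebra_simps)
qed

text \<open>
  Double counting of the pairs (s, z) with z \<in> C s: on average z serves a 2\<epsilon> fraction of S, and the z that serve
  less than an \<epsilon> fraction account for at most half of all pairs.
\<close>

lemma popular_crossings:
  fixes S :: "'a set" and C :: "'a \<Rightarrow> 'a set"
  assumes S: "finite S" "S \<noteq> {}" and N: "finite N" "card N \<le> n"
    and C: "\<And>s. s \<in> S \<Longrightarrow> C s \<subseteq> N \<and> 2 * \<epsilon> * n \<le> card (C s)"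
  shows "\<epsilon> * n \<le> card {z \<in> N. \<epsilon> * card S \<le> card {s \<in> S. z \<in> C s}}"
proof -
  let ?Z = "{z \<in> N. \<epsilon> * card S \<le> card {s \<in> S. z \<in> C s}}"
  have "real (card S) * (2 * \<epsilon> * n) \<le> (\<Sum>s\<in>S. real (card (C s)))"
    using sum_bounded_below[of S "2 * \<epsilon> * n" "\<lambda>s. real (card (C s))"] C by simp
  also have "\<dots> = (\<Sum>s\<in>S. \<Sum>z\<in>N. if z \<in> C s then 1 else 0)"
  proof (rule sum.cong[OF refl])
    fix s assume "s \<in> S"
    then have "{z \<in> N. z \<in> C s} = C s" using C by auto
    then show "real (card (C s)) = (\<Sum>z\<in>N. if z \<in> C s then 1 else 0)"
      using N by (simp add: sum.If_cases Int_def)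
  qed
  also have "\<dots> = (\<Sum>z\<in>N. \<Sum>s\<in>S. if z \<in> C s then 1 else 0)" by (rule sum.swap)
  also have "\<dots> = (\<Sum>z\<in>N. real (card {s \<in> S. z \<in> C s}))"
    using S by (simp add: sum.If_cases Int_def)
  also have "\<dots> \<le> (\<Sum>z\<in>N. (if z \<in> ?Z then real (card S) else 0) + \<epsilon> * card S)"
  proof (rule sum_mono)
    fix z assume "z \<in> N"
    have "card {s \<in> S. z \<in> C s} \<le> card S" using S by (intro card_mono) auto
    then show "real (card {s \<in> S. z \<in> C s}) \<le> (if z \<in> ?Z then real (card S) else 0) + \<epsilon> * card S"
      using \<open>z \<in> N\<close> eps by (auto intro: add_increasing2)
  qed
  also have "\<dots> = card ?Z * real (card S) + card N * (\<epsilon> * card S)"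
    using N by (simp add: sum.distrib sum.If_cases Int_def)
  also have "\<dots> \<le> card ?Z * real (card S) + n * (\<epsilon> * card S)"
    using N eps by (intro add_left_mono mult_right_mono) auto
  finally have "real (card S) * (\<epsilon> * n) \<le> real (card S) * card ?Z" by (simp add: algebra_simps)
  moreover have "0 < real (card S)" using S by (simp add: card_gt_0_iff)
  ultimately show ?thesis by (simp del: mult_le_cancel_left add: mult_le_cancel_left_pos)
qed

text \<open>
  What Posa's rotations and Dirac's count provide for a graph H. The set A consists of ends of longest paths, and
  w a z of the host edges e for which adding e and {a, z} improves H. The last clause bounds the number of distinct edges
  in such sets from below, since the chance that a random graph misses all of them depends on that number.
\<close>

definition booster_structure :: "'a set set \<Rightarrow> 'a set \<Rightarrow> ('a \<Rightarrow> 'a \<Rightarrow> 'a set set) \<Rightarrow> bool" where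
  "booster_structure H A w \<longleftrightarrow> A \<subseteq> V \<and> n < 8 * card A \<and>
     (\<forall>a\<in>A. \<forall>z. w a z \<subseteq> E \<and> (\<forall>e\<in>w a z. {a, z} \<in> E \<longrightarrow> improves H {e, {a, z}})) \<and>
     (\<forall>a\<in>A. \<exists>Z\<subseteq>{z. {a, z} \<in> E}. \<epsilon> * n \<le> card Z \<and>
        (\<forall>Y\<subseteq>{z \<in> Z. \<not> improves H {{a, z}}}. \<epsilon> * n / 16 * card Y \<le> card (\<Union>z\<in>Y. w a z)))"

text \<open>
  Every endpoint a of a longest path P is the start of a longest path on the same vertices, which is rotated
  again with a fixed; this gives the ends S a and the paths Q a s. An edge of w a z joins an end s to the
  predecessor of z on Q a s. For fixed a, the pair (s, predecessor) determines z, because s determines the path,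
  so that different pairs (z, s) give different ordered pairs and at most two of them give the same edge.
\<close>

lemma booster_structure_exists:
  assumes H: "expander H" and P: "longest_path V H P"
  shows "\<exists>A w. booster_structure H A w"
proof -
  define A where "A = endpoints H P"
  note HV = expander_edges[OF H]
  have gP: "gpath H P" "set P \<subseteq> V" using P by (auto simp: longest_path_def)
  have AV: "A \<subseteq> V" using posa_lemma(2)[OF P HV] gP by (auto simp: A_def)
  have "\<forall>a\<in>A. \<exists>R. rotations H P R \<and> last R = a" by (auto simp: A_def endpoints_def)
  then obtain R where R: "\<And>a. a \<in> A \<Longrightarrow> rotations H P (R a) \<and> last (R a) = a" by metis
  define B where "B a = rev (R a)" for a
  have B: "longest_path V H (B a)" "set (B a) = set P" "hd (B a) = a" if "a \<in> A" for a
  proof -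
    have 1: "gpath H (R a)" "set (R a) = set P" using R[OF that] rotations_path[OF _ gP(1)] by blast+
    then have "gpath H (B a)" by (auto simp: B_def gpath_def insert_commute)
    then show "longest_path V H (B a)" using longest_path_longest[OF P] 1 by (simp add: B_def)
    show "set (B a) = set P" using 1 by (simp add: B_def)
    show "hd (B a) = a" using R[OF that] 1 by (simp add: B_def hd_rev gpath_def)
  qed
  define S where "S a = endpoints H (B a)" for a
  define Q where "Q a s = (SOME Q. rotations H (B a) Q \<and> last Q = s)" for a s
  have Q: "rotations H (B a) (Q a s) \<and> last (Q a s) = s" if "s \<in> S a" for a s
    unfolding Q_def by (rule someI_ex) (use that in \<open>auto simp: S_def endpoints_def\<close>)
  have Qp: "longest_path V H (Q a s)" "set (Q a s) = set P" "hd (Q a s) = a" "last (Q a s) = s"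
    "distinct (Q a s)" "Q a s \<noteq> []" if "a \<in> A" "s \<in> S a" for a s
  proof -
    have g: "gpath H (B a)" using B(1)[OF that(1)] by (simp add: longest_path_def)
    have 1: "gpath H (Q a s)" "set (Q a s) = set (B a)" "hd (Q a s) = hd (B a)"
      using Q[OF that(2)] rotations_path[OF _ g] by blast+
    then show "longest_path V H (Q a s)" using longest_path_longest[OF B(1)[OF that(1)]] by blast
    show "set (Q a s) = set P" "hd (Q a s) = a" "last (Q a s) = s" using 1 B[OF that(1)] Q[OF that(2)] by auto
    show "distinct (Q a s)" "Q a s \<noteq> []" using 1 by (auto simp: gpath_def)
  qed
  have SP: "S a \<subseteq> set P" "finite (S a)" "n < 8 * card (S a)" if "a \<in> A" for a
  proof -
    show "S a \<subseteq> set P" using posa_lemma(2)[OF B(1)[OF that] HV] B(2)[OF that] by (simp add: S_def)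
    then show "finite (S a)" by (rule finite_subset) simp
    show "n < 8 * card (S a)" using many_endpoints[OF H B(1)[OF that]] by (simp add: S_def)
  qed
  have len: "3 \<le> length (Q a s)" if "a \<in> A" "s \<in> S a" for a s
  proof -
    have "card (S a) \<le> card (set P)" using SP(1)[OF that(1)] by (intro card_mono) auto
    also have "\<dots> = length (Q a s)" using Qp(2,5)[OF that] by (metis distinct_card)
    finally show ?thesis using SP(3)[OF that(1)] large by linarith
  qed
  define w where "w a z = {e \<in> E. \<exists>s\<in>S a. \<exists>p y q. Q a s = p @ y # z # q \<and> e = {s, y}}" for a z
  have imp: "improves H {e, {a, z}}" if a: "a \<in> A" and e: "e \<in> w a z" for a z e
  proof -
    obtain s p y q where s: "s \<in> S a" "Q a s = p @ y # z # q" "e = {s, y}" using e by (auto simp: w_def)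
    note q = Qp[OF a s(1)]
    have "last (z # q) = s" using q(4) s(2) by simp
    moreover have "hd (p @ [y]) = a" using q(3) s(2) by (cases p) auto
    ultimately show ?thesis
      using len[OF a s(1)] s by (intro improves_closing[OF H q(1), of "p @ [y]" "z # q"]) auto
  qed
  have main: "\<exists>Z\<subseteq>{z. {a, z} \<in> E}. \<epsilon> * n \<le> card Z \<and>
        (\<forall>Y\<subseteq>{z \<in> Z. \<not> improves H {{a, z}}}. \<epsilon> * n / 16 * card Y \<le> card (\<Union>z\<in>Y. w a z))" if a: "a \<in> A" for a
  proof -
    let ?N = "{z. {a, z} \<in> E}"
    have finN: "finite ?N" "card ?N \<le> n"
      using finite_host_nbrs[of a] host_nbrs[of a] finite_V card_V card_mono[of V ?N] by auto
    define Z where "Z = {z \<in> ?N. \<epsilon> * card (S a) \<le> card {s \<in> S a. z \<in> crossings (Q a s)}}"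
    have "S a \<noteq> {}" using SP(3)[OF a] by auto
    have cr: "crossings (Q a s) \<subseteq> ?N \<and> 2 * \<epsilon> * n \<le> card (crossings (Q a s))" if "s \<in> S a" for s
    proof
      show "crossings (Q a s) \<subseteq> ?N" using Qp(3)[OF a that] by (auto simp: crossings_def)
      show "2 * \<epsilon> * n \<le> card (crossings (Q a s))"
        using card_crossings[OF Qp(5)[OF a that] Qp(6)[OF a that]] Qp(2)[OF a that] gP by auto
    qed
    \<comment> \<open>Z collects the z that are useful for at least an \<epsilon> fraction of the ends s.\<close>
    have cZ: "\<epsilon> * n \<le> card Z"
      unfolding Z_def
      by (rule popular_crossings[where C = "\<lambda>s. crossings (Q a s)", OF SP(2)[OF a] \<open>S a \<noteq> {}\<close> finN cr])
    have big: "\<epsilon> * n / 16 * card Y \<le> card (\<Union>z\<in>Y. w a z)" if Y: "Y \<subseteq> {z \<in> Z. \<not> improves H {{a, z}}}" for Y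
    proof -
      let ?X = "\<Union>z\<in>Y. w a z"
      have YN: "Y \<subseteq> ?N" using Y by (auto simp: Z_def)
      have finY: "finite Y" using YN finN finite_subset by blast
      have finX: "finite ?X" using finite_E by (rule finite_subset[rotated]) (auto simp: w_def)
      \<comment> \<open>The edge from a to a vertex outside the path lengthens it, so Y contains no such vertex.\<close>
      have YP: "z \<in> set P" if "z \<in> Y" for z
      proof (rule ccontr)
        assume "z \<notin> set P"
        moreover obtain s where "s \<in> S a" using \<open>S a \<noteq> {}\<close> by auto
        moreover have "z \<in> V" using YN that host_nbrs[of a] by auto
        ultimately have "improves H {{a, z}}"
          using Qp(1-3)[OF a] by (intro improves_leaving[of H "Q a s" z]) auto
        then show False using that Y by auto
      qed
      define T where "T z = {s \<in> S a. z \<in> crossings (Q a s)}" for z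
      have T: "\<exists>y. {s, y} \<in> ?X \<and> (\<exists>p q. Q a s = p @ y # z # q)" if "z \<in> Y" "s \<in> T z" for z s
      proof -
        have s: "s \<in> S a" using that by (auto simp: T_def)
        have zP: "z \<in> set P" using YP[OF that(1)] .
        have "z \<in> crossings (Q a s)" using that by (auto simp: T_def)
        then have "\<exists>p y q. Q a s = p @ y # z # q \<and> {last (Q a s), y} \<in> E"
          using zP Qp(2)[OF a s] unfolding crossings_def by simp
        then obtain p y q where pyq: "Q a s = p @ y # z # q" "{s, y} \<in> E"
          unfolding Qp(4)[OF a s] by blast
        then have "{s, y} \<in> w a z" using s by (auto simp: w_def)
        then show ?thesis using pyq that(1) by blast
      qed
      define prd where "prd z s = (SOME y. {s, y} \<in> ?X \<and> (\<exists>p q. Q a s = p @ y # z # q))" for z s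
      have prd: "{s, prd z s} \<in> ?X \<and> (\<exists>p q. Q a s = p @ prd z s # z # q)" if "z \<in> Y" "s \<in> T z" for z s
        unfolding prd_def by (rule someI_ex) (use T[OF that] in blast)
      have inj: "inj_on (\<lambda>(z, s). (s, prd z s)) (Sigma Y T)"
      proof (rule inj_onI)
        fix u v assume uv: "u \<in> Sigma Y T" "v \<in> Sigma Y T"
          "(\<lambda>(z, s). (s, prd z s)) u = (\<lambda>(z, s). (s, prd z s)) v"
        obtain z s z' where zs: "u = (z, s)" "v = (z', s)" using uv(3) by (cases u, cases v) auto
        then have *: "z \<in> Y" "s \<in> T z" "z' \<in> Y" "s \<in> T z'" "prd z s = prd z' s" using uv by auto
        obtain p q p' q' where "Q a s = p @ prd z s # z # q" "Q a s = p' @ prd z' s # z' # q'"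
          using prd[OF *(1,2)] prd[OF *(3,4)] by blast
        then have "Q a s = p @ prd z s # z # q" "Q a s = p' @ prd z s # z' # q'" using *(5) by simp_all
        moreover have "distinct (Q a s)" using Qp(5)[OF a] *(2) by (auto simp: T_def)
        ultimately have "z # q = z' # q'" using split_at_unique[of p "prd z s" "z # q" p' "z' # q'"] by metis
        then show "u = v" using zs by simp
      qed
      have finT: "finite (T z)" for z using SP(2)[OF a] by (auto simp: T_def)
      have "card Y * (\<epsilon> * card (S a)) \<le> (\<Sum>z\<in>Y. real (card (T z)))"
        using sum_bounded_below[of Y "\<epsilon> * card (S a)" "\<lambda>z. real (card (T z))"] Y by (auto simp: T_def Z_def)
      also have "\<dots> = real (card (Sigma Y T))" using finY finT by simp
      also have "card (Sigma Y T) \<le> card {(u, v). {u, v} \<in> ?X}"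
        using inj prd by (intro card_inj_on_le[OF _ _ card_ordered_pairs_le(2)[OF finX]]) auto
      also have "\<dots> \<le> 2 * card ?X" by (rule card_ordered_pairs_le(1)[OF finX])
      finally have 1: "card Y * (\<epsilon> * card (S a)) \<le> 2 * card ?X" by simp
      have "real n / 8 \<le> card (S a)" using SP(3)[OF a] by simp
      then have "card Y * (\<epsilon> * (real n / 8)) \<le> card Y * (\<epsilon> * card (S a))"
        using eps by (intro mult_left_mono) auto
      then show ?thesis using 1 by (simp add: field_simps)
    qed
    show ?thesis using cZ big by (intro exI[of _ Z]) (auto simp: Z_def)
  qed
  have "booster_structure H A w"
    unfolding booster_structure_def using AV many_endpoints[OF H P] imp main
    by (auto simp: A_def w_def)
  then show ?thesis by blast
qed

end

section \<open>Expansion\<close>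

text \<open>
  Cutting out the closed part between two visits of a vertex shortens the walk.
\<close>

lemma walk_to_path:
  assumes "successively (\<lambda>x y. {x, y} \<in> H) ws" "ws \<noteq> []" "hd ws = x" "last ws = x'" "x \<noteq> x'"
  shows "\<exists>vs. gpath H vs \<and> hd vs = x \<and> last vs = x' \<and> 2 \<le> length vs \<and> length vs \<le> length ws"
  using assms
proof (induction "length ws" arbitrary: ws rule: less_induct)
  case less
  show ?case
  proof (cases "distinct ws")
    case True
    have "length ws \<noteq> 1" using less.prems by (auto simp: length_Suc_conv)
    moreover have "length ws \<noteq> 0" using less.prems by simp
    ultimately have "2 \<le> length ws" by linarith
    then show ?thesis using True less.prems by (intro exI[of _ ws]) (auto simp: gpath_def)
  next
    case False
    then obtain xs ys zs y where ws: "ws = (xs @ [y]) @ (ys @ [y]) @ zs"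
      using not_distinct_decomp[of ws] by auto
    let ?us = "(xs @ [y]) @ zs"
    have "successively (\<lambda>x y. {x, y} \<in> H) ?us"
      using less.prems(1) unfolding ws successively_append_iff[of _ "xs @ [y]"] successively_append_iff[of _ "ys @ [y]"]
      by (auto split: if_splits)
    moreover have "hd ?us = x" "last ?us = x'" using less.prems(3,4) unfolding ws by (cases xs; cases zs; auto)+
    moreover have "length ?us < length ws" unfolding ws by simp
    ultimately obtain vs where "gpath H vs \<and> hd vs = x \<and> last vs = x' \<and> 2 \<le> length vs \<and> length vs \<le> length ?us"
      using less.hyps[of ?us] less.prems(5) by auto
    then show ?thesis using \<open>length ?us < length ws\<close> by auto
  qed
qed

definition deg :: "'a set set \<Rightarrow> 'a \<Rightarrow> nat" where
  "deg H v = card {z. {v, z} \<in> H}"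

lemma deg_eq_card_edges:
  assumes "\<And>e. e \<in> H \<Longrightarrow> card e = 2"
  shows "deg H v = card {e \<in> H. v \<in> e}"
proof -
  have "bij_betw (\<lambda>z. {v, z}) {z. {v, z} \<in> H} {e \<in> H. v \<in> e}"
    unfolding bij_betw_def
  proof
    show "inj_on (\<lambda>z. {v, z}) {z. {v, z} \<in> H}" by (auto simp: inj_on_def doubleton_eq_iff)
    show "(\<lambda>z. {v, z}) ` {z. {v, z} \<in> H} = {e \<in> H. v \<in> e}"
    proof (intro equalityI subsetI)
      fix e assume e: "e \<in> {e \<in> H. v \<in> e}"
      then obtain a b where "e = {a, b}" using assms by (metis (no_types, lifting) card_2_iff mem_Collect_eq)
      then have "e = {v, a} \<or> e = {v, b}" using e by auto
      then show "e \<in> (\<lambda>z. {v, z}) ` {z. {v, z} \<in> H}" using e by auto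
    qed auto
  qed
  then show ?thesis unfolding deg_def by (rule bij_betw_same_card)
qed

definition cut_edges :: "'a set set \<Rightarrow> 'a set \<Rightarrow> 'a set \<Rightarrow> 'a set set" where
  "cut_edges H S Y = {e \<in> H. \<exists>s\<in>S. \<exists>y\<in>Y. e = {s, y}}"

context dirac_host
begin

lemma finite_nbrs: "H \<subseteq> E \<Longrightarrow> finite {z. {v, z} \<in> H}"
  using finite_host_nbrs[of v] by (rule finite_subset[rotated]) auto

lemma deg_mono: "H \<subseteq> H' \<Longrightarrow> H' \<subseteq> E \<Longrightarrow> deg H v \<le> deg H' v"
  unfolding deg_def using finite_nbrs by (intro card_mono) auto

lemma nbhd_subset: "H \<subseteq> E \<Longrightarrow> nbhd H S \<subseteq> V"
  using simple by (fastforce simp: nbhd_def)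

lemma expander_mono:
  assumes "expander R" "R \<subseteq> H" "H \<subseteq> E"
  shows "expander H"
proof -
  have sub: "nbhd R S \<subseteq> nbhd H S" for S using assms by (auto simp: nbhd_def)
  have "card (nbhd R S) \<le> card (nbhd H S)" for S
    using sub nbhd_subset[OF assms(3)] finite_V by (meson card_mono finite_subset)
  then have 1: "2 * card S \<le> card (nbhd H S)" if "S \<subseteq> V" "S \<noteq> {}" "8 * card S \<le> n" for S
    using assms(1) that le_trans[of "2 * card S" "card (nbhd R S)"] by (simp add: expander_def)
  have 2: "nbhd H S \<noteq> {}" if "S \<subseteq> V" "S \<noteq> {}" "S \<noteq> V" for S
  proof -
    have "nbhd R S \<noteq> {}" using assms(1) that by (simp add: expander_def)
    then show ?thesis using sub[of S] by auto
  qed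
  show ?thesis unfolding expander_def using assms(3) 1 2 by simp
qed

text \<open>
  A vertex of S has at most n - card Y neighbours outside Y.
\<close>

lemma card_cut_edges_ge:
  assumes "S \<subseteq> V" "Y \<subseteq> V" "S \<inter> Y = {}"
  shows "card S * ((1 / 2 + \<epsilon>) * n - (n - card Y)) \<le> card (cut_edges E S Y)"
proof -
  have fin: "finite S" "finite Y" using assms finite_V finite_subset by blast+
  let ?N = "\<lambda>s. {y \<in> Y. {s, y} \<in> E}"
  have low: "(1 / 2 + \<epsilon>) * n - (n - card Y) \<le> card (?N s)" if "s \<in> S" for s
  proof -
    have "{z. {s, z} \<in> E} \<subseteq> ?N s \<union> (V - Y)" using host_nbrs[of s] by auto
    then have "card {z. {s, z} \<in> E} \<le> card (?N s \<union> (V - Y))" using fin finite_V by (intro card_mono) auto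
    also have "\<dots> \<le> card (?N s) + card (V - Y)" by (rule card_Un_le)
    finally have "real (card {z. {s, z} \<in> E}) \<le> card (?N s) + (n - card Y)"
      using assms fin by (simp add: card_Diff_subset card_V)
    moreover have "(1 / 2 + \<epsilon>) * n \<le> card {z. {s, z} \<in> E}" using host_degree that assms by auto
    ultimately show ?thesis by linarith
  qed
  have "card S * ((1 / 2 + \<epsilon>) * n - (n - card Y)) \<le> (\<Sum>s\<in>S. real (card (?N s)))"
    using sum_bounded_below[of S "(1 / 2 + \<epsilon>) * n - (n - card Y)" "\<lambda>s. real (card (?N s))"] low by simp
  also have "\<dots> = real (card (Sigma S ?N))" using fin by simp
  also have "card (Sigma S ?N) \<le> card (cut_edges E S Y)"
  proof (rule card_inj_on_le[where f = "\<lambda>(s, y). {s, y}"])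
    show "inj_on (\<lambda>(s, y). {s, y}) (Sigma S ?N)"
      using assms(3) by (auto simp: inj_on_def doubleton_eq_iff)
    show "finite (cut_edges E S Y)" unfolding cut_edges_def using finite_E by simp
  qed (auto simp: cut_edges_def)
  finally show ?thesis by simp
qed

lemma ordered_pairs_sum:
  assumes "H \<subseteq> E" "finite S"
  shows "card {(v, u). v \<in> S \<and> {v, u} \<in> H} = (\<Sum>v\<in>S. deg H v)"
proof -
  have "{(v, u). v \<in> S \<and> {v, u} \<in> H} = Sigma S (\<lambda>v. {u. {v, u} \<in> H})" by auto
  then show ?thesis using assms finite_nbrs by (simp add: deg_def)
qed

text \<open>
  If S had few neighbours, then S together with them would form a set U of fewer than 6 card S vertices that
  contains all of the at least d card S / 2 edges at S, contradicting sparsity.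
\<close>

lemma large_degree_expansion:
  fixes \<kappa> :: real
  assumes R: "R \<subseteq> G1" "G1 \<subseteq> E" and S: "S \<subseteq> V" "real (6 * card S) \<le> \<kappa> * n"
    and deg: "\<And>v. v \<in> S \<Longrightarrow> d \<le> deg R v"
    and sparse: "\<And>U. U \<subseteq> V \<Longrightarrow> U \<noteq> {} \<Longrightarrow> card U \<le> \<kappa> * n \<Longrightarrow> 12 * card {e \<in> G1. e \<subseteq> U} < d * card U"
  shows "5 * card S \<le> card (nbhd R S)"
proof (rule ccontr)
  assume no: "\<not> 5 * card S \<le> card (nbhd R S)"
  let ?U = "S \<union> nbhd R S"
  have RE: "R \<subseteq> E" using R by auto
  have finS: "finite S" using S finite_V finite_subset by blast
  have fN: "finite (nbhd R S)" using nbhd_subset[OF RE] finite_V finite_subset by blast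
  have "card ?U \<le> card S + card (nbhd R S)" by (rule card_Un_le)
  then have U: "card ?U \<le> 6 * card S" using no by linarith
  have UV: "?U \<subseteq> V" using S nbhd_subset[OF RE] by auto
  have Une: "?U \<noteq> {}" using no by auto
  have "real (card ?U) \<le> \<kappa> * n" using U S(2) by linarith
  then have sp: "12 * card {e \<in> G1. e \<subseteq> ?U} < d * card ?U" using sparse UV Une by blast
  let ?X = "{e \<in> R. e \<subseteq> ?U}"
  have finX: "finite ?X" using finite_E RE by (auto intro: finite_subset)
  have "card S * d \<le> (\<Sum>v\<in>S. deg R v)" using sum_bounded_below[of S d "deg R"] deg by simp
  also have "\<dots> = card {(v, u). v \<in> S \<and> {v, u} \<in> R}" using ordered_pairs_sum[OF RE finS] by simp
  also have "\<dots> \<le> card {(u, v). {u, v} \<in> ?X}"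
    by (intro card_mono card_ordered_pairs_le(2)[OF finX]) (auto simp: nbhd_def)
  also have "\<dots> \<le> 2 * card ?X" by (rule card_ordered_pairs_le(1)[OF finX])
  also have "\<dots> \<le> 2 * card {e \<in> G1. e \<subseteq> ?U}"
    using R finite_E by (intro mult_left_mono card_mono) (auto intro: finite_subset)
  finally have "card S * d \<le> 2 * card {e \<in> G1. e \<subseteq> ?U}" .
  moreover have "d * card ?U \<le> d * (6 * card S)" using U by (rule mult_left_mono) simp
  ultimately show False using sp by (simp add: algebra_simps)
qed

text \<open>
  B plays the role of the vertices of low degree. Two vertices of B are never joined by a path of at most four edges, so the chosen pairs of
  neighbours T x of the vertices x of S in B are disjoint and lie outside B. The part S2 of S outside B has at least five times
  as many neighbours as vertices. These two sources interfere little: every vertex of S2 is within distance two of at most one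
  vertex of B, so that at most 3 card S2 of the vertices counted are lost.
\<close>

lemma small_set_expansion:
  fixes \<kappa> :: real
  assumes R: "R \<subseteq> G1" "G1 \<subseteq> E" and S: "S \<subseteq> V" "real (6 * card S) \<le> \<kappa> * n"
    and deg2: "\<And>v. v \<in> V \<Longrightarrow> 2 \<le> deg R v"
    and deg: "\<And>v. v \<in> V \<Longrightarrow> v \<notin> B \<Longrightarrow> d \<le> deg R v"
    and far: "\<And>vs. gpath G1 vs \<Longrightarrow> 2 \<le> length vs \<Longrightarrow> length vs \<le> 5 \<Longrightarrow> \<not> (hd vs \<in> B \<and> last vs \<in> B)"
    and sparse: "\<And>U. U \<subseteq> V \<Longrightarrow> U \<noteq> {} \<Longrightarrow> card U \<le> \<kappa> * n \<Longrightarrow> 12 * card {e \<in> G1. e \<subseteq> U} < d * card U"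
  shows "2 * card S \<le> card (nbhd R S)"
proof -
  have RE: "R \<subseteq> E" using R by auto
  define S1 where "S1 = S \<inter> B"
  define S2 where "S2 = S - B"
  have fin: "finite S" using S finite_V finite_subset by blast
  have finS: "finite S1" "finite S2" using fin by (auto simp: S1_def S2_def)
  have finN: "finite (nbhd R A)" for A using nbhd_subset[OF RE] finite_V finite_subset by blast
  have walk: False if w: "successively (\<lambda>x y. {x, y} \<in> R) ws" "ws \<noteq> []" "hd ws \<in> B" "last ws \<in> B"
    "hd ws \<noteq> last ws" "length ws \<le> 5" for ws
  proof -
    obtain vs where "gpath R vs" "hd vs = hd ws" "last vs = last ws" "2 \<le> length vs" "length vs \<le> length ws"
      using walk_to_path[OF w(1,2) refl refl w(5)] by blast
    then show False using far[OF gpath_mono[OF _ R(1)], of vs] w by auto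
  qed
  have "\<exists>T. T \<subseteq> {z. {x, z} \<in> R} \<and> card T = 2" if "x \<in> S1" for x
    using obtain_subset_with_card_n[of 2 "{z. {x, z} \<in> R}"] deg2[of x] that S
    unfolding deg_def S1_def by (metis IntD1 subsetD)
  then obtain T where T: "\<And>x. x \<in> S1 \<Longrightarrow> T x \<subseteq> {z. {x, z} \<in> R} \<and> card (T x) = 2" by metis
  have finT: "finite (T x)" if "x \<in> S1" for x using T[OF that] finite_nbrs[OF RE] finite_subset by blast
  define TT where "TT = (\<Union>x\<in>S1. T x)"
  have finTT: "finite TT" using finT finS by (auto simp: TT_def)
  have cTT: "card TT = 2 * card S1"
  proof -
    have "card TT = (\<Sum>x\<in>S1. card (T x))"
      unfolding TT_def
    proof (rule card_UN_disjoint[OF finS(1)])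
      show "\<forall>i\<in>S1. \<forall>j\<in>S1. i \<noteq> j \<longrightarrow> T i \<inter> T j = {}"
      proof (intro ballI impI)
        fix x x' assume x: "x \<in> S1" "x' \<in> S1" "x \<noteq> x'"
        have False if "u \<in> T x" "u \<in> T x'" for u
          using walk[of "[x, u, x']"] that x T[of x] T[of x'] by (auto simp: S1_def insert_commute)
        then show "T x \<inter> T x' = {}" by auto
      qed
    qed (use finT in auto)
    also have "\<dots> = 2 * card S1" using T by simp
    finally show ?thesis .
  qed
  have TTB: "TT \<inter> B = {}"
  proof -
    have False if "x \<in> S1" "u \<in> T x" "u \<in> B" for x u
    proof -
      have "{x, u} \<in> R" using T[OF that(1)] that by auto
      moreover have "x \<noteq> u" using RE calculation simple[of "{x, u}"] by (auto simp: card_insert_if)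
      ultimately show False using walk[of "[x, u]"] that by (auto simp: S1_def)
    qed
    then show ?thesis by (auto simp: TT_def)
  qed
  \<comment> \<open>Within distance two of v, along an edge at x or through one of the chosen neighbours of x.\<close>
  define near where "near x v \<longleftrightarrow> {x, v} \<in> R \<or> v \<in> T x \<or> (\<exists>u\<in>T x. {u, v} \<in> R)" for x v
  have near_walk: "\<exists>ws. successively (\<lambda>x y. {x, y} \<in> R) ws \<and> ws \<noteq> [] \<and> hd ws = x \<and> last ws = v \<and> length ws \<le> 3"
    if x: "x \<in> S1" and "near x v" for x v
  proof -
    consider "{x, v} \<in> R" | u where "u \<in> T x" "{u, v} \<in> R" using \<open>near x v\<close> T[OF x] by (auto simp: near_def)
    then show ?thesis
    proof cases
      case 1 then show ?thesis by (intro exI[of _ "[x, v]"]) auto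
    next
      case 2 then show ?thesis using T[OF x] by (intro exI[of _ "[x, u, v]"]) auto
    qed
  qed
  have near_unique: "x = x'" if x: "x \<in> S1" "x' \<in> S1" "near x v" "near x' v" for x x' v
  proof (rule ccontr)
    assume "x \<noteq> x'"
    obtain ws where ws: "successively (\<lambda>x y. {x, y} \<in> R) ws" "ws \<noteq> []" "hd ws = x" "last ws = v" "length ws \<le> 3"
      using near_walk x by blast
    obtain us where us: "successively (\<lambda>x y. {x, y} \<in> R) us" "us \<noteq> []" "hd us = x'" "last us = v" "length us \<le> 3"
      using near_walk x by blast
    obtain vs where vs: "us = vs @ [v]" using us by (metis append_butlast_last_id)
    have len: "length (ws @ rev vs) \<le> 5" using ws(5) us(5) vs by simp
    show False
    proof (cases "vs = []")
      case True
      then show ?thesis using walk[OF ws(1,2)] ws us vs x \<open>x \<noteq> x'\<close> by (auto simp: S1_def)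
    next
      case False
      have "successively (\<lambda>x y. {x, y} \<in> R) (ws @ rev vs)"
        using ws us False unfolding vs by (auto simp: successively_append_iff insert_commute hd_rev)
      then show ?thesis using walk[of "ws @ rev vs"] ws us vs x \<open>x \<noteq> x'\<close> False len
        by (auto simp: S1_def last_rev)
    qed
  qed
  have near_card: "card {x \<in> S1. \<exists>v\<in>S2. near x v} \<le> card S2"
  proof -
    let ?N = "{x \<in> S1. \<exists>v\<in>S2. near x v}"
    define f where "f x = (SOME v. v \<in> S2 \<and> near x v)" for x
    have f: "f x \<in> S2 \<and> near x (f x)" if "x \<in> ?N" for x
      unfolding f_def by (rule someI_ex) (use that in blast)
    have "inj_on f ?N" using near_unique f by (intro inj_onI) (metis (no_types, lifting) mem_Collect_eq)
    then show ?thesis using f finS by (intro card_inj_on_le[of f]) auto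
  qed
  let ?N2 = "nbhd R S2"
  have exp2: "5 * card S2 \<le> card ?N2"
  proof (rule large_degree_expansion[OF R _ _ _ sparse])
    show "S2 \<subseteq> V" using S by (auto simp: S2_def)
    have "card S2 \<le> card S" using fin by (intro card_mono) (auto simp: S2_def)
    then show "real (6 * card S2) \<le> \<kappa> * n" using S(2) by simp
    show "d \<le> deg R v" if "v \<in> S2" for v using deg that S by (auto simp: S2_def)
  qed
  have sub: "(TT - S2) \<union> (?N2 - S1 - TT) \<subseteq> nbhd R S"
    using T TTB by (fastforce simp: TT_def nbhd_def S1_def S2_def)
  have "card ((TT - S2) \<union> (?N2 - S1 - TT)) = card (TT - S2) + card (?N2 - S1 - TT)"
    using finTT finN by (intro card_Un_disjoint) auto
  then have low: "card (TT - S2) + card (?N2 - S1 - TT) \<le> card (nbhd R S)"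
    using card_mono[OF finN sub] by linarith
  have adj1: "?N2 \<inter> S1 \<subseteq> {x \<in> S1. \<exists>v\<in>S2. near x v}"
    by (auto simp: nbhd_def near_def insert_commute)
  have a1: "card (?N2 \<inter> S1) \<le> card S2"
    using card_mono[OF _ adj1] near_card finS by simp
  have a2: "card (TT \<inter> S2) + card (TT \<inter> ?N2) \<le> 2 * card S2"
  proof -
    have "card (TT \<inter> S2) + card (TT \<inter> ?N2) = card (TT \<inter> (S2 \<union> ?N2))"
      using finTT by (subst card_Un_disjoint[symmetric]) (auto simp: nbhd_def Int_Un_distrib)
    also have "\<dots> \<le> card (\<Union>x\<in>{x \<in> S1. \<exists>v\<in>S2. near x v}. T x)"
    proof (rule card_mono)
      show "finite (\<Union>x\<in>{x \<in> S1. \<exists>v\<in>S2. near x v}. T x)" using finS finT by auto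
      show "TT \<inter> (S2 \<union> ?N2) \<subseteq> (\<Union>x\<in>{x \<in> S1. \<exists>v\<in>S2. near x v}. T x)"
        by (auto simp: TT_def nbhd_def near_def insert_commute) (metis insert_commute)+
    qed
    also have "\<dots> \<le> (\<Sum>x\<in>{x \<in> S1. \<exists>v\<in>S2. near x v}. card (T x))" using finS by (intro card_UN_le) auto
    also have "\<dots> = 2 * card {x \<in> S1. \<exists>v\<in>S2. near x v}" using T by simp
    also have "\<dots> \<le> 2 * card S2" using near_card by simp
    finally show ?thesis .
  qed
  have "card (TT - S2) + card (TT \<inter> S2) = card TT" using finTT by (metis card_Int_Diff add.commute)
  moreover have "card ?N2 \<le> card (?N2 - S1 - TT) + card (?N2 \<inter> S1) + card (TT \<inter> ?N2)"
  proof -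
    have "?N2 \<subseteq> (?N2 - S1 - TT) \<union> (?N2 \<inter> S1) \<union> (TT \<inter> ?N2)" by auto
    then have "card ?N2 \<le> card ((?N2 - S1 - TT) \<union> (?N2 \<inter> S1) \<union> (TT \<inter> ?N2))"
      using finN by (intro card_mono) auto
    also have "\<dots> \<le> card (?N2 - S1 - TT) + card (?N2 \<inter> S1) + card (TT \<inter> ?N2)"
      by (meson add_right_mono card_Un_le le_trans)
    finally show ?thesis .
  qed
  moreover have "card S = card S1 + card S2"
  proof -
    have "S1 \<union> S2 = S" "S1 \<inter> S2 = {}" by (auto simp: S1_def S2_def)
    then show ?thesis using finS card_Un_disjoint by metis
  qed
  ultimately show ?thesis using low a1 a2 cTT exp2 by linarith
qed

text \<open>
  For small S this is \<open>small_set_expansion\<close>. For larger S, a set Y of vertices without neighbours in S would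
  give a cut with quadratically many host edges and no edge of R; for card S \<le> n / 8 the host degree n / 2 still exceeds
  the 3 card S vertices that may be missing from Y by n / 8. Connectivity follows in the same way, and for sets with more than
  half of the vertices by passing to the complement.
\<close>

lemma expanderI:
  fixes \<kappa> :: real
  assumes R: "R \<subseteq> G1" "G1 \<subseteq> E" and k: "0 < \<kappa>" "\<kappa> \<le> 1 / 2"
    and deg2: "\<And>v. v \<in> V \<Longrightarrow> 2 \<le> deg R v"
    and deg: "\<And>v. v \<in> V \<Longrightarrow> v \<notin> B \<Longrightarrow> d \<le> deg R v"
    and far: "\<And>vs. gpath G1 vs \<Longrightarrow> 2 \<le> length vs \<Longrightarrow> length vs \<le> 5 \<Longrightarrow> \<not> (hd vs \<in> B \<and> last vs \<in> B)"
    and sparse: "\<And>U. U \<subseteq> V \<Longrightarrow> U \<noteq> {} \<Longrightarrow> card U \<le> \<kappa> * n \<Longrightarrow> 12 * card {e \<in> G1. e \<subseteq> U} < d * card U"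
    and dense: "\<And>S Y. S \<subseteq> V \<Longrightarrow> Y \<subseteq> V \<Longrightarrow> S \<inter> Y = {} \<Longrightarrow> \<kappa> * \<epsilon> / 48 * real n ^ 2 \<le> card (cut_edges E S Y) \<Longrightarrow> cut_edges R S Y \<noteq> {}"
  shows "expander R"
proof -
  have RE: "R \<subseteq> E" using R by auto
  have exp: "2 * card S \<le> card (nbhd R S)" if S: "S \<subseteq> V" "S \<noteq> {}" "8 * card S \<le> n" for S
  proof (cases "real (6 * card S) \<le> \<kappa> * n")
    case True
    show ?thesis by (rule small_set_expansion[OF R S(1) True deg2 deg far sparse])
  next
    case False
    show ?thesis
    proof (rule ccontr)
      assume no: "\<not> 2 * card S \<le> card (nbhd R S)"
      let ?Y = "V - S - nbhd R S"
      have finS: "finite S" using S finite_V finite_subset by blast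
      have "card V \<le> card (?Y \<union> (S \<union> nbhd R S))"
        using finite_V finS nbhd_subset[OF RE] by (intro card_mono) (auto intro: finite_subset)
      also have "\<dots> \<le> card ?Y + (card S + card (nbhd R S))"
        by (meson add_left_mono card_Un_le le_trans)
      finally have Y: "real n - 3 * real (card S) \<le> card ?Y" using no card_V by linarith
      have "card S * ((1 / 2 + \<epsilon>) * n - (n - card ?Y)) \<le> card (cut_edges E S ?Y)"
        using S by (intro card_cut_edges_ge) auto
      moreover have "\<kappa> * n / 6 * (n * \<epsilon> / 8) \<le> card S * ((1 / 2 + \<epsilon>) * n - (n - card ?Y))"
      proof (rule mult_mono)
        show "\<kappa> * n / 6 \<le> card S" using False by simp
        have "real (card ?Y) \<le> n" using card_mono[OF finite_V, of ?Y] card_V by auto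
        have "n * \<epsilon> / 8 \<le> n / 8" using eps by (simp add: mult_left_le)
        also have "n / 8 \<le> n / 2 - 3 * real (card S)" using S(3) by linarith
        also have "\<dots> \<le> (1 / 2 + \<epsilon>) * n - (n - card ?Y)"
        proof -
          have "0 \<le> \<epsilon> * n" using eps by simp
          moreover have "real (n - card ?Y) \<le> 3 * real (card S)" using Y by linarith
          ultimately show ?thesis by (simp add: algebra_simps)
        qed
        finally show "n * \<epsilon> / 8 \<le> (1 / 2 + \<epsilon>) * n - (n - card ?Y)" .
      qed (use eps in auto)
      ultimately have "\<kappa> * \<epsilon> / 48 * real n ^ 2 \<le> card (cut_edges E S ?Y)"
        by (simp add: power2_eq_square algebra_simps)
      then have "cut_edges R S ?Y \<noteq> {}" using S by (intro dense) auto
      then show False by (auto simp: cut_edges_def nbhd_def)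
    qed
  qed
  have conn1: "nbhd R S \<noteq> {}" if S: "S \<subseteq> V" "S \<noteq> {}" "2 * card S \<le> n" for S
  proof (cases "8 * card S \<le> n")
    case True
    have "0 < card S" using S finite_V finite_subset card_gt_0_iff by blast
    then show ?thesis using exp[OF S(1,2) True] by auto
  next
    case False
    have finS: "finite S" using S finite_V finite_subset by blast
    have Y: "card (V - S) = n - card S" using S finS by (simp add: card_Diff_subset card_V)
    have "card S \<le> n" using S by simp
    have "card S * ((1 / 2 + \<epsilon>) * n - (n - card (V - S))) \<le> card (cut_edges E S (V - S))"
      using S by (intro card_cut_edges_ge) auto
    moreover have "\<kappa> * n / 6 * (n * \<epsilon> / 8) \<le> card S * ((1 / 2 + \<epsilon>) * n - (n - card (V - S)))"
    proof (rule mult_mono)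
      have "\<kappa> * n \<le> 1 / 2 * n" using k by (intro mult_right_mono) auto
      then show "\<kappa> * n / 6 \<le> card S" using False by linarith
      have "n * \<epsilon> / 8 \<le> \<epsilon> * n" using eps by simp
      also have "\<dots> \<le> (1 / 2 + \<epsilon>) * n - card S" using S(3) by (simp add: algebra_simps)
      also have "\<dots> = (1 / 2 + \<epsilon>) * n - (n - card (V - S))" using Y \<open>card S \<le> n\<close> by simp
      finally show "n * \<epsilon> / 8 \<le> (1 / 2 + \<epsilon>) * n - (n - card (V - S))" .
    qed (use eps in auto)
    ultimately have "\<kappa> * \<epsilon> / 48 * real n ^ 2 \<le> card (cut_edges E S (V - S))"
      by (simp add: power2_eq_square algebra_simps)
    then have "cut_edges R S (V - S) \<noteq> {}" using S by (intro dense) auto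
    then show ?thesis by (auto simp: cut_edges_def nbhd_def)
  qed
  have conn: "nbhd R S \<noteq> {}" if S: "S \<subseteq> V" "S \<noteq> {}" "S \<noteq> V" for S
  proof (cases "2 * card S \<le> n")
    case True then show ?thesis using conn1 S by blast
  next
    case False
    have finS: "finite S" using S finite_V finite_subset by blast
    have "card (V - S) = n - card S" using S finS by (simp add: card_Diff_subset card_V)
    then have "nbhd R (V - S) \<noteq> {}" using S False by (intro conn1) auto
    then obtain v w where "v \<in> V - S" "w \<notin> V - S" "{v, w} \<in> R" by (auto simp: nbhd_def)
    moreover then have "w \<in> V" using simple[of "{v, w}"] RE by auto
    ultimately show ?thesis by (auto simp: nbhd_def insert_commute)
  qed
  show ?thesis using RE exp conn by (auto simp: expander_def)
qed

end

section \<open>Closing the longest path repeatedly\<close>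

context dirac_host
begin

text \<open>
  A fixed choice of w for every H. The union bound over H then has to consider, for each H, only the sets which
  arise from a vertex a and a set of vertices Y.
\<close>

definition rotation_edges :: "'a set set \<Rightarrow> 'a \<Rightarrow> 'a \<Rightarrow> 'a set set" where
  "rotation_edges H = (SOME w. \<exists>A. booster_structure H A w)"

definition rotation_family :: "'a set set \<Rightarrow> 'a set set set" where
  "rotation_family H = (\<lambda>(a, Y). \<Union>z\<in>Y. rotation_edges H a z) ` (V \<times> Pow V)"

text \<open>
  The host edges that improve H once a suitable edge of H \<union> T is there; in the application T is a sparse snapshot.
\<close>

definition boosters :: "'a set set \<Rightarrow> 'a set set \<Rightarrow> 'a set set" where
  "boosters H T = {e2 \<in> E. \<exists>e1\<in>H \<union> T. improves H {e1, e2}}"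

definition booster_family :: "'a set set \<Rightarrow> 'a set set set" where
  "booster_family F = (\<lambda>(H, T). boosters H T) ` (Pow F \<times> Pow F)"

lemma longest_path_exists: "\<exists>P. longest_path V H P"
proof -
  obtain v where "v \<in> V" using card_V large by (metis all_not_in_conv card.empty not_numeral_le_zero)
  then have "gpath H [v] \<and> set [v] \<subseteq> V" by (auto simp: gpath_def)
  moreover have "\<forall>Q. gpath H Q \<and> set Q \<subseteq> V \<longrightarrow> length Q < Suc n"
    using card_mono[OF finite_V] by (metis card_V distinct_card gpath_def less_Suc_eq_le)
  ultimately have "\<exists>P. (gpath H P \<and> set P \<subseteq> V) \<and> (\<forall>Q. gpath H Q \<and> set Q \<subseteq> V \<longrightarrow> length Q \<le> length P)"
    by (rule ex_has_greatest_nat)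
  then show ?thesis by (simp add: longest_path_def imp_conjL)
qed

text \<open>
  For a \<in> A let Y be the set of those good z for which no edge of w a z is present in H \<union> T. If Y were large, the union of
  these w a z would be a member of the rotation family that T misses. So nearly every good z gives a booster {a, z}.
\<close>

lemma many_boosters:
  assumes H: "expander H" and T: "T \<subseteq> E"
    and rot: "\<And>X. X \<in> rotation_family H \<Longrightarrow> X \<subseteq> E - H \<Longrightarrow> \<epsilon>\<^sup>2 / 32 * real n ^ 2 \<le> card X \<Longrightarrow> X \<inter> T \<noteq> {}"
  shows "\<epsilon> / 32 * real n ^ 2 \<le> card (boosters H T)"
proof -
  let ?w = "rotation_edges H"
  obtain P where P: "longest_path V H P" using longest_path_exists by blast
  have "\<exists>w A. booster_structure H A w" using booster_structure_exists[OF H P] by blast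
  then have "\<exists>A. booster_structure H A ?w" unfolding rotation_edges_def by (rule someI_ex)
  then obtain A where A: "booster_structure H A ?w" by blast
  have AV: "A \<subseteq> V" "n < 8 * card A" using A by (auto simp: booster_structure_def)
  have wE: "?w a z \<subseteq> E" and wimp: "e \<in> ?w a z \<Longrightarrow> {a, z} \<in> E \<Longrightarrow> improves H {e, {a, z}}" if "a \<in> A" for a z e
    using A that by (auto simp: booster_structure_def)
  have HE: "H \<subseteq> E" using H by (simp add: expander_def)
  have "H \<noteq> {}"
  proof -
    obtain v where "v \<in> V" using AV large by fastforce
    moreover have "{v} \<noteq> V" using card_V large by auto
    ultimately have "nbhd H {v} \<noteq> {}" using H by (simp add: expander_def)
    then show ?thesis by (auto simp: nbhd_def)
  qed
  have many: "\<epsilon> * n / 2 \<le> card {z. {a, z} \<in> boosters H T}" if a: "a \<in> A" for a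
  proof -
    obtain Z where Z: "Z \<subseteq> {z. {a, z} \<in> E}" "\<epsilon> * n \<le> card Z"
      "\<And>Y. Y \<subseteq> {z \<in> Z. \<not> improves H {{a, z}}} \<Longrightarrow> \<epsilon> * n / 16 * card Y \<le> card (\<Union>z\<in>Y. ?w a z)"
      using A a unfolding booster_structure_def by meson
    define Y where "Y = {z \<in> Z. \<not> improves H {{a, z}} \<and> ?w a z \<inter> (H \<union> T) = {}}"
    let ?X = "\<Union>z\<in>Y. ?w a z"
    have finZ: "finite Z" using Z(1) finite_host_nbrs finite_subset by blast
    have YV: "Y \<subseteq> V" using Z(1) host_nbrs[of a] by (auto simp: Y_def)
    have "?X \<in> rotation_family H" unfolding rotation_family_def using a AV YV by (intro image_eqI[of _ _ "(a, Y)"]) auto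
    moreover have "?X \<subseteq> E - H" using wE[OF a] by (auto simp: Y_def)
    moreover have "?X \<inter> T = {}" by (auto simp: Y_def)
    ultimately have "card ?X < \<epsilon>\<^sup>2 / 32 * real n ^ 2" using rot[of ?X] by linarith
    moreover have "\<epsilon> * n / 16 * card Y \<le> card ?X" by (rule Z(3)) (auto simp: Y_def)
    ultimately have "\<epsilon> * n / 16 * card Y < \<epsilon> * n / 16 * (\<epsilon> * n / 2)"
      by (simp add: power2_eq_square algebra_simps)
    moreover have "0 < \<epsilon> * n / 16" using eps large by simp
    ultimately have cY: "card Y < \<epsilon> * n / 2" by (simp only: mult_less_cancel_left_pos)
    have "card Z = card (Z - Y) + card Y"
      using finZ by (subst card_Diff_subset) (auto simp: Y_def card_mono intro: finite_subset)
    then have "\<epsilon> * n / 2 \<le> card (Z - Y)" using Z(2) cY by linarith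
    also have "card (Z - Y) \<le> card {z. {a, z} \<in> boosters H T}"
    proof (rule card_mono)
      show "finite {z. {a, z} \<in> boosters H T}"
        using finite_host_nbrs[of a] by (rule finite_subset[rotated]) (auto simp: boosters_def)
      show "Z - Y \<subseteq> {z. {a, z} \<in> boosters H T}"
      proof
        fix z assume z: "z \<in> Z - Y"
        then have azE: "{a, z} \<in> E" using Z(1) by auto
        have "\<exists>e1\<in>H \<union> T. improves H {e1, {a, z}}"
        proof (cases "improves H {{a, z}}")
          case True
          obtain e where "e \<in> H" using \<open>H \<noteq> {}\<close> by auto
          then show ?thesis using improves_mono[OF True, of "{e, {a, z}}"] by blast
        next
          case False
          then obtain e where "e \<in> ?w a z" "e \<in> H \<union> T" using z by (auto simp: Y_def)
          then show ?thesis using wimp[OF a] azE by blast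
        qed
        then show "z \<in> {z. {a, z} \<in> boosters H T}" using azE by (auto simp: boosters_def)
      qed
    qed
    finally show ?thesis by simp
  qed
  have finB: "finite (boosters H T)" using finite_E by (auto simp: boosters_def)
  have finA: "finite A" using AV finite_V finite_subset by blast
  have BE: "boosters H T \<subseteq> E" by (auto simp: boosters_def)
  have "real (card A) * (\<epsilon> * n / 2) \<le> (\<Sum>a\<in>A. real (deg (boosters H T) a))"
    using sum_bounded_below[of A "\<epsilon> * n / 2" "\<lambda>a. real (deg (boosters H T) a)"] many by (simp add: deg_def)
  also have "\<dots> = card {(v, u). v \<in> A \<and> {v, u} \<in> boosters H T}"
    using ordered_pairs_sum[OF BE finA] by simp
  also have "\<dots> \<le> card {(v, u). {v, u} \<in> boosters H T}"
    by (intro of_nat_mono card_mono card_ordered_pairs_le(2)[OF finB]) auto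
  also have "\<dots> \<le> 2 * card (boosters H T)" using card_ordered_pairs_le(1)[OF finB] by linarith
  finally have 1: "real (card A) * (\<epsilon> * n / 2) \<le> 2 * card (boosters H T)" by simp
  have "real n / 8 * (\<epsilon> * n / 2) \<le> real (card A) * (\<epsilon> * n / 2)"
    using AV eps by (intro mult_right_mono) auto
  then show ?thesis using 1 by (simp add: power2_eq_square algebra_simps)
qed

text \<open>
  A booster that already belongs to H \<union> T can be used at once; otherwise all of them are new, and G contains one.
\<close>

lemma improvement_exists:
  assumes H: "expander H" and T: "T \<subseteq> E"
    and rot: "\<And>X. X \<in> rotation_family H \<Longrightarrow> X \<subseteq> E - H \<Longrightarrow> \<epsilon>\<^sup>2 / 32 * real n ^ 2 \<le> card X \<Longrightarrow> X \<inter> T \<noteq> {}"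
    and boost: "\<And>X. X \<in> booster_family (H \<union> T) \<Longrightarrow> X \<subseteq> E - (H \<union> T) \<Longrightarrow> \<epsilon> / 32 * real n ^ 2 \<le> card X \<Longrightarrow> X \<inter> G \<noteq> {}"
  shows "\<exists>D \<subseteq> H \<union> T \<union> G. card D \<le> 2 \<and> improves H D"
proof -
  have "\<exists>e2. e2 \<in> boosters H T \<and> e2 \<in> H \<union> T \<union> G"
  proof (cases "boosters H T \<inter> (H \<union> T) = {}")
    case True
    have "boosters H T \<in> booster_family (H \<union> T)"
      unfolding booster_family_def by (intro image_eqI[of _ _ "(H, T)"]) auto
    moreover have "boosters H T \<subseteq> E - (H \<union> T)" using True by (auto simp: boosters_def)
    ultimately have "boosters H T \<inter> G \<noteq> {}" using boost many_boosters[OF H T rot] by blast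
    then show ?thesis by blast
  qed blast
  then obtain e1 e2 where "e1 \<in> H \<union> T" "e2 \<in> H \<union> T \<union> G" "improves H {e1, e2}" by (auto simp: boosters_def)
  then show ?thesis using card_length[of "[e1, e2]"] by (intro exI[of _ "{e1, e2}"]) auto
qed

text \<open>
  Each round lengthens the longest path and adds at most two edges. Unless a Hamilton cycle appears, n rounds would
  produce a path with more than n vertices. Throughout, H has at most 2 n edges more than R, so the
  hypotheses on sparse graphs apply in every round.
\<close>

lemma hamiltonian_by_boosters:
  assumes R: "expander R" "R \<subseteq> G" and G: "G \<subseteq> E" and T: "T \<subseteq> G"
    and rot: "\<And>H X. H \<subseteq> G \<Longrightarrow> card H \<le> card R + 2 * n \<Longrightarrow> X \<in> rotation_family H \<Longrightarrow> X \<subseteq> E - H \<Longrightarrow>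
      \<epsilon>\<^sup>2 / 32 * real n ^ 2 \<le> card X \<Longrightarrow> X \<inter> T \<noteq> {}"
    and boost: "\<And>F X. F \<subseteq> G \<Longrightarrow> card F \<le> card R + 2 * n + card T \<Longrightarrow> X \<in> booster_family F \<Longrightarrow> X \<subseteq> E - F \<Longrightarrow>
      \<epsilon> / 32 * real n ^ 2 \<le> card X \<Longrightarrow> X \<inter> G \<noteq> {}"
  shows "hamiltonian (V, G)"
proof (rule ccontr)
  assume noham: "\<not> hamiltonian (V, G)"
  have finG: "finite G" using G finite_E finite_subset by blast
  have "k \<le> n \<Longrightarrow> \<exists>H Q. R \<subseteq> H \<and> H \<subseteq> G \<and> card H \<le> card R + 2 * k \<and> gpath H Q \<and> set Q \<subseteq> V \<and> k < length Q" for k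
  proof (induction k)
    case 0
    obtain P where "longest_path V R P" using longest_path_exists by blast
    then show ?case using R by (intro exI[of _ R] exI[of _ P]) (auto simp: longest_path_def gpath_def)
  next
    case (Suc k)
    then obtain H Q where H: "R \<subseteq> H" "H \<subseteq> G" "card H \<le> card R + 2 * k" and Q: "gpath H Q" "set Q \<subseteq> V" "k < length Q"
      by auto
    have finH: "finite H" using H finG finite_subset by blast
    have "H \<subseteq> E" using H G by auto
    have exp: "expander H" using expander_mono[OF R(1) H(1) \<open>H \<subseteq> E\<close>] .
    have le: "card H \<le> card R + 2 * n" using H(3) Suc.prems by simp
    have cHT: "card (H \<union> T) \<le> card R + 2 * n + card T" using le card_Un_le[of H T] by linarith
    have "\<exists>D \<subseteq> H \<union> T \<union> G. card D \<le> 2 \<and> improves H D"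
    proof (rule improvement_exists[OF exp])
      show "T \<subseteq> E" using T G by auto
      show "X \<inter> T \<noteq> {}" if "X \<in> rotation_family H" "X \<subseteq> E - H" "\<epsilon>\<^sup>2 / 32 * real n ^ 2 \<le> card X" for X
        by (rule rot[OF H(2) le that])
      show "X \<inter> G \<noteq> {}" if "X \<in> booster_family (H \<union> T)" "X \<subseteq> E - (H \<union> T)" "\<epsilon> / 32 * real n ^ 2 \<le> card X" for X
        by (rule boost[OF _ cHT that]) (use H T in auto)
    qed
    then obtain D where D: "D \<subseteq> G" "card D \<le> 2" "improves H D"
      using H(2) T by (metis Un_absorb1 Un_subset_iff)
    have sub: "H \<union> D \<subseteq> G" using H D by auto
    then have "\<not> hamiltonian (V, H \<union> D)" using noham hamiltonian_mono by blast
    then obtain Q' where Q': "gpath (H \<union> D) Q'" "set Q' \<subseteq> V" "length Q < length Q'"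
      using D(3) Q(1,2) unfolding improves_def by blast
    have "card (H \<union> D) \<le> card R + 2 * Suc k" using card_Un_le[of H D] H(3) D(2) by simp
    then show ?case using H(1) sub Q' Q(3) by (intro exI[of _ "H \<union> D"] exI[of _ Q']) auto
  qed
  from this[of n] obtain H Q where "gpath H Q" "set Q \<subseteq> V" "n < length Q" by auto
  then show False using card_mono[OF finite_V, of "set Q"] by (simp add: gpath_def card_V distinct_card)
qed

text \<open>
  Keep Ts, and at each vertex min d (deg G v) edges of G. All edges at a vertex of low degree survive, which is essential
  for vertices of degree two.
\<close>

lemma sparse_skeleton:
  assumes G: "G \<subseteq> E" "Ts \<subseteq> G" and d: "2 \<le> d" and deg2: "\<And>v. v \<in> V \<Longrightarrow> 2 \<le> deg G v"
  shows "\<exists>R. Ts \<subseteq> R \<and> R \<subseteq> G \<and> card R \<le> card Ts + n * d \<and> (\<forall>v\<in>V. 2 \<le> deg R v) \<and> (\<forall>v\<in>V. d \<le> deg G v \<longrightarrow> d \<le> deg R v)"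
proof -
  have "\<exists>N. N \<subseteq> {z. {v, z} \<in> G} \<and> card N = min d (deg G v)" for v
    using obtain_subset_with_card_n[of "min d (deg G v)" "{z. {v, z} \<in> G}"] by (metis deg_def min.cobounded2)
  then obtain N where N: "\<And>v. N v \<subseteq> {z. {v, z} \<in> G} \<and> card (N v) = min d (deg G v)" by metis
  have finN: "finite (N v)" for v using N[of v] finite_nbrs[OF G(1), of v] finite_subset by blast
  define R where "R = Ts \<union> (\<Union>v\<in>V. (\<lambda>z. {v, z}) ` N v)"
  have RG: "R \<subseteq> G" using G N by (auto simp: R_def)
  have RE: "R \<subseteq> E" using RG G by auto
  have "card (\<Union>v\<in>V. (\<lambda>z. {v, z}) ` N v) \<le> (\<Sum>v\<in>V. card ((\<lambda>z. {v, z}) ` N v))"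
    by (rule card_UN_le[OF finite_V])
  also have "\<dots> \<le> (\<Sum>v\<in>V. d)"
  proof (rule sum_mono)
    fix v show "card ((\<lambda>z. {v, z}) ` N v) \<le> d" using card_image_le[OF finN, of "\<lambda>z. {v, z}" v] N[of v] by simp
  qed
  also have "\<dots> = n * d" by (simp add: card_V)
  finally have "card R \<le> card Ts + n * d" unfolding R_def using card_Un_le le_trans add_left_mono by meson
  moreover have dR: "min d (deg G v) \<le> deg R v" if "v \<in> V" for v
  proof -
    have "card (N v) \<le> card {z. {v, z} \<in> R}"
      using that finite_nbrs[OF RE, of v] by (intro card_mono) (auto simp: R_def)
    then show ?thesis using N[of v] by (simp add: deg_def)
  qed
  moreover have "2 \<le> deg R v" if "v \<in> V" for v using dR[OF that] deg2[OF that] d by linarith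
  moreover have "d \<le> deg R v" if "v \<in> V" "d \<le> deg G v" for v using dR[OF that(1)] that(2) by linarith
  ultimately show ?thesis using RG by (intro exI[of _ R]) (auto simp: R_def)
qed

text \<open>
  The deterministic core: if the early graph G0 and the late graph G1 behave typically, every graph G between them with minimum
  degree two is Hamiltonian. Low degree is measured in G0 and distances in G1, so that the
  conditions do not depend on G.
\<close>

theorem hamiltonian_of_typical:
  fixes \<kappa> :: real
  assumes G: "G0 \<subseteq> G" "G \<subseteq> G1" "G1 \<subseteq> E" and T: "Ts \<subseteq> G0" "T \<subseteq> G0" and d: "2 \<le> d" and k: "0 < \<kappa>" "\<kappa> \<le> 1 / 2"
    and deg2: "\<And>v. v \<in> V \<Longrightarrow> 2 \<le> deg G v"
    and far: "\<And>vs. gpath G1 vs \<Longrightarrow> 2 \<le> length vs \<Longrightarrow> length vs \<le> 5 \<Longrightarrow> \<not> (deg G0 (hd vs) < d \<and> deg G0 (last vs) < d)"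
    and sparse: "\<And>U. U \<subseteq> V \<Longrightarrow> U \<noteq> {} \<Longrightarrow> card U \<le> \<kappa> * n \<Longrightarrow> 12 * card {e \<in> G1. e \<subseteq> U} < d * card U"
    and dense: "\<And>S Y. S \<subseteq> V \<Longrightarrow> Y \<subseteq> V \<Longrightarrow> S \<inter> Y = {} \<Longrightarrow> \<kappa> * \<epsilon> / 48 * real n ^ 2 \<le> card (cut_edges E S Y) \<Longrightarrow> cut_edges E S Y \<inter> Ts \<noteq> {}"
    and rot: "\<And>H X. H \<subseteq> G1 \<Longrightarrow> card H \<le> card Ts + n * d + 2 * n \<Longrightarrow> X \<in> rotation_family H \<Longrightarrow> X \<subseteq> E - H \<Longrightarrow>
      \<epsilon>\<^sup>2 / 32 * real n ^ 2 \<le> card X \<Longrightarrow> X \<inter> T \<noteq> {}"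
    and boost: "\<And>F X. F \<subseteq> G1 \<Longrightarrow> card F \<le> card Ts + n * d + 2 * n + card T \<Longrightarrow> X \<in> booster_family F \<Longrightarrow> X \<subseteq> E - F \<Longrightarrow>
      \<epsilon> / 32 * real n ^ 2 \<le> card X \<Longrightarrow> X \<inter> G0 \<noteq> {}"
  shows "hamiltonian (V, G)"
proof -
  have GE: "G \<subseteq> E" "G0 \<subseteq> E" using G by auto
  have "Ts \<subseteq> G" using T G by auto
  then have "\<exists>R. Ts \<subseteq> R \<and> R \<subseteq> G \<and> card R \<le> card Ts + n * d \<and> (\<forall>v\<in>V. 2 \<le> deg R v) \<and> (\<forall>v\<in>V. d \<le> deg G v \<longrightarrow> d \<le> deg R v)"
    by (rule sparse_skeleton[OF GE(1) _ d deg2])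
  then obtain R where "Ts \<subseteq> R \<and> R \<subseteq> G \<and> card R \<le> card Ts + n * d \<and> (\<forall>v\<in>V. 2 \<le> deg R v) \<and> (\<forall>v\<in>V. d \<le> deg G v \<longrightarrow> d \<le> deg R v)" ..
  then have R: "Ts \<subseteq> R" "R \<subseteq> G" "card R \<le> card Ts + n * d" "\<And>v. v \<in> V \<Longrightarrow> 2 \<le> deg R v"
     "\<And>v. v \<in> V \<Longrightarrow> d \<le> deg G v \<Longrightarrow> d \<le> deg R v"
    by simp_all
  have "expander R"
  proof (rule expanderI[where B = "{v. deg G0 v < d}" and d = d, OF _ G(3) k R(4)])
    show "R \<subseteq> G1" using R G by auto
    show "d \<le> deg R v" if "v \<in> V" "v \<notin> {v. deg G0 v < d}" for v
      using that deg_mono[OF G(1) GE(1), of v] by (intro R(5)) auto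
    show "\<not> (hd vs \<in> {v. deg G0 v < d} \<and> last vs \<in> {v. deg G0 v < d})"
      if "gpath G1 vs" "2 \<le> length vs" "length vs \<le> 5" for vs
      using far[OF that] by simp
    show "cut_edges R S Y \<noteq> {}" if "S \<subseteq> V" "Y \<subseteq> V" "S \<inter> Y = {}" "\<kappa> * \<epsilon> / 48 * real n ^ 2 \<le> card (cut_edges E S Y)" for S Y
      using dense[OF that] R(1) by (fastforce simp: cut_edges_def)
  qed (use sparse in auto)
  then show ?thesis
  proof (rule hamiltonian_by_boosters[OF _ R(2) GE(1), of T])
    show "T \<subseteq> G" using T G by auto
    show "X \<inter> T \<noteq> {}" if "H \<subseteq> G" "card H \<le> card R + 2 * n" "X \<in> rotation_family H" "X \<subseteq> E - H"
      "\<epsilon>\<^sup>2 / 32 * real n ^ 2 \<le> card X" for H X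
      by (rule rot[OF _ _ that(3-5)]) (use that R G in auto)
    show "X \<inter> G \<noteq> {}" if "F \<subseteq> G" "card F \<le> card R + 2 * n + card T" "X \<in> booster_family F" "X \<subseteq> E - F"
      "\<epsilon> / 32 * real n ^ 2 \<le> card X" for F X
    proof -
      have "X \<inter> G0 \<noteq> {}" by (rule boost[OF _ _ that(3-5)]) (use that R G in auto)
      then show ?thesis using G by auto
    qed
  qed
qed

lemma card_rotation_family: "finite (rotation_family H)" "card (rotation_family H) \<le> n * 2 ^ n"
proof -
  have "card (V \<times> Pow V) = n * 2 ^ n" using finite_V by (simp add: card_cartesian_product card_Pow card_V)
  then show "finite (rotation_family H)" "card (rotation_family H) \<le> n * 2 ^ n"
    unfolding rotation_family_def using finite_V card_image_le[of "V \<times> Pow V" "\<lambda>(a, Y). \<Union>z\<in>Y. rotation_edges H a z"]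
    by auto
qed

lemma card_booster_family: "finite F \<Longrightarrow> finite (booster_family F) \<and> card (booster_family F) \<le> 4 ^ card F"
proof -
  assume F: "finite F"
  have "card (Pow F \<times> Pow F) = 2 ^ card F * 2 ^ card F" using F by (simp add: card_cartesian_product card_Pow)
  also have "\<dots> = 4 ^ card F" by (simp flip: power_mult_distrib)
  finally show ?thesis unfolding booster_family_def
    using F card_image_le[of "Pow F \<times> Pow F" "\<lambda>(H, T). boosters H T"] by auto
qed

end

section \<open>Union bounds over sparse subgraphs\<close>

lemma sum_Pow_power_card:
  fixes z :: real
  assumes "finite E"
  shows "(\<Sum>F\<in>Pow E. z ^ card F) = (1 + z) ^ card E"
  using assms
proof (induction E rule: finite_induct)
  case (insert e E)
  have inj: "inj_on (insert e) (Pow E)" using insert by (auto simp: inj_on_def)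
  have "(\<Sum>F\<in>Pow (insert e E). z ^ card F) = (\<Sum>F\<in>Pow E. z ^ card F) + (\<Sum>F\<in>insert e ` Pow E. z ^ card F)"
    unfolding Pow_insert using insert by (intro sum.union_disjoint) auto
  also have "(\<Sum>F\<in>insert e ` Pow E. z ^ card F) = (\<Sum>F\<in>Pow E. z * z ^ card F)"
    unfolding sum.reindex[OF inj]
  proof (intro sum.cong refl)
    fix F assume "F \<in> Pow E"
    then have "e \<notin> F" "finite F" using insert finite_subset by auto
    then show "((\<lambda>F. z ^ card F) \<circ> insert e) F = z * z ^ card F" by simp
  qed
  also have "(\<Sum>F\<in>Pow E. z ^ card F) + (\<Sum>F\<in>Pow E. z * z ^ card F) = (1 + z) * (\<Sum>F\<in>Pow E. z ^ card F)"
    by (simp add: sum.distrib sum_distrib_left distrib_right)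
  finally show ?case using insert by simp
qed simp

lemma one_plus_power_le_exp: "0 \<le> z \<Longrightarrow> (1 + z) ^ k \<le> exp (real k * z)"
  by (metis exp_ge_add_one_self exp_of_nat_mult add.commute add_nonneg_nonneg power_mono zero_le_one)

text \<open>
  A Chernoff bound in generating function form. Weighting each set by x to the power of its size, with x \<le> 1, and dividing by the
  least weight that occurs makes the sum extend over all subsets.
\<close>

lemma sum_small_subsets:
  fixes x y :: real
  assumes "finite E" "0 < x" "x \<le> 1" "0 \<le> y"
  shows "(\<Sum>F | F \<subseteq> E \<and> card F \<le> h. y ^ card F) \<le> (1 / x) ^ h * exp (real (card E) * (x * y))"
proof -
  have "(\<Sum>F | F \<subseteq> E \<and> card F \<le> h. y ^ card F) \<le> (\<Sum>F | F \<subseteq> E \<and> card F \<le> h. (1 / x) ^ h * (x * y) ^ card F)"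
  proof (rule sum_mono)
    fix F assume "F \<in> {F. F \<subseteq> E \<and> card F \<le> h}"
    then have "(1 / x) ^ card F \<le> (1 / x) ^ h" using assms by (intro power_increasing) auto
    then have "(1 / x) ^ card F * (x * y) ^ card F \<le> (1 / x) ^ h * (x * y) ^ card F"
      using assms by (intro mult_right_mono) auto
    moreover have "(1 / x) ^ card F * (x * y) ^ card F = y ^ card F"
      using assms by (simp flip: power_mult_distrib)
    ultimately show "y ^ card F \<le> (1 / x) ^ h * (x * y) ^ card F" by simp
  qed
  also have "\<dots> \<le> (\<Sum>F\<in>Pow E. (1 / x) ^ h * (x * y) ^ card F)"
    using assms by (intro sum_mono2) auto
  also have "\<dots> = (1 / x) ^ h * (1 + x * y) ^ card E"
    using sum_Pow_power_card[OF assms(1), of "x * y"] by (simp flip: sum_distrib_left)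
  also have "\<dots> \<le> (1 / x) ^ h * exp (real (card E) * (x * y))"
    using assms by (intro mult_left_mono one_plus_power_le_exp) auto
  finally show ?thesis .
qed

lemma sum_subsets_of_size:
  fixes x y :: real
  assumes "finite E" "0 < x" "0 \<le> y"
  shows "(\<Sum>F | F \<subseteq> E \<and> card F = g. y ^ card F) \<le> (1 / x) ^ g * exp (real (card E) * (x * y))"
proof -
  have "(\<Sum>F | F \<subseteq> E \<and> card F = g. y ^ card F) = (\<Sum>F | F \<subseteq> E \<and> card F = g. (1 / x) ^ g * (x * y) ^ card F)"
    using assms by (intro sum.cong) (auto simp flip: power_mult_distrib)
  also have "\<dots> \<le> (\<Sum>F\<in>Pow E. (1 / x) ^ g * (x * y) ^ card F)"
    using assms by (intro sum_mono2) auto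
  also have "\<dots> = (1 / x) ^ g * (1 + x * y) ^ card E"
    using sum_Pow_power_card[OF assms(1), of "x * y"] by (simp flip: sum_distrib_left)
  also have "\<dots> \<le> (1 / x) ^ g * exp (real (card E) * (x * y))"
    using assms by (intro mult_left_mono one_plus_power_le_exp) auto
  finally show ?thesis .
qed

text \<open>
  The union bound over all pairs of a sparse graph F in the snapshot at t1 and a set X attached to F. The factor 4 to the
  power card F for the number of sets X is absorbed into the weight of F.
\<close>

lemma sprinkling:
  fixes \<xi> x N :: real
  assumes E: "finite E" and t: "t \<le> card E" "t1 \<le> card E" "h \<le> t"
    and XX: "\<And>F. F \<subseteq> E \<Longrightarrow> finite (XX F) \<and> card (XX F) \<le> N * 4 ^ card F"
    and x: "0 < x" "x \<le> 1" and \<xi>: "0 \<le> \<xi>"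
  shows "order_prob E (\<lambda>es. \<exists>F X. F \<subseteq> set (take t1 es) \<and> card F \<le> h \<and> X \<in> XX F \<and> X \<subseteq> E - F \<and> \<xi> \<le> card X \<and> X \<inter> set (take t es) = {})
    \<le> N * (1 / x) ^ h * exp (4 * x * t1) * exp (- (\<xi> * (real t - h) / card E))"
proof -
  let ?m = "real (card E)"
  define I where "I = Sigma {F. F \<subseteq> E \<and> card F \<le> h} (\<lambda>F. {X \<in> XX F. X \<subseteq> E - F \<and> \<xi> \<le> card X})"
  have finF: "finite {F. F \<subseteq> E \<and> card F \<le> h}" using E by simp
  have finI: "finite I" unfolding I_def using E XX by (intro finite_SigmaI finF) auto
  have N: "0 \<le> N" using XX[of "{}"] by simp
  have "order_prob E (\<lambda>es. \<exists>F X. F \<subseteq> set (take t1 es) \<and> card F \<le> h \<and> X \<in> XX F \<and> X \<subseteq> E - F \<and> \<xi> \<le> card X \<and> X \<inter> set (take t es) = {})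
    \<le> (\<Sum>i\<in>I. order_prob E (\<lambda>es. fst i \<subseteq> set (take t1 es) \<and> snd i \<inter> set (take t es) = {}))"
  proof (rule order_prob_union_bound[OF E finI])
    fix es assume es: "es \<in> permutations_of_set E" and "\<exists>F X. F \<subseteq> set (take t1 es) \<and> card F \<le> h \<and> X \<in> XX F \<and> X \<subseteq> E - F \<and> \<xi> \<le> card X \<and> X \<inter> set (take t es) = {}"
    then obtain F X where *: "F \<subseteq> set (take t1 es)" "card F \<le> h" "X \<in> XX F" "X \<subseteq> E - F" "\<xi> \<le> card X" "X \<inter> set (take t es) = {}" by blast
    have "F \<subseteq> E" using *(1) es set_take_subset[of t1 es] by (auto simp: permutations_of_set_def)
    then have "(F, X) \<in> I" using * by (auto simp: I_def)
    then show "\<exists>i\<in>I. fst i \<subseteq> set (take t1 es) \<and> snd i \<inter> set (take t es) = {}"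
      by (rule bexI[rotated]) (use * in simp)
  qed
  also have "\<dots> \<le> (\<Sum>(F, X)\<in>I. (t1 / ?m) ^ card F * exp (- (\<xi> * (real t - h) / ?m)))"
  proof (rule sum_mono, clarify)
    fix F X assume "(F, X) \<in> I"
    then have FX: "F \<subseteq> E" "card F \<le> h" "X \<subseteq> E - F" "\<xi> \<le> card X" by (auto simp: I_def)
    have "order_prob E (\<lambda>es. F \<subseteq> set (take t1 es) \<and> X \<inter> set (take t es) = {}) \<le> (t1 / ?m) ^ card F * exp (- (real (card X) * (real t - card F) / ?m))"
      using FX t by (intro prob_contain_avoid[OF E]) auto
    also have "\<dots> \<le> (t1 / ?m) ^ card F * exp (- (\<xi> * (real t - h) / ?m))"
    proof -
      have "\<xi> * (real t - h) \<le> real (card X) * (real t - card F)" using FX t \<xi> by (intro mult_mono) auto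
      then have "\<xi> * (real t - h) / ?m \<le> real (card X) * (real t - card F) / ?m" by (rule divide_right_mono) simp
      then show ?thesis by (intro mult_left_mono) auto
    qed
    finally show "order_prob E (\<lambda>es. fst (F, X) \<subseteq> set (take t1 es) \<and> snd (F, X) \<inter> set (take t es) = {})
      \<le> (t1 / ?m) ^ card F * exp (- (\<xi> * (real t - h) / ?m))" by simp
  qed
  also have "\<dots> = (\<Sum>F | F \<subseteq> E \<and> card F \<le> h. card {X \<in> XX F. X \<subseteq> E - F \<and> \<xi> \<le> card X} * ((t1 / ?m) ^ card F * exp (- (\<xi> * (real t - h) / ?m))))"
    unfolding I_def using XX finF by (subst sum.Sigma[symmetric]) auto
  also have "\<dots> \<le> (\<Sum>F | F \<subseteq> E \<and> card F \<le> h. (N * exp (- (\<xi> * (real t - h) / ?m))) * (4 * t1 / ?m) ^ card F)"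
  proof (rule sum_mono)
    fix F assume F: "F \<in> {F. F \<subseteq> E \<and> card F \<le> h}"
    have "card {X \<in> XX F. X \<subseteq> E - F \<and> \<xi> \<le> card X} \<le> card (XX F)" using XX F by (intro card_mono) auto
    then have "real (card {X \<in> XX F. X \<subseteq> E - F \<and> \<xi> \<le> card X}) \<le> N * 4 ^ card F" using XX[of F] F by auto
    then have "card {X \<in> XX F. X \<subseteq> E - F \<and> \<xi> \<le> card X} * ((t1 / ?m) ^ card F * exp (- (\<xi> * (real t - h) / ?m)))
       \<le> N * 4 ^ card F * ((t1 / ?m) ^ card F * exp (- (\<xi> * (real t - h) / ?m)))"
      by (intro mult_right_mono) auto
    also have "\<dots> = (N * exp (- (\<xi> * (real t - h) / ?m))) * (4 * t1 / ?m) ^ card F"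
      by (simp add: power_mult_distrib power_divide)
    finally show "card {X \<in> XX F. X \<subseteq> E - F \<and> \<xi> \<le> card X} * ((t1 / ?m) ^ card F * exp (- (\<xi> * (real t - h) / ?m)))
       \<le> (N * exp (- (\<xi> * (real t - h) / ?m))) * (4 * t1 / ?m) ^ card F" .
  qed
  also have "\<dots> = (N * exp (- (\<xi> * (real t - h) / ?m))) * (\<Sum>F | F \<subseteq> E \<and> card F \<le> h. (4 * t1 / ?m) ^ card F)"
    by (simp add: sum_distrib_left)
  also have "\<dots> \<le> (N * exp (- (\<xi> * (real t - h) / ?m))) * ((1 / x) ^ h * exp (?m * (x * (4 * t1 / ?m))))"
    using N x E by (intro mult_left_mono sum_small_subsets) auto
  also have "\<dots> \<le> (N * exp (- (\<xi> * (real t - h) / ?m))) * ((1 / x) ^ h * exp (4 * x * t1))"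
    using N x by (intro mult_left_mono) auto
  finally show ?thesis by (simp add: mult_ac)
qed

text \<open>
  First x is chosen so that the term 16 x is small, which fixes ln (1 / x), and then \<alpha>.
\<close>

lemma sprinkling_constants:
  fixes \<eta> \<theta> :: real
  assumes "0 < \<eta>" "0 < \<theta>"
  obtains x \<alpha> where "0 < x" "x \<le> 1" "0 < \<alpha>" "8 * \<alpha> \<le> \<theta>" "\<alpha> * ln (1 / x) + 16 * x + 4 * \<eta> * \<alpha> \<le> \<eta> * \<theta> / 2"
proof -
  define x where "x = min 1 (\<eta> * \<theta> / 64)"
  have x: "0 < x" "x \<le> 1" "16 * x \<le> \<eta> * \<theta> / 4" using assms by (auto simp: x_def)
  define c where "c = ln (1 / x) + 4 * \<eta>"
  have "0 \<le> ln (1 / x)" using x by (intro ln_ge_zero) auto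
  then have c: "0 < c" using assms by (simp add: c_def)
  define \<alpha> where "\<alpha> = min (\<theta> / 8) (\<eta> * \<theta> / 4 / c)"
  have "\<alpha> \<le> \<eta> * \<theta> / 4 / c" by (simp add: \<alpha>_def)
  then have "\<alpha> * c \<le> \<eta> * \<theta> / 4" using c by (simp add: pos_le_divide_eq)
  then have "\<alpha> * ln (1 / x) + 16 * x + 4 * \<eta> * \<alpha> \<le> \<eta> * \<theta> / 2" using x by (simp add: c_def algebra_simps)
  moreover have "0 < \<alpha>" "8 * \<alpha> \<le> \<theta>" using assms c by (auto simp: \<alpha>_def)
  ultimately show ?thesis using that x by blast
qed

text \<open>
  The number of edges at density \<theta> ln n / n, for a host with m edges.
\<close>

definition edge_time :: "real \<Rightarrow> nat \<Rightarrow> nat \<Rightarrow> nat" where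
  "edge_time \<theta> n m = nat \<lfloor>\<theta> * m * ln n / n\<rfloor>"

lemma edge_time_le: "0 \<le> \<theta> \<Longrightarrow> 1 \<le> n \<Longrightarrow> real (edge_time \<theta> n m) \<le> \<theta> * m * ln n / n"
  unfolding edge_time_def by (subst of_nat_nat) auto

lemma edge_time_ge: "\<theta> * m * ln n / n - 1 \<le> real (edge_time \<theta> n m)"
  unfolding edge_time_def by linarith

lemma edge_time_mono: "\<theta> \<le> \<theta>' \<Longrightarrow> 1 \<le> n \<Longrightarrow> edge_time \<theta> n m \<le> edge_time \<theta>' n m"
  unfolding edge_time_def by (intro nat_mono floor_mono divide_right_mono mult_right_mono) auto

context dirac_host
begin

text \<open>
  These bounds let \<theta> m ln n / n be estimated by multiples of n ln n, uniformly over all hosts.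
\<close>

lemma card_E_bounds: "real n ^ 2 / 4 \<le> card E" "real (card E) \<le> real n ^ 2 / 2"
proof -
  have "real n * (real n / 2) \<le> (\<Sum>v\<in>V. real (deg E v))"
  proof -
    have "real n / 2 \<le> deg E v" if "v \<in> V" for v
    proof -
      have "real n / 2 \<le> (1 / 2 + \<epsilon>) * n" using eps by (simp add: algebra_simps)
      then show ?thesis using host_degree[OF that] by (simp add: deg_def)
    qed
    then show ?thesis using sum_bounded_below[of V "real n / 2" "\<lambda>v. real (deg E v)"] by (simp add: card_V)
  qed
  also have "\<dots> = card {(v, u). v \<in> V \<and> {v, u} \<in> E}" using ordered_pairs_sum[of E V] finite_V by simp
  also have "\<dots> \<le> card {(u, v). {u, v} \<in> E}"
    by (intro of_nat_mono card_mono card_ordered_pairs_le(2)[OF finite_E]) auto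
  also have "\<dots> \<le> 2 * card E" using card_ordered_pairs_le(1)[OF finite_E] by linarith
  finally show "real n ^ 2 / 4 \<le> card E" by (simp add: power2_eq_square)
  have "card E \<le> card {e. e \<subseteq> V \<and> card e = 2}" using simple finite_V by (intro card_mono) auto
  also have "\<dots> = n choose 2" using n_subsets[OF finite_V, of 2] by (simp add: card_V)
  finally have "2 * card E \<le> n * (n - 1)" by (simp add: choose_two)
  also have "\<dots> \<le> n * n" by simp
  finally have "2 * real (card E) \<le> real n * real n" by (metis of_nat_le_iff of_nat_mult of_nat_numeral)
  then show "real (card E) \<le> real n ^ 2 / 2" by (simp add: power2_eq_square)
qed

lemma card_E_pos: "0 < card E"
  using card_E_bounds(1) large by (cases "card E = 0") auto

abbreviation snapshot :: "real \<Rightarrow> 'a set list \<Rightarrow> 'a set set" where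
  "snapshot \<theta> es \<equiv> set (take (edge_time \<theta> n (card E)) es)"

text \<open>
  The bad event of the union bounds: some sparse F in the late snapshot has a large set X \<in> XX F of further host edges
  that the snapshot of density \<theta> misses.
\<close>

definition avoids :: "('a set set \<Rightarrow> 'a set set set) \<Rightarrow> nat \<Rightarrow> real \<Rightarrow> real \<Rightarrow> 'a set list \<Rightarrow> bool" where
  "avoids XX h \<eta> \<theta> es \<longleftrightarrow> (\<exists>F X. F \<subseteq> snapshot 8 es \<and> card F \<le> h \<and> X \<in> XX F \<and> X \<subseteq> E - F \<and>
     \<eta> * real n ^ 2 \<le> card X \<and> X \<inter> snapshot \<theta> es = {})"

lemma edge_time_upper: "0 \<le> \<theta> \<Longrightarrow> real (edge_time \<theta> n (card E)) \<le> \<theta> / 2 * (n * ln n)"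
proof -
  assume \<theta>: "0 \<le> \<theta>"
  have "real (edge_time \<theta> n (card E)) \<le> \<theta> * card E * ln n / n" using \<theta> large by (intro edge_time_le) auto
  also have "\<dots> \<le> \<theta> * (real n ^ 2 / 2) * ln n / n"
    using \<theta> card_E_bounds large by (intro divide_right_mono mult_right_mono mult_left_mono) auto
  also have "\<dots> = \<theta> / 2 * (n * ln n)" using large by (simp add: power2_eq_square)
  finally show ?thesis .
qed

lemma edge_time_lower: "0 \<le> \<theta> \<Longrightarrow> \<theta> / 4 * (n * ln n) - 1 \<le> real (edge_time \<theta> n (card E))"
proof -
  assume \<theta>: "0 \<le> \<theta>"
  have "\<theta> / 4 * (n * ln n) = \<theta> * (real n ^ 2 / 4) * ln n / n" using large by (simp add: power2_eq_square)
  also have "\<dots> \<le> \<theta> * card E * ln n / n"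
    using \<theta> card_E_bounds large by (intro divide_right_mono mult_right_mono mult_left_mono) auto
  finally show ?thesis using edge_time_ge[of \<theta> "card E" n] by linarith
qed

lemma edge_rate_lower: "0 \<le> c \<Longrightarrow> \<theta> * ln n / n - 4 * (1 + c) / real n ^ 2 \<le> (real (edge_time \<theta> n (card E)) - c) / card E"
proof -
  assume c: "0 \<le> c"
  have m: "0 < real (card E)" using card_E_pos by simp
  have "(1 + c) / card E \<le> (1 + c) / (real n ^ 2 / 4)"
    using card_E_bounds(1) large c m by (intro divide_left_mono mult_pos_pos) auto
  then have "\<theta> * ln n / n - 4 * (1 + c) / real n ^ 2 \<le> \<theta> * ln n / n - (1 + c) / card E"
    by (simp add: algebra_simps)
  also have "\<dots> = (\<theta> * card E * ln n / n - 1 - c) / card E"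
    using m by (simp add: diff_divide_distrib add_divide_distrib)
  also have "\<dots> \<le> (real (edge_time \<theta> n (card E)) - c) / card E"
    using edge_time_ge[of \<theta> "card E" n] by (intro divide_right_mono) auto
  finally show ?thesis .
qed

lemma edge_rate_upper: "0 \<le> \<theta> \<Longrightarrow> real (edge_time \<theta> n (card E)) / card E \<le> \<theta> * ln n / n"
proof -
  assume \<theta>: "0 \<le> \<theta>"
  have "real (edge_time \<theta> n (card E)) / card E \<le> (\<theta> * card E * ln n / n) / card E"
    using edge_time_le[OF \<theta>, of n "card E"] large by (intro divide_right_mono) auto
  also have "\<dots> = \<theta> * ln n / n" using card_E_pos by simp
  finally show ?thesis .
qed

lemma edge_time_le_card: "0 \<le> \<theta> \<Longrightarrow> \<theta> * ln n \<le> n \<Longrightarrow> edge_time \<theta> n (card E) \<le> card E"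
proof -
  assume "0 \<le> \<theta>" "\<theta> * ln n \<le> n"
  then have "\<theta> * ln n / n \<le> 1" using large by simp
  then have "real (edge_time \<theta> n (card E)) / card E \<le> 1" using edge_rate_upper[OF \<open>0 \<le> \<theta>\<close>] by linarith
  then show ?thesis using card_E_pos by (simp add: divide_le_eq)
qed

text \<open>
  The exponents add up as follows: \<alpha> n ln n times ln (1 / x) for the size of F, 16 x n ln n for the late snapshot, and
  - \<eta> (\<theta> - 4 \<alpha>) n ln n for missing X after up to \<alpha> n ln n positions have been taken by F.
\<close>

lemma sprinkling_explicit:
  fixes \<eta> \<theta> x \<alpha> :: real
  assumes \<eta>: "0 < \<eta>" and \<theta>: "0 < \<theta>" and x: "0 < x" "x \<le> 1" and \<alpha>: "0 < \<alpha>" "8 * \<alpha> \<le> \<theta>"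
    and c: "\<alpha> * ln (1 / x) + 16 * x + 4 * \<eta> * \<alpha> \<le> \<eta> * \<theta> / 2"
    and n: "8 * ln n \<le> n" "\<theta> * ln n \<le> n" "1 \<le> \<theta> / 8 * (n * ln n)"
    and XX: "\<And>F. F \<subseteq> E \<Longrightarrow> finite (XX F) \<and> real (card (XX F)) \<le> real n * 4 ^ n * 4 ^ card F"
    and h: "real h \<le> \<alpha> * (n * ln n)"
  shows "order_prob E (avoids XX h \<eta> \<theta>)
    \<le> real n * 4 ^ n * exp (- (\<eta> * \<theta> / 2) * (n * ln n) + 4 * \<eta>)"
proof -
  let ?t = "edge_time \<theta> n (card E)" and ?t1 = "edge_time 8 n (card E)" and ?L = "real n * ln n"
  have L: "0 \<le> ?L" using large by simp
  have "\<alpha> * ?L \<le> \<theta> / 8 * ?L" using \<alpha> L by (intro mult_right_mono) auto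
  moreover have "\<theta> / 4 * ?L = \<theta> / 8 * ?L + \<theta> / 8 * ?L" by simp
  ultimately have "h \<le> ?t" using h edge_time_lower[of \<theta>] n(3) \<theta> by linarith
  have "order_prob E (avoids XX h \<eta> \<theta>)
    \<le> (real n * 4 ^ n) * (1 / x) ^ h * exp (4 * x * ?t1) * exp (- (\<eta> * real n ^ 2 * (real ?t - h) / card E))"
    unfolding avoids_def[abs_def]
    by (rule sprinkling[OF finite_E _ _ \<open>h \<le> ?t\<close> XX x])
      (use \<eta> \<theta> n in \<open>auto intro!: edge_time_le_card\<close>)
  also have "\<dots> = (real n * 4 ^ n) * exp (real h * ln (1 / x) + 4 * x * ?t1 - \<eta> * real n ^ 2 * ((real ?t - h) / card E))"
  proof -
    have "(1 / x) ^ h = exp (real h * ln (1 / x))" using x by (simp add: exp_of_nat_mult)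
    then show ?thesis by (simp add: exp_add exp_diff exp_minus field_simps)
  qed
  also have "\<dots> \<le> (real n * 4 ^ n) * exp (- (\<eta> * \<theta> / 2) * ?L + 4 * \<eta>)"
  proof -
    have "0 \<le> ln (1 / x)" using x by (intro ln_ge_zero) auto
    then have 1: "real h * ln (1 / x) \<le> \<alpha> * ?L * ln (1 / x)" using h by (intro mult_right_mono) auto
    have 2: "4 * x * ?t1 \<le> 4 * x * (4 * ?L)" using edge_time_upper[of 8] x by (intro mult_left_mono) auto
    have "\<theta> * ln n / n - 4 * (1 + \<alpha> * ?L) / real n ^ 2 \<le> (real ?t - \<alpha> * ?L) / card E"
      using \<alpha> L by (intro edge_rate_lower) auto
    also have "\<dots> \<le> (real ?t - h) / card E" using h by (intro divide_right_mono) auto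
    finally have "\<eta> * real n ^ 2 * (\<theta> * ln n / n - 4 * (1 + \<alpha> * ?L) / real n ^ 2) \<le> \<eta> * real n ^ 2 * ((real ?t - h) / card E)"
      using \<eta> by (intro mult_left_mono) auto
    moreover have "\<eta> * real n ^ 2 * (\<theta> * ln n / n - 4 * (1 + \<alpha> * ?L) / real n ^ 2) = \<eta> * \<theta> * ?L - 4 * \<eta> - 4 * \<eta> * \<alpha> * ?L"
    proof -
      have "\<eta> * real n ^ 2 * (\<theta> * ln n / n) = \<eta> * \<theta> * ?L" using large by (simp add: power2_eq_square)
      moreover have "\<eta> * real n ^ 2 * (4 * (1 + \<alpha> * ?L) / real n ^ 2) = \<eta> * (4 * (1 + \<alpha> * ?L))" using large by simp
      ultimately show ?thesis by (simp only: right_diff_distrib) (simp add: algebra_simps)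
    qed
    ultimately have "real h * ln (1 / x) + 4 * x * ?t1 - \<eta> * real n ^ 2 * ((real ?t - h) / card E)
       \<le> (\<alpha> * ln (1 / x) + 16 * x + 4 * \<eta> * \<alpha>) * ?L - \<eta> * \<theta> * ?L + 4 * \<eta>"
      using 1 2 by (simp add: algebra_simps)
    also have "\<dots> \<le> (\<eta> * \<theta> / 2) * ?L - \<eta> * \<theta> * ?L + 4 * \<eta>" using mult_right_mono[OF c L] by simp
    finally have "real h * ln (1 / x) + 4 * x * ?t1 - \<eta> * real n ^ 2 * ((real ?t - h) / card E) \<le> - (\<eta> * \<theta> / 2) * ?L + 4 * \<eta>"
      by (simp add: algebra_simps)
    then show ?thesis by (intro mult_left_mono) auto
  qed
  finally show ?thesis .
qed

end

lemma superexponential_tendsto_0: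
  fixes k c :: real
  assumes "0 < k"
  shows "(\<lambda>n. real n * 4 ^ n * exp (- k * (real n * ln (real n)) + c)) \<longlonglongrightarrow> 0"
  using assms by real_asymp

section \<open>Low degrees and short paths\<close>

lemma path_edges_card: "distinct vs \<Longrightarrow> vs \<noteq> [] \<Longrightarrow> finite (path_edges vs) \<and> \<Union> (path_edges vs) \<subseteq> set vs \<and> card (path_edges vs) = length vs - 1"
proof (induction vs rule: path_edges.induct)
  case (1 x y zs)
  then have IH: "finite (path_edges (y # zs))" "\<Union> (path_edges (y # zs)) \<subseteq> set (y # zs)" "card (path_edges (y # zs)) = length (y # zs) - 1"
    by auto
  then have "{x, y} \<notin> path_edges (y # zs)" using 1(2) by auto
  then show ?case using IH by auto
qed auto

lemma gpath_path_edges: "gpath H vs \<Longrightarrow> path_edges vs \<subseteq> H"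
  unfolding gpath_def by (induction vs rule: path_edges.induct) auto

lemma prob_contain:
  assumes "finite E" "F \<subseteq> E" "t \<le> card E"
  shows "order_prob E (\<lambda>es. F \<subseteq> set (take t es)) \<le> (real t / card E) ^ card F"
  using prob_contain_avoid[OF assms(1,2), of "{}" "card E" t] assms by (simp add: card_mono)

context dirac_host
begin

lemma deg_eq_card_star: "H \<subseteq> E \<Longrightarrow> deg H v = card {e \<in> H. v \<in> e}"
  by (rule deg_eq_card_edges) (use simple in blast)

lemma card_star_bounds:
  assumes "v \<in> V"
  shows "(1 / 2 + \<epsilon>) * n \<le> card {e \<in> E. v \<in> e}" "card {e \<in> E. v \<in> e} \<le> n"
proof -
  show "(1 / 2 + \<epsilon>) * n \<le> card {e \<in> E. v \<in> e}"
    using host_degree[OF assms] deg_eq_card_star[of E v] by (simp add: deg_def)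
  have "card {z. {v, z} \<in> E} \<le> card V" using host_nbrs[of v] finite_V by (intro card_mono) auto
  then show "card {e \<in> E. v \<in> e} \<le> n" using deg_eq_card_star[of E v] by (simp add: deg_def card_V)
qed

lemma take_subset: "es \<in> permutations_of_set E \<Longrightarrow> set (take t es) \<subseteq> E"
  using set_take_subset[of t es] by (auto simp: permutations_of_set_def)

text \<open>
  At density 8 a vertex misses n / 2 host edges with probability about n to the power -4, so there is ample room for summing over
  the vertex and over the at most one edge that it keeps.
\<close>

lemma prob_small_degree:
  assumes n: "8 * ln n \<le> n" "1 \<le> edge_time 8 n (card E)"
  shows "order_prob E (\<lambda>es. \<exists>v\<in>V. deg (snapshot 8 es) v < 2)
    \<le> real n * (real n * exp 1) * exp (- ((real n / 2 - 1) * (8 * ln n / n - 8 / real n ^ 2)))"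
proof -
  let ?t = "edge_time 8 n (card E)" and ?m = "real (card E)"
  define A where "A v = {e \<in> E. v \<in> e}" for v
  define I where "I = Sigma V (\<lambda>v. {J. J \<subseteq> A v \<and> card J \<le> 1})"
  have finA: "finite (A v)" for v using finite_E by (simp add: A_def)
  have tm: "?t \<le> card E" using n(1) by (intro edge_time_le_card) auto
  define K where "K = exp (- ((real n / 2 - 1) * (8 * ln n / n - 8 / real n ^ 2)))"
  have "order_prob E (\<lambda>es. \<exists>v\<in>V. deg (set (take ?t es)) v < 2)
    \<le> (\<Sum>i\<in>I. order_prob E (\<lambda>es. snd i \<subseteq> set (take ?t es) \<and> (A (fst i) - snd i) \<inter> set (take ?t es) = {}))"
  proof (rule order_prob_union_bound[OF finite_E])
    show "finite I" unfolding I_def using finite_V finA by auto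
    fix es assume es: "es \<in> permutations_of_set E" and "\<exists>v\<in>V. deg (set (take ?t es)) v < 2"
    then obtain v where v: "v \<in> V" "deg (set (take ?t es)) v < 2" by auto
    let ?J = "A v \<inter> set (take ?t es)"
    have "?J = {e \<in> set (take ?t es). v \<in> e}" using take_subset[OF es] by (auto simp: A_def)
    then have "card ?J \<le> 1" using v(2) deg_eq_card_star[OF take_subset[OF es], of ?t v] by simp
    then have "(v, ?J) \<in> I" using v(1) by (auto simp: I_def)
    then show "\<exists>i\<in>I. snd i \<subseteq> set (take ?t es) \<and> (A (fst i) - snd i) \<inter> set (take ?t es) = {}"
      by (rule bexI[rotated]) auto
  qed
  also have "\<dots> \<le> (\<Sum>(v, J)\<in>I. (?t / ?m) ^ card J * K)"
  proof (rule sum_mono, clarify)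
    fix v J assume "(v, J) \<in> I"
    then have vJ: "v \<in> V" "J \<subseteq> A v" "card J \<le> 1" by (auto simp: I_def)
    have "order_prob E (\<lambda>es. J \<subseteq> set (take ?t es) \<and> (A v - J) \<inter> set (take ?t es) = {})
       \<le> (?t / ?m) ^ card J * exp (- (real (card (A v - J)) * (real ?t - card J) / ?m))"
      using vJ n(2) tm by (intro prob_contain_avoid[OF finite_E]) (auto simp: A_def)
    also have "\<dots> \<le> (?t / ?m) ^ card J * K"
    proof -
      have "card (A v) \<le> card (A v - J) + card J"
        using finA[of v] vJ finite_subset[OF vJ(2) finA] by (simp add: card_Diff_subset)
      moreover have "real n / 2 \<le> (1 / 2 + \<epsilon>) * n" using eps by (simp add: algebra_simps)
      ultimately have 1: "real n / 2 - 1 \<le> card (A v - J)" using card_star_bounds(1)[OF vJ(1)] vJ(3) unfolding A_def by linarith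
      have "8 * ln n / n - 8 / real n ^ 2 \<le> (real ?t - 1) / ?m" using edge_rate_lower[of 1 8] by simp
      then have "(real n / 2 - 1) * (8 * ln n / n - 8 / real n ^ 2) \<le> (real n / 2 - 1) * ((real ?t - 1) / ?m)"
        using large by (intro mult_left_mono) auto
      also have "\<dots> \<le> real (card (A v - J)) * ((real ?t - card J) / ?m)"
        using 1 vJ(3) n(2) by (intro mult_mono divide_right_mono) auto
      finally show ?thesis unfolding K_def by (intro mult_left_mono) auto
    qed
    finally show "order_prob E (\<lambda>es. snd (v, J) \<subseteq> set (take ?t es) \<and> (A (fst (v, J)) - snd (v, J)) \<inter> set (take ?t es) = {})
       \<le> (?t / ?m) ^ card J * K" by simp
  qed
  also have "\<dots> = (\<Sum>v\<in>V. (\<Sum>J | J \<subseteq> A v \<and> card J \<le> 1. (?t / ?m) ^ card J) * K)"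
    unfolding I_def using finite_V finA by (subst sum.Sigma[symmetric]) (auto simp: sum_distrib_right)
  also have "\<dots> \<le> (\<Sum>v\<in>V. (real n * exp 1) * K)"
  proof (intro sum_mono mult_right_mono)
    fix v assume v: "v \<in> V"
    \<comment> \<open>The weight parameter 1 / n balances the single possible edge against about n edges at v.\<close>
    have "(\<Sum>J | J \<subseteq> A v \<and> card J \<le> 1. (?t / ?m) ^ card J) \<le> (1 / (1 / real n)) ^ 1 * exp (real (card (A v)) * ((1 / real n) * (?t / ?m)))"
      using large finA by (intro sum_small_subsets) auto
    also have "\<dots> \<le> real n * exp 1"
    proof -
      have "real (card (A v)) * ((1 / real n) * (?t / ?m)) \<le> n * ((1 / real n) * 1)"
        using card_star_bounds(2)[OF v] tm card_E_pos by (intro mult_mono) (auto simp: A_def divide_le_eq)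
      then show ?thesis using large by (intro mult_mono) auto
    qed
    finally show "(\<Sum>J | J \<subseteq> A v \<and> card J \<le> 1. (?t / ?m) ^ card J) \<le> real n * exp 1" .
  qed (simp add: K_def)
  also have "\<dots> = real n * (real n * exp 1) * K" by (simp add: card_V)
  finally show ?thesis by (simp add: K_def)
qed

text \<open>
  The path edges are present late, while all but fewer than 2 d of the edges at its two ends are absent early. At most one edge
  is counted at both ends, and four are on the path, so about (1 + 2\<epsilon>) n edges are constrained. The set J of the
  exceptional edges is summed over with weight parameter y.
\<close>

lemma prob_close_pair_fixed_path:
  fixes y :: real
  assumes vs: "distinct vs" "set vs \<subseteq> V" "2 \<le> length vs" "length vs \<le> 5" "path_edges vs \<subseteq> E"
    and y: "0 < y" "y \<le> 1" and n: "8 * ln n \<le> n" "4 + 2 * d \<le> edge_time (1 - \<epsilon>) n (card E)"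
      "real (5 + 2 * d) \<le> n"
  shows "order_prob E (\<lambda>es. gpath (snapshot 8 es) vs \<and>
      deg (snapshot (1 - \<epsilon>) es) (hd vs) < d \<and> deg (snapshot (1 - \<epsilon>) es) (last vs) < d)
    \<le> (8 * ln n / n) ^ (length vs - 1) * ((1 / y) ^ (2 * d) * exp (16 * y * ln n) *
      exp (- (((1 + 2 * \<epsilon>) * n - (5 + 2 * real d)) * ((1 - \<epsilon>) * ln n / n - 4 * (5 + 2 * real d) / real n ^ 2))))"
proof -
  let ?t1 = "edge_time 8 n (card E)" and ?t0 = "edge_time (1 - \<epsilon>) n (card E)" and ?m = "real (card E)"
  let ?a = "hd vs" and ?b = "last vs"
  define P where "P = path_edges vs"
  define A where "A = {e \<in> E. ?a \<in> e} \<union> {e \<in> E. ?b \<in> e} - P"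
  define I where "I = {J. J \<subseteq> A \<and> card J \<le> 2 * d}"
  define K where "K = exp (- (((1 + 2 * \<epsilon>) * n - (5 + 2 * real d)) * ((1 - \<epsilon>) * ln n / n - 4 * (5 + 2 * real d) / real n ^ 2)))"
  have ab: "?a \<in> V" "?b \<in> V" "?a \<noteq> ?b"
  proof -
    have ne: "vs \<noteq> []" using vs by auto
    show "?a \<in> V" "?b \<in> V" using hd_in_set[OF ne] last_in_set[OF ne] vs by auto
    show "?a \<noteq> ?b" using vs by (simp add: hd_conv_nth last_conv_nth ne nth_eq_iff_index_eq)
  qed
  have P: "finite P" "card P = length vs - 1" "P \<subseteq> E"
  proof -
    have "vs \<noteq> []" using vs(3) by auto
    then show "finite P" "card P = length vs - 1" "P \<subseteq> E"
      using path_edges_card[OF vs(1)] vs(5) by (auto simp: P_def)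
  qed
  have finA: "finite A" using finite_E by (simp add: A_def)
  have cA_upper: "card A \<le> 2 * n"
  proof -
    have "card A \<le> card ({e \<in> E. ?a \<in> e} \<union> {e \<in> E. ?b \<in> e})" unfolding A_def using finite_E by (intro card_mono) auto
    also have "\<dots> \<le> card {e \<in> E. ?a \<in> e} + card {e \<in> E. ?b \<in> e}" by (rule card_Un_le)
    finally show ?thesis using card_star_bounds(2)[OF ab(1)] card_star_bounds(2)[OF ab(2)] by linarith
  qed
  have cA_lower: "(1 + 2 * \<epsilon>) * n - 5 \<le> card A"
  proof -
    let ?S = "{e \<in> E. ?a \<in> e}" and ?T = "{e \<in> E. ?b \<in> e}"
    have "?S \<inter> ?T \<subseteq> {{?a, ?b}}"
    proof
      fix e assume e: "e \<in> ?S \<inter> ?T"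
      then have "card e = 2" "{?a, ?b} \<subseteq> e" using simple by auto
      moreover have "card {?a, ?b} = 2" using ab by simp
      ultimately have "{?a, ?b} = e" by (metis card_subset_eq card.infinite zero_neq_numeral)
      then show "e \<in> {{?a, ?b}}" by simp
    qed
    then have i: "card (?S \<inter> ?T) \<le> 1" using card_mono[of "{{?a, ?b}}" "?S \<inter> ?T"] by simp
    have "card ?S + card ?T = card (?S \<union> ?T) + card (?S \<inter> ?T)" using finite_E by (intro card_Un_Int) auto
    moreover have "card (?S \<union> ?T) \<le> card A + card P"
      using card_Un_le[of A P] card_mono[of "A \<union> P" "?S \<union> ?T"] finA P by (auto simp: A_def)
    ultimately have "real (card ?S) + real (card ?T) \<le> card A + 5" using i P(2) vs(4) by linarith
    then show ?thesis using card_star_bounds(1)[OF ab(1)] card_star_bounds(1)[OF ab(2)] by (simp add: algebra_simps)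
  qed
  have t1: "?t1 \<le> card E" using n(1) by (intro edge_time_le_card) auto
  have "(1 - \<epsilon>) * ln n \<le> 8 * ln n" using eps large by (intro mult_right_mono) auto
  then have t0: "?t0 \<le> card E" using n(1) eps by (intro edge_time_le_card) auto
  have q: "real ?t1 / ?m \<le> 8 * ln n / n" by (rule edge_rate_upper) simp
  have "order_prob E (\<lambda>es. gpath (set (take ?t1 es)) vs \<and> deg (set (take ?t0 es)) ?a < d \<and> deg (set (take ?t0 es)) ?b < d)
    \<le> (\<Sum>J\<in>I. order_prob E (\<lambda>es. P \<union> J \<subseteq> set (take ?t1 es) \<and> (A - J) \<inter> set (take ?t0 es) = {}))"
  proof (rule order_prob_union_bound[OF finite_E])
    show "finite I" using finA by (simp add: I_def)
    fix es assume es: "es \<in> permutations_of_set E"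
      and *: "gpath (set (take ?t1 es)) vs \<and> deg (set (take ?t0 es)) ?a < d \<and> deg (set (take ?t0 es)) ?b < d"
    let ?G0 = "set (take ?t0 es)"
    let ?J = "A \<inter> ?G0"
    have "card ?J \<le> card ({e \<in> ?G0. ?a \<in> e} \<union> {e \<in> ?G0. ?b \<in> e})" by (intro card_mono) (auto simp: A_def)
    also have "\<dots> \<le> card {e \<in> ?G0. ?a \<in> e} + card {e \<in> ?G0. ?b \<in> e}" by (rule card_Un_le)
    also have "\<dots> \<le> 2 * d" using * deg_eq_card_star[OF take_subset[OF es], of ?t0] by simp
    finally have JI: "?J \<in> I" by (simp add: I_def)
    have "edge_time (1 - \<epsilon>) n (card E) \<le> edge_time 8 n (card E)" using eps large by (intro edge_time_mono) auto
    then have "?G0 \<subseteq> set (take ?t1 es)" by (rule set_take_subset_set_take)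
    moreover have "P \<subseteq> set (take ?t1 es)" using gpath_path_edges * by (auto simp: P_def)
    ultimately have "P \<union> ?J \<subseteq> set (take ?t1 es) \<and> (A - ?J) \<inter> ?G0 = {}" by auto
    then show "\<exists>J\<in>I. P \<union> J \<subseteq> set (take ?t1 es) \<and> (A - J) \<inter> set (take ?t0 es) = {}" using JI by (rule bexI)
  qed
  also have "\<dots> \<le> (\<Sum>J\<in>I. (real ?t1 / ?m) ^ card P * ((real ?t1 / ?m) ^ card J * K))"
  proof (rule sum_mono)
    fix J assume "J \<in> I"
    then have J: "J \<subseteq> A" "card J \<le> 2 * d" by (auto simp: I_def)
    have finJ: "finite J" using J finA finite_subset by blast
    have cPJ: "card (P \<union> J) = card P + card J" using finJ P J by (intro card_Un_disjoint) (auto simp: A_def)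
    have "order_prob E (\<lambda>es. P \<union> J \<subseteq> set (take ?t1 es) \<and> (A - J) \<inter> set (take ?t0 es) = {})
       \<le> (?t1 / ?m) ^ card (P \<union> J) * exp (- (real (card (A - J)) * (real ?t0 - card (P \<union> J)) / ?m))"
      using J P vs n t0 t1 cPJ by (intro prob_contain_avoid[OF finite_E]) (auto simp: A_def)
    also have "\<dots> \<le> (?t1 / ?m) ^ card (P \<union> J) * K"
    proof -
      have "card A \<le> card (A - J) + card J" using finA J finJ by (simp add: card_Diff_subset)
      then have 1: "(1 + 2 * \<epsilon>) * n - (5 + 2 * real d) \<le> card (A - J)" using cA_lower J(2) by simp
      have pos: "0 \<le> (1 + 2 * \<epsilon>) * n - (5 + 2 * real d)"
      proof -
        have "0 \<le> 2 * \<epsilon> * n" using eps by simp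
        then show ?thesis using n(3) by (simp add: distrib_right)
      qed
      have "(1 - \<epsilon>) * ln n / n - 4 * (1 + (4 + 2 * real d)) / real n ^ 2 \<le> (real ?t0 - (4 + 2 * real d)) / ?m"
        by (rule edge_rate_lower) simp
      then have "((1 + 2 * \<epsilon>) * n - (5 + 2 * real d)) * ((1 - \<epsilon>) * ln n / n - 4 * (5 + 2 * real d) / real n ^ 2)
         \<le> ((1 + 2 * \<epsilon>) * n - (5 + 2 * real d)) * ((real ?t0 - (4 + 2 * real d)) / ?m)"
        using pos by (intro mult_left_mono) (auto simp: algebra_simps)
      also have "\<dots> \<le> real (card (A - J)) * ((real ?t0 - card (P \<union> J)) / ?m)"
        using 1 J(2) P(2) vs(4) n(2) cPJ by (intro mult_mono divide_right_mono) auto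
      finally show ?thesis unfolding K_def by (intro mult_left_mono) auto
    qed
    finally show "order_prob E (\<lambda>es. P \<union> J \<subseteq> set (take ?t1 es) \<and> (A - J) \<inter> set (take ?t0 es) = {})
       \<le> (real ?t1 / ?m) ^ card P * ((real ?t1 / ?m) ^ card J * K)" by (simp add: cPJ power_add)
  qed
  also have "\<dots> = (real ?t1 / ?m) ^ card P * (\<Sum>J\<in>I. (real ?t1 / ?m) ^ card J) * K"
    by (simp add: sum_distrib_left sum_distrib_right mult_ac)
  also have "\<dots> \<le> (8 * ln n / n) ^ card P * ((1 / y) ^ (2 * d) * exp (16 * y * ln n)) * K"
  proof (intro mult_right_mono mult_mono power_mono q)
    have "(\<Sum>J\<in>I. (real ?t1 / ?m) ^ card J) \<le> (1 / y) ^ (2 * d) * exp (real (card A) * (y * (real ?t1 / ?m)))"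
      unfolding I_def using y finA by (intro sum_small_subsets) auto
    also have "\<dots> \<le> (1 / y) ^ (2 * d) * exp (16 * y * ln n)"
    proof -
      have "real (card A) * (y * (real ?t1 / ?m)) \<le> (2 * real n) * (y * (8 * ln n / n))"
        using cA_upper q y by (intro mult_mono) auto
      also have "\<dots> = 16 * y * ln n" using large by simp
      finally show ?thesis using y by (intro mult_left_mono) auto
    qed
    finally show "(\<Sum>J\<in>I. (real ?t1 / ?m) ^ card J) \<le> (1 / y) ^ (2 * d) * exp (16 * y * ln n)" .
  qed (use large in \<open>auto simp: K_def intro!: sum_nonneg\<close>)
  finally show ?thesis by (simp add: K_def P(2) mult.assoc)
qed

lemma prob_close_pair:
  fixes y :: real
  assumes y: "0 < y" "y \<le> 1" and n: "8 * ln n \<le> n" "4 + 2 * d \<le> edge_time (1 - \<epsilon>) n (card E)"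
      "real (5 + 2 * d) \<le> n" "1 \<le> 8 * ln n"
  shows "order_prob E (\<lambda>es. \<exists>vs. gpath (snapshot 8 es) vs \<and> 2 \<le> length vs \<and> length vs \<le> 5 \<and>
      deg (snapshot (1 - \<epsilon>) es) (hd vs) < d \<and> deg (snapshot (1 - \<epsilon>) es) (last vs) < d)
    \<le> 4 * real n * (8 * ln n) ^ 4 * ((1 / y) ^ (2 * d) * exp (16 * y * ln n) *
      exp (- (((1 + 2 * \<epsilon>) * n - (5 + 2 * real d)) * ((1 - \<epsilon>) * ln n / n - 4 * (5 + 2 * real d) / real n ^ 2))))"
proof -
  let ?t1 = "edge_time 8 n (card E)" and ?t0 = "edge_time (1 - \<epsilon>) n (card E)"
  define K where "K = (1 / y) ^ (2 * d) * exp (16 * y * ln n) *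
      exp (- (((1 + 2 * \<epsilon>) * n - (5 + 2 * real d)) * ((1 - \<epsilon>) * ln n / n - 4 * (5 + 2 * real d) / real n ^ 2)))"
  have K: "0 \<le> K" using y by (simp add: K_def)
  define I where "I l = {vs. set vs \<subseteq> V \<and> length vs = l}" for l
  define I' where "I' l = {vs \<in> I l. distinct vs \<and> path_edges vs \<subseteq> E}" for l
  have fin: "finite (I l)" for l unfolding I_def using finite_V finite_lists_length_eq by blast
  have fin': "finite (I' l)" for l unfolding I'_def using fin by simp
  have cI: "card (I' l) \<le> n ^ l" for l
  proof -
    have "card (I' l) \<le> card (I l)" unfolding I'_def using fin by (intro card_mono) auto
    also have "\<dots> = n ^ l" unfolding I_def using card_lists_length_eq[OF finite_V, of l] by (simp add: card_V)
    finally show ?thesis .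
  qed
  let ?\<Phi> = "\<lambda>vs es. gpath (set (take ?t1 es)) vs \<and> deg (set (take ?t0 es)) (hd vs) < d \<and> deg (set (take ?t0 es)) (last vs) < d"
  have "order_prob E (\<lambda>es. \<exists>vs. gpath (set (take ?t1 es)) vs \<and> 2 \<le> length vs \<and> length vs \<le> 5 \<and>
      deg (set (take ?t0 es)) (hd vs) < d \<and> deg (set (take ?t0 es)) (last vs) < d)
     \<le> (\<Sum>i\<in>Sigma {2..5} I'. order_prob E (?\<Phi> (snd i)))"
  proof (rule order_prob_union_bound[OF finite_E])
    show "finite (Sigma {2..5} I')" using fin' by auto
    fix es assume es: "es \<in> permutations_of_set E" and "\<exists>vs. gpath (set (take ?t1 es)) vs \<and> 2 \<le> length vs \<and> length vs \<le> 5 \<and>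
      deg (set (take ?t0 es)) (hd vs) < d \<and> deg (set (take ?t0 es)) (last vs) < d"
    then obtain vs where vs: "gpath (set (take ?t1 es)) vs" "2 \<le> length vs" "length vs \<le> 5"
      "deg (set (take ?t0 es)) (hd vs) < d" "deg (set (take ?t0 es)) (last vs) < d" by blast
    have pE: "path_edges vs \<subseteq> E" using gpath_path_edges[OF vs(1)] take_subset[OF es] by blast
    have "set vs \<subseteq> V"
    proof
      fix x assume "x \<in> set vs"
      then obtain i where i: "i < length vs" "x = vs ! i" by (metis in_set_conv_nth)
      have s: "successively (\<lambda>x y. {x, y} \<in> E) vs"
        using gpath_mono[OF vs(1) take_subset[OF es]] by (simp add: gpath_def)
      show "x \<in> V"
      proof (cases "Suc i < length vs")
        case True
        then show ?thesis using successively_nth[OF s True] simple i by blast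
      next
        case False
        then obtain j where j: "i = Suc j" using vs(2) i by (cases i) auto
        then show ?thesis using successively_nth[OF s, of j] simple i by blast
      qed
    qed
    then have "(length vs, vs) \<in> Sigma {2..5} I'" using vs pE by (auto simp: I'_def I_def gpath_def)
    then show "\<exists>i\<in>Sigma {2..5} I'. ?\<Phi> (snd i) es" using vs by (intro bexI[of _ "(length vs, vs)"]) auto
  qed
  also have "\<dots> = (\<Sum>l\<in>{2..5}. \<Sum>vs\<in>I' l. order_prob E (?\<Phi> vs))"
    using fin' by (subst sum.Sigma) (auto simp: case_prod_unfold)
  also have "\<dots> \<le> (\<Sum>l\<in>{2..5}. \<Sum>vs\<in>I' l. (8 * ln n / n) ^ (l - 1) * K)"
  proof (intro sum_mono)
    fix l :: nat and vs assume l: "l \<in> {2..5}" and "vs \<in> I' l"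
    then have vs: "distinct vs" "set vs \<subseteq> V" "2 \<le> length vs" "length vs \<le> 5" "path_edges vs \<subseteq> E" "length vs = l"
      by (auto simp: I'_def I_def)
    show "order_prob E (?\<Phi> vs) \<le> (8 * ln n / n) ^ (l - 1) * K"
      using prob_close_pair_fixed_path[OF vs(1-5) y n(1-3)] vs(6) unfolding K_def by simp
  qed
  also have "\<dots> \<le> (\<Sum>l\<in>{2..5::nat}. n * (8 * ln n) ^ 4 * K)"
  proof (intro sum_mono)
    fix l :: nat assume l: "l \<in> {2..5}"
    have "(\<Sum>vs\<in>I' l. (8 * ln n / n) ^ (l - 1) * K) = card (I' l) * ((8 * ln n / n) ^ (l - 1) * K)" by simp
    also have "\<dots> \<le> real n ^ l * ((8 * ln n / n) ^ (l - 1) * K)"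
    proof (rule mult_right_mono)
      show "real (card (I' l)) \<le> real n ^ l" using cI[of l] by (metis of_nat_le_iff of_nat_power)
      show "0 \<le> (8 * ln n / n) ^ (l - 1) * K" using K large by auto
    qed
    also have "\<dots> = n * (8 * ln n) ^ (l - 1) * K"
    proof -
      obtain k where "l = Suc k" using l by (cases l) auto
      then show ?thesis using large by (simp add: power_divide)
    qed
    also have "\<dots> \<le> n * (8 * ln n) ^ 4 * K"
      using l n(4) K by (intro mult_right_mono mult_left_mono power_increasing) auto
    finally show "(\<Sum>vs\<in>I' l. (8 * ln n / n) ^ (l - 1) * K) \<le> n * (8 * ln n) ^ 4 * K" .
  qed
  also have "\<dots> = 4 * real n * (8 * ln n) ^ 4 * K" by simp
  finally show ?thesis unfolding K_def .
qed

end

section \<open>Dense spots and isolated vertices\<close>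

context dirac_host
begin

text \<open>
  A set U of u vertices spans at most u^2 / 2 host edges. The bound for d u / 12 of them to be present is
  of the form (const u / n) to the power g with g \<ge> \<delta> u ln n / 12, and the restriction on u makes its base at most 1 / e.
  One factor per vertex pays for the choice of U, and what remains of the exponent gives decay in n.
\<close>

lemma prob_dense_spot_of_size:
  fixes \<delta> :: real
  assumes \<delta>: "0 < \<delta>" and d: "\<delta> * ln n \<le> d" "12 \<le> \<delta> * ln n" and n: "8 * ln n \<le> n"
    and u: "1 \<le> u" "real u \<le> \<delta> / (48 * exp 2) * n"
  shows "order_prob E (\<lambda>es. \<exists>U\<subseteq>V. card U = u \<and> d * u \<le> 12 * card {e \<in> snapshot 8 es. e \<subseteq> U})
    \<le> (exp 3 * (48 / \<delta>) * exp (- (\<delta> / 12 * ln n))) ^ u"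
proof -
  let ?t = "edge_time 8 n (card E)" and ?m = "real (card E)"
  define \<mu> where "\<mu> = 48 / \<delta>"
  have \<mu>: "0 < \<mu>" using \<delta> by (simp add: \<mu>_def)
  define g where "g = nat \<lceil>real d * real u / 12\<rceil>"
  have g: "real d * u / 12 \<le> g" unfolding g_def by linarith
  define EU where "EU U = {e \<in> E. e \<subseteq> U}" for U
  have finEU: "finite (EU U)" for U using finite_E by (simp add: EU_def)
  define UU where "UU = {U. U \<subseteq> V \<and> card U = u}"
  have finUU: "finite UU" using finite_V by (simp add: UU_def)
  define I where "I = Sigma UU (\<lambda>U. {J. J \<subseteq> EU U \<and> card J = g})"
  have q: "real ?t / ?m \<le> 8 * ln n / n" by (rule edge_rate_upper) simp
  have t: "?t \<le> card E" using n by (intro edge_time_le_card) auto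
  have u0: "0 < real u" using u by simp
  have n0: "0 < real n" using large by simp
  have dL: "\<delta> * ln n * u / 12 \<le> g"
  proof -
    have "\<delta> * ln n * u / 12 \<le> real d * u / 12" using d(1) u0 by (intro divide_right_mono mult_right_mono) auto
    then show ?thesis using g by linarith
  qed
  have gu: "u \<le> g"
  proof -
    have "12 * real u / 12 \<le> \<delta> * ln n * u / 12" using d(2) u0 by (intro divide_right_mono mult_right_mono) auto
    then have "real u \<le> real g" using dL by simp
    then show ?thesis by simp
  qed
  define \<rho> where "\<rho> = exp 1 * \<mu> * u / n"
  have \<rho>: "0 < \<rho>" "\<rho> \<le> exp (- 1)"
  proof -
    show "0 < \<rho>" using \<mu> u0 n0 by (simp add: \<rho>_def)
    have "\<rho> = (exp 1 * \<mu> / n) * u" by (simp add: \<rho>_def)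
    also have "\<dots> \<le> (exp 1 * \<mu> / n) * (\<delta> / (48 * exp 2) * n)" using u \<mu> by (intro mult_left_mono) auto
    also have "\<dots> = exp 1 / exp 2" using \<delta> n0 by (simp add: \<mu>_def)
    also have "\<dots> = exp (- 1)" by (simp flip: exp_diff)
    finally show "\<rho> \<le> exp (- 1)" .
  qed
  define B where "B = \<rho> ^ u * exp u * exp (- (\<delta> / 12 * ln n * u))"
  have "order_prob E (\<lambda>es. \<exists>U\<subseteq>V. card U = u \<and> d * u \<le> 12 * card {e \<in> set (take ?t es). e \<subseteq> U})
    \<le> (\<Sum>i\<in>I. order_prob E (\<lambda>es. snd i \<subseteq> set (take ?t es)))"
  proof (rule order_prob_union_bound[OF finite_E])
    show "finite I" unfolding I_def using finUU finEU by auto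
    fix es assume es: "es \<in> permutations_of_set E" and "\<exists>U\<subseteq>V. card U = u \<and> d * u \<le> 12 * card {e \<in> set (take ?t es). e \<subseteq> U}"
    then obtain U where U: "U \<subseteq> V" "card U = u" "d * u \<le> 12 * card {e \<in> set (take ?t es). e \<subseteq> U}" by blast
    have "real d * u \<le> 12 * real (card {e \<in> set (take ?t es). e \<subseteq> U})"
      using U(3) by (metis of_nat_le_iff of_nat_mult of_nat_numeral)
    then have "g \<le> card {e \<in> set (take ?t es). e \<subseteq> U}" unfolding g_def by linarith
    then obtain J where J: "J \<subseteq> {e \<in> set (take ?t es). e \<subseteq> U}" "card J = g"
      by (meson obtain_subset_with_card_n)
    have "J \<subseteq> EU U" using J(1) take_subset[OF es] by (auto simp: EU_def)
    then have "(U, J) \<in> I" using U J by (auto simp: I_def UU_def)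
    then show "\<exists>i\<in>I. snd i \<subseteq> set (take ?t es)" using J(1) by (intro bexI[of _ "(U, J)"]) auto
  qed
  also have "\<dots> \<le> (\<Sum>(U, J)\<in>I. (?t / ?m) ^ card J)"
  proof (rule sum_mono, clarify)
    fix U J assume "(U, J) \<in> I"
    then have "J \<subseteq> E" by (auto simp: I_def EU_def)
    then show "order_prob E (\<lambda>es. snd (U, J) \<subseteq> set (take ?t es)) \<le> (?t / ?m) ^ card J"
      using prob_contain[OF finite_E _ t, of J] by simp
  qed
  also have "\<dots> = (\<Sum>U\<in>UU. \<Sum>J | J \<subseteq> EU U \<and> card J = g. (?t / ?m) ^ card J)"
    unfolding I_def using finUU finEU by (subst sum.Sigma[symmetric]) auto
  also have "\<dots> \<le> (\<Sum>U\<in>UU. B * 1 ^ card U)"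
  proof (rule sum_mono)
    fix U assume "U \<in> UU"
    then have U: "U \<subseteq> V" "card U = u" by (auto simp: UU_def)
    have finU: "finite U" using U finite_V finite_subset by blast
    have "card (EU U) \<le> card {e. e \<subseteq> U \<and> card e = 2}" unfolding EU_def using simple finU by (intro card_mono) auto
    also have "\<dots> = u choose 2" using n_subsets[OF finU, of 2] U by simp
    finally have "2 * card (EU U) \<le> u * (u - 1)" by (simp add: choose_two)
    also have "\<dots> \<le> u * u" by simp
    finally have "2 * real (card (EU U)) \<le> real u * real u" by (metis of_nat_le_iff of_nat_mult of_nat_numeral)
    then have cEU: "real (card (EU U)) \<le> real u * u / 2" by simp
    \<comment> \<open>The weight parameter is chosen so that the exponential factor of the bound is at most exp g.\<close>
    let ?y = "real n / (\<mu> * u)"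
    have y: "0 < ?y" using n0 \<mu> u0 by simp
    have "(\<Sum>J | J \<subseteq> EU U \<and> card J = g. (?t / ?m) ^ card J) \<le> (1 / ?y) ^ g * exp (real (card (EU U)) * (?y * (?t / ?m)))"
      using y finEU by (intro sum_subsets_of_size) auto
    also have "\<dots> \<le> (1 / ?y) ^ g * exp g"
    proof -
      have nonneg: "0 \<le> ?y * (?t / ?m)" using y by (intro mult_nonneg_nonneg) auto
      have "real (card (EU U)) * (?y * (?t / ?m)) \<le> (real u * u / 2) * (?y * (8 * ln n / n))"
        by (rule mult_mono[OF cEU mult_left_mono[OF q less_imp_le[OF y]] _ nonneg]) simp
      also have "\<dots> = \<delta> * ln n * u / 12" using n0 u0 \<delta> by (simp add: \<mu>_def field_simps)
      also have "\<dots> \<le> g" by (rule dL)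
      finally show ?thesis using \<mu> u0 n0 by (intro mult_left_mono zero_le_power) auto
    qed
    also have "\<dots> = \<rho> ^ g"
    proof -
      have "exp (real g) = exp 1 ^ g" using exp_of_nat_mult[of g "1 :: real"] by simp
      then show ?thesis by (simp add: \<rho>_def mult_ac flip: power_mult_distrib)
    qed
    also have "\<dots> = \<rho> ^ u * \<rho> ^ (g - u)" using gu by (simp flip: power_add)
    also have "\<dots> \<le> \<rho> ^ u * exp (- 1) ^ (g - u)" using \<rho> by (intro mult_left_mono power_mono) auto
    also have "exp (- 1) ^ (g - u) = exp (real u - real g)"
      using gu exp_of_nat_mult[of "g - u" "- 1 :: real"] by (simp add: of_nat_diff)
    also have "\<rho> ^ u * exp (real u - real g) \<le> \<rho> ^ u * exp (u - \<delta> / 12 * ln n * u)"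
      using dL \<rho> by (intro mult_left_mono) auto
    also have "\<dots> = B" by (simp only: B_def diff_conv_add_uminus exp_add mult.assoc)
    finally show "(\<Sum>J | J \<subseteq> EU U \<and> card J = g. (?t / ?m) ^ card J) \<le> B * 1 ^ card U" by simp
  qed
  also have "\<dots> = B * (\<Sum>U | U \<subseteq> V \<and> card U = u. 1 ^ card U)" by (simp add: UU_def)
  \<comment> \<open>The number of sets U, by the same bound with weight 1 and parameter u / n.\<close>
  also have "\<dots> \<le> B * ((1 / (real u / n)) ^ u * exp (real (card V) * ((real u / n) * 1)))"
    using finite_V u0 n0 \<rho> by (intro mult_left_mono sum_subsets_of_size) (auto simp: B_def)
  also have "\<dots> = (exp 3 * \<mu> * exp (- (\<delta> / 12 * ln n))) ^ u"
  proof -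
    have e: "exp (real u * c) = exp c ^ u" for c :: real by (simp add: exp_of_nat_mult)
    have "B * ((1 / (real u / n)) ^ u * exp (real (card V) * ((real u / n) * 1)))
       = \<rho> ^ u * exp (real u * 1) * exp (real u * (- (\<delta> / 12 * ln n))) * ((1 / (real u / n)) ^ u * exp (real u * 1))"
      using n0 by (simp add: B_def card_V mult.commute)
    also have "\<dots> = (\<rho> * exp 1 * exp (- (\<delta> / 12 * ln n)) * ((1 / (real u / n)) * exp 1)) ^ u"
      unfolding e by (simp only: power_mult_distrib)
    also have "\<rho> * exp 1 * exp (- (\<delta> / 12 * ln n)) * ((1 / (real u / n)) * exp 1) = (exp 1 * exp 1 * exp 1) * \<mu> * exp (- (\<delta> / 12 * ln n))"
      using u0 n0 by (simp add: \<rho>_def)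
    also have "exp 1 * exp 1 * exp 1 = (exp 3 :: real)" by (simp flip: exp_add)
    finally show ?thesis .
  qed
  finally show ?thesis by (simp add: \<mu>_def)
qed

text \<open>
  The bounds for the different sizes form a geometric series with a ratio tending to zero.
\<close>

lemma prob_dense_spot:
  fixes \<delta> :: real
  assumes \<delta>: "0 < \<delta>" and d: "\<delta> * ln n \<le> d" "12 \<le> \<delta> * ln n" and n: "8 * ln n \<le> n"
    and r: "exp 3 * (48 / \<delta>) * exp (- (\<delta> / 12 * ln n)) \<le> 1 / 2"
  shows "order_prob E (\<lambda>es. \<exists>U\<subseteq>V. U \<noteq> {} \<and> real (card U) \<le> \<delta> / (48 * exp 2) * n \<and>
      d * card U \<le> 12 * card {e \<in> snapshot 8 es. e \<subseteq> U})
    \<le> 2 * (exp 3 * (48 / \<delta>) * exp (- (\<delta> / 12 * ln n)))"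
proof -
  let ?t = "edge_time 8 n (card E)" and ?r = "exp 3 * (48 / \<delta>) * exp (- (\<delta> / 12 * ln n))"
  let ?I = "{u \<in> {1..n}. real u \<le> \<delta> / (48 * exp 2) * n}"
  have r0: "0 \<le> ?r" using \<delta> by simp
  have "order_prob E (\<lambda>es. \<exists>U\<subseteq>V. U \<noteq> {} \<and> real (card U) \<le> \<delta> / (48 * exp 2) * n \<and>
      d * card U \<le> 12 * card {e \<in> set (take ?t es). e \<subseteq> U})
    \<le> (\<Sum>u\<in>?I. order_prob E (\<lambda>es. \<exists>U\<subseteq>V. card U = u \<and> d * u \<le> 12 * card {e \<in> set (take ?t es). e \<subseteq> U}))"
  proof (rule order_prob_union_bound[OF finite_E])
    fix es assume "\<exists>U\<subseteq>V. U \<noteq> {} \<and> real (card U) \<le> \<delta> / (48 * exp 2) * n \<and> d * card U \<le> 12 * card {e \<in> set (take ?t es). e \<subseteq> U}"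
    then obtain U where U: "U \<subseteq> V" "U \<noteq> {}" "real (card U) \<le> \<delta> / (48 * exp 2) * n" "d * card U \<le> 12 * card {e \<in> set (take ?t es). e \<subseteq> U}" by blast
    have "card U \<in> ?I" using U finite_subset[OF U(1) finite_V] card_mono[OF finite_V U(1)] by (simp add: card_V Suc_le_eq card_gt_0_iff)
    then show "\<exists>u\<in>?I. \<exists>U\<subseteq>V. card U = u \<and> d * u \<le> 12 * card {e \<in> set (take ?t es). e \<subseteq> U}"
      using U by blast
  qed simp
  also have "\<dots> \<le> (\<Sum>u\<in>?I. ?r ^ u)"
    by (intro sum_mono prob_dense_spot_of_size[OF \<delta> d n]) auto
  also have "\<dots> \<le> (\<Sum>u\<in>{1..n}. ?r ^ u)" using r0 by (intro sum_mono2) auto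
  also have "\<dots> = (\<Sum>u<n. ?r * ?r ^ u)"
    by (rule sum.reindex_bij_witness[of _ Suc "\<lambda>u. u - 1"]) (auto simp flip: power_Suc)
  also have "\<dots> = ?r * (\<Sum>u<n. ?r ^ u)" by (simp add: sum_distrib_left)
  also have "\<dots> \<le> ?r * 2"
  proof (rule mult_left_mono[OF _ r0])
    have "(\<Sum>u<n. ?r ^ u) \<le> (\<Sum>u<n. (1 / 2) ^ u)" using r r0 by (intro sum_mono power_mono) auto
    also have "\<dots> \<le> 2" by (simp add: sum_gp_strict)
    finally show "(\<Sum>u<n. ?r ^ u) \<le> 2" .
  qed
  finally show ?thesis by simp
qed

end

text \<open>
  Chebyshev's inequality for the number X of vertices v with \<Phi> v: if X = 0 then X deviates from its mean \<mu> by \<mu>.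
\<close>

lemma second_moment:
  fixes \<omega> :: real
  assumes E: "finite E" and V: "finite V" and \<mu>: "\<mu> = (\<Sum>v\<in>V. order_prob E (\<Phi> v))" "0 < \<mu>"
    and pair: "\<And>u v. u \<in> V \<Longrightarrow> v \<in> V \<Longrightarrow> u \<noteq> v \<Longrightarrow>
       order_prob E (\<lambda>es. \<Phi> u es \<and> \<Phi> v es) \<le> (1 + \<omega>) * (order_prob E (\<Phi> u) * order_prob E (\<Phi> v))"
    and \<omega>: "0 \<le> \<omega>"
  shows "order_prob E (\<lambda>es. \<forall>v\<in>V. \<not> \<Phi> v es) \<le> 1 / \<mu> + \<omega>"
proof -
  define \<Omega> where "\<Omega> = permutations_of_set E"
  define N :: real where "N = fact (card E)"
  have N: "0 < N" by (simp add: N_def)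
  have fin: "finite \<Omega>" by (simp add: \<Omega>_def)
  have cN: "real (card \<Omega>) = N" using E by (simp add: \<Omega>_def N_def card_permutations_of_set)
  have sumP: "(\<Sum>es\<in>\<Omega>. of_bool (\<Psi> es)) = N * order_prob E \<Psi>" for \<Psi>
    using E fin by (simp add: order_prob_card \<Omega>_def N_def sum.If_cases of_bool_def Int_def)
  define p where "p v = order_prob E (\<Phi> v)" for v
  define X :: "_ \<Rightarrow> real" where "X es = (\<Sum>v\<in>V. of_bool (\<Phi> v es))" for es
  have sX: "(\<Sum>es\<in>\<Omega>. X es) = N * \<mu>"
    unfolding X_def by (subst sum.swap) (simp add: sumP \<mu> sum_distrib_left)
  have "(\<Sum>es\<in>\<Omega>. X es * X es) = (\<Sum>es\<in>\<Omega>. \<Sum>u\<in>V. \<Sum>v\<in>V. of_bool (\<Phi> u es \<and> \<Phi> v es))"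
    unfolding X_def sum_product by (intro sum.cong refl) auto
  also have "\<dots> = (\<Sum>u\<in>V. \<Sum>v\<in>V. \<Sum>es\<in>\<Omega>. of_bool (\<Phi> u es \<and> \<Phi> v es))"
    by (subst sum.swap, intro sum.cong refl, subst sum.swap) (rule refl)
  also have "\<dots> = (\<Sum>u\<in>V. \<Sum>v\<in>V. N * order_prob E (\<lambda>es. \<Phi> u es \<and> \<Phi> v es))" by (simp only: sumP)
  also have "\<dots> \<le> (\<Sum>u\<in>V. \<Sum>v\<in>V. N * ((if u = v then p u else 0) + (1 + \<omega>) * (p u * p v)))"
  proof (intro sum_mono mult_left_mono)
    fix u v assume uv: "u \<in> V" "v \<in> V"
    have "0 \<le> (1 + \<omega>) * (p u * p v)" unfolding p_def using \<omega> order_prob_nonneg[of E]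
      by (intro mult_nonneg_nonneg) auto
    then show "order_prob E (\<lambda>es. \<Phi> u es \<and> \<Phi> v es) \<le> (if u = v then p u else 0) + (1 + \<omega>) * (p u * p v)"
      using pair[OF uv] by (auto simp: p_def)
  qed (use N in auto)
  also have "\<dots> = N * (\<mu> + (1 + \<omega>) * (\<mu> * \<mu>))"
  proof -
    have "(\<Sum>u\<in>V. \<Sum>v\<in>V. (if u = v then p u else 0)) = \<mu>" using V by (simp add: \<mu> p_def)
    moreover have "(\<Sum>u\<in>V. \<Sum>v\<in>V. p u * p v) = \<mu> * \<mu>" by (simp add: \<mu> p_def sum_product)
    ultimately show ?thesis by (simp add: sum.distrib flip: sum_distrib_left)
  qed
  finally have sXX: "(\<Sum>es\<in>\<Omega>. X es * X es) \<le> N * (\<mu> + (1 + \<omega>) * (\<mu> * \<mu>))" .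
  have "N * order_prob E (\<lambda>es. \<forall>v\<in>V. \<not> \<Phi> v es) * (\<mu> * \<mu>) = (\<Sum>es\<in>\<Omega>. of_bool (\<forall>v\<in>V. \<not> \<Phi> v es) * (\<mu> * \<mu>))"
    by (simp only: sumP sum_distrib_right[symmetric])
  also have "\<dots> \<le> (\<Sum>es\<in>\<Omega>. (X es - \<mu>) * (X es - \<mu>))"
  proof (rule sum_mono)
    fix es
    have "X es = 0" if "\<forall>v\<in>V. \<not> \<Phi> v es" using that by (simp add: X_def)
    then show "of_bool (\<forall>v\<in>V. \<not> \<Phi> v es) * (\<mu> * \<mu>) \<le> (X es - \<mu>) * (X es - \<mu>)" by auto
  qed
  also have "\<dots> = (\<Sum>es\<in>\<Omega>. X es * X es) - 2 * \<mu> * (\<Sum>es\<in>\<Omega>. X es) + N * (\<mu> * \<mu>)"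
  proof -
    have "(\<Sum>es\<in>\<Omega>. (X es - \<mu>) * (X es - \<mu>)) = (\<Sum>es\<in>\<Omega>. X es * X es - 2 * \<mu> * X es + \<mu> * \<mu>)"
      by (intro sum.cong) (simp_all add: algebra_simps)
    also have "\<dots> = (\<Sum>es\<in>\<Omega>. X es * X es) - (\<Sum>es\<in>\<Omega>. 2 * \<mu> * X es) + card \<Omega> * (\<mu> * \<mu>)"
      by (simp add: sum.distrib sum_subtractf)
    finally show ?thesis by (simp only: cN sum_distrib_left)
  qed
  also have "\<dots> \<le> N * (\<mu> + (1 + \<omega>) * (\<mu> * \<mu>)) - 2 * \<mu> * (N * \<mu>) + N * (\<mu> * \<mu>)" using sXX sX by simp
  also have "\<dots> = N * (\<mu> + \<omega> * (\<mu> * \<mu>))" by (simp add: algebra_simps)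
  finally have "N * (order_prob E (\<lambda>es. \<forall>v\<in>V. \<not> \<Phi> v es) * (\<mu> * \<mu>)) \<le> N * (\<mu> + \<omega> * (\<mu> * \<mu>))" by (simp add: mult.assoc)
  then have "order_prob E (\<lambda>es. \<forall>v\<in>V. \<not> \<Phi> v es) * (\<mu> * \<mu>) \<le> \<mu> + \<omega> * (\<mu> * \<mu>)" using N by simp
  then have "order_prob E (\<lambda>es. \<forall>v\<in>V. \<not> \<Phi> v es) \<le> (\<mu> + \<omega> * (\<mu> * \<mu>)) / (\<mu> * \<mu>)"
    using \<mu>(2) by (simp add: pos_le_divide_eq)
  also have "\<dots> = 1 / \<mu> + \<omega>" using \<mu>(2) by (simp add: add_divide_distrib)
  finally show ?thesis .
qed

text \<open>
  The probability that x given edges are not among the first t of m.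
\<close>

definition avoid_prob :: "nat \<Rightarrow> nat \<Rightarrow> nat \<Rightarrow> real" where
  "avoid_prob m t x = (\<Prod>i<x. (real m - real t - real i) / (real m - real i))"

context
  fixes m t n :: nat
  assumes m: "t + 2 * n < m"
begin

lemma factor_bounds:
  assumes "i < 2 * n"
  shows "0 \<le> (real m - t - i) / (real m - i)" "(real m - t - i) / (real m - i) \<le> 1"
  using assms m by (auto simp: divide_le_eq)

lemma factor_antimono:
  assumes "i \<le> j" "j \<le> 2 * n"
  shows "(real m - t - j) / (real m - j) \<le> (real m - t - i) / (real m - i)"
proof -
  have pos: "0 < real m - j" "0 < real m - i" using assms m by linarith+
  have "real t * i \<le> real t * j" using assms by (intro mult_left_mono) auto
  then have "(real m - t - j) * (real m - i) \<le> (real m - t - i) * (real m - j)"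
    by (simp add: algebra_simps)
  then show ?thesis using pos by (simp add: divide_simps)
qed

lemma avoid_prob_nonneg: "x \<le> 2 * n \<Longrightarrow> 0 \<le> avoid_prob m t x"
  unfolding avoid_prob_def using factor_bounds by (intro prod_nonneg) auto

lemma avoid_prob_antimono:
  assumes "x \<le> y" "y \<le> 2 * n"
  shows "avoid_prob m t y \<le> avoid_prob m t x"
  using assms
proof (induction y rule: dec_induct)
  case (step k)
  have "avoid_prob m t (Suc k) = avoid_prob m t k * ((real m - t - k) / (real m - k))" by (simp add: avoid_prob_def)
  also have "\<dots> \<le> avoid_prob m t k * 1"
    using step factor_bounds(2)[of k] avoid_prob_nonneg[of k] by (intro mult_left_mono) auto
  finally show ?case using step by simp
qed simp

lemma avoid_prob_add: "a + b \<le> 2 * n \<Longrightarrow> avoid_prob m t (a + b) \<le> avoid_prob m t a * avoid_prob m t b"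
proof (induction b)
  case (Suc b)
  have "avoid_prob m t (a + Suc b) = avoid_prob m t (a + b) * ((real m - t - (a + b)) / (real m - (a + b)))"
    by (simp add: avoid_prob_def)
  also have "\<dots> \<le> (avoid_prob m t a * avoid_prob m t b) * ((real m - t - b) / (real m - b))"
    using Suc factor_antimono[of b "a + b"] factor_bounds(1)[of "a + b"] avoid_prob_nonneg
    by (intro mult_mono) auto
  also have "\<dots> = avoid_prob m t a * avoid_prob m t (Suc b)" by (simp add: avoid_prob_def)
  finally show ?case .
qed (simp add: avoid_prob_def)

text \<open>
  The stars of two vertices may share one edge. Up to that edge, avoiding both is negatively correlated; the shared
  edge costs a factor 1 + t / (m - t - n), which is 1 + o(1) in the application.
\<close>

lemma avoid_prob_overlap:
  assumes "1 \<le> b" "a \<le> n" "b \<le> n" "a + b - 1 \<le> c" "c \<le> 2 * n"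
  shows "avoid_prob m t c \<le> (1 + real t / (real m - t - n)) * (avoid_prob m t a * avoid_prob m t b)"
proof -
  let ?f = "(real m - t - n) / (real m - n)"
  have mpos: "0 < real m - t - n" using m by linarith
  have f: "0 < ?f" using mpos by auto
  have "avoid_prob m t b = avoid_prob m t (b - 1) * ((real m - real t - real (b - 1)) / (real m - real (b - 1)))"
    using assms(1) by (cases b) (auto simp: avoid_prob_def)
  moreover have "?f \<le> (real m - t - real (b - 1)) / (real m - real (b - 1))"
    using assms by (intro factor_antimono) auto
  moreover have "0 \<le> avoid_prob m t (b - 1)" using assms by (intro avoid_prob_nonneg) auto
  ultimately have "avoid_prob m t (b - 1) * ?f \<le> avoid_prob m t b" by (metis mult_left_mono)
  then have "avoid_prob m t (b - 1) \<le> avoid_prob m t b / ?f" by (simp only: pos_le_divide_eq[OF f])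
  then have 1: "avoid_prob m t (b - 1) \<le> (1 / ?f) * avoid_prob m t b" by (simp only: times_divide_eq_left mult_1)
  have "avoid_prob m t c \<le> avoid_prob m t (a + (b - 1))" using assms by (intro avoid_prob_antimono) auto
  also have "\<dots> \<le> avoid_prob m t a * avoid_prob m t (b - 1)" using assms by (intro avoid_prob_add) auto
  also have "\<dots> \<le> avoid_prob m t a * ((1 / ?f) * avoid_prob m t b)"
    using 1 avoid_prob_nonneg assms by (intro mult_left_mono) auto
  also have "1 / ?f = 1 + real t / (real m - t - n)" using mpos by (simp add: field_simps)
  finally show ?thesis by (simp add: mult_ac)
qed

lemma avoid_prob_lower:
  assumes "x \<le> n"
  shows "exp (- (real n * (real t / (real m - t - n)))) \<le> avoid_prob m t x"
proof -
  let ?w = "real t / (real m - t - n)"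
  have mpos: "0 < real m - t - n" using m by linarith
  have f: "(real m - t - n) / (real m - n) = 1 / (1 + ?w)" using mpos by (simp add: field_simps)
  have w: "0 \<le> ?w" using mpos by simp
  have "exp (- ?w) \<le> 1 / (1 + ?w)"
    using exp_ge_add_one_self[of ?w] w by (simp add: exp_minus field_simps)
  then have "exp (- ?w) ^ n \<le> (1 / (1 + ?w)) ^ n" by (intro power_mono) auto
  also have "\<dots> = (\<Prod>i<n. (real m - real t - real n) / (real m - real n))" by (simp add: f)
  also have "\<dots> \<le> avoid_prob m t n" unfolding avoid_prob_def
    using factor_antimono factor_bounds(1)[of n] mpos by (intro prod_mono) auto
  also have "\<dots> \<le> avoid_prob m t x" using assms by (intro avoid_prob_antimono) auto
  finally show ?thesis by (simp add: exp_of_nat_mult[symmetric])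
qed

end

context dirac_host
begin

text \<open>
  At density 1 - \<epsilon> a vertex of degree at most n is isolated with probability at least about n to the power \<epsilon> - 1,
  so the expected number of isolated vertices grows like a power of n, and pairs are almost uncorrelated.
\<close>

lemma prob_no_isolated:
  assumes n: "0 < n - ln n - 8" "ln n * (ln n + 4) / (n - ln n - 4) \<le> 1"
  shows "order_prob E (\<lambda>es. \<forall>v\<in>V. deg (snapshot (1 - \<epsilon>) es) v \<noteq> 0)
    \<le> exp (1 - \<epsilon> * ln n) + ln n / (n - ln n - 4)"
proof -
  let ?t = "edge_time (1 - \<epsilon>) n (card E)" and ?m = "card E" and ?L = "ln (real n)"
  define A where "A v = {e \<in> E. v \<in> e}" for v
  have n0: "0 < real n" using large by simp
  have L0: "0 \<le> ?L" using large by simp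
  have tle: "real ?t \<le> (1 - \<epsilon>) * ?L / n * ?m"
    using edge_time_le[of "1 - \<epsilon>" n ?m] eps large by (simp add: mult_ac)
  have m0: "0 < real ?m" using card_E_pos by simp
  have nm: "n \<le> 4 / n * ?m" using card_E_bounds(1) n0 by (simp add: field_simps power2_eq_square)
  have tm: "?t + 2 * n < ?m"
  proof -
    have "(1 - \<epsilon>) * ?L / n * ?m \<le> 1 * ?L / n * ?m" using eps L0 by (intro mult_right_mono divide_right_mono) auto
    moreover have "(?L + 8) / n * ?m = 1 * ?L / n * ?m + 2 * (4 / n * ?m)" by (simp add: add_divide_distrib distrib_right)
    ultimately have "?t + 2 * real n \<le> (?L + 8) / n * ?m" using tle nm by linarith
    also have "\<dots> < 1 * real ?m"
    proof (rule mult_strict_right_mono[OF _ m0])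
      show "(?L + 8) / n < 1" using n(1) n0 by (simp add: divide_less_eq)
    qed
    finally show ?thesis by linarith
  qed
  define \<omega> where "\<omega> = real ?t / (real ?m - ?t - n)"
  have \<omega>: "0 \<le> \<omega>" using tm by (simp add: \<omega>_def)
  have pos: "0 < n - ?L - 4" using n(1) by linarith
  have \<omega>_le: "\<omega> \<le> (1 - \<epsilon>) * ?L / (n - ?L - 4)"
  proof -
    have "(1 - \<epsilon>) * ?L / n * ?m \<le> 1 * ?L / n * ?m" using eps L0 by (intro mult_right_mono divide_right_mono) auto
    then have "?m - ?L / n * ?m - 4 / n * ?m \<le> real ?m - ?t - n" using tle nm unfolding mult_1 by linarith
    moreover have "?m - ?L / n * ?m - 4 / n * ?m = (n - ?L - 4) / n * ?m" using n0 by (simp add: field_simps)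
    ultimately have den: "(n - ?L - 4) / n * ?m \<le> real ?m - ?t - n" by simp
    have "\<omega> \<le> ((1 - \<epsilon>) * ?L / n * ?m) / ((n - ?L - 4) / n * ?m)"
      unfolding \<omega>_def using tle den pos m0 n0 by (intro frac_le) auto
    also have "\<dots> = (1 - \<epsilon>) * ?L / (n - ?L - 4)" using m0 n0 by simp
    finally show ?thesis .
  qed
  have ca: "card (A v) \<le> n" "1 \<le> card (A v)" if "v \<in> V" for v
  proof -
    show "card (A v) \<le> n" using card_star_bounds(2)[OF that] by (simp add: A_def)
    have "0 < (1 / 2 + \<epsilon>) * n" using eps n0 by simp
    then show "1 \<le> card (A v)" using card_star_bounds(1)[OF that] unfolding A_def by linarith
  qed
  have AE: "A v \<subseteq> E" "finite (A v)" for v using finite_E by (auto simp: A_def)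
  define \<Phi> where "\<Phi> v es \<longleftrightarrow> A v \<inter> set (take ?t es) = {}" for v es
  have p: "order_prob E (\<Phi> v) = avoid_prob ?m ?t (card (A v))" if "v \<in> V" for v
    unfolding \<Phi>_def avoid_prob_def using prob_avoid_exact[OF finite_E AE(1), of ?t v] tm ca[OF that] by simp
  define \<mu> where "\<mu> = (\<Sum>v\<in>V. order_prob E (\<Phi> v))"
  have \<mu>_ge: "exp (\<epsilon> * ?L - 1) \<le> \<mu>"
  proof -
    \<comment> \<open>The mean is at least n exp (- n \<omega>), and n \<omega> is (1 - \<epsilon>) ln n up to an additive constant.\<close>
    have "n * \<omega> \<le> (1 - \<epsilon>) * ?L + 1"
    proof -
      have "n * \<omega> \<le> n * ((1 - \<epsilon>) * ?L / (n - ?L - 4))" using \<omega>_le n0 by (intro mult_left_mono) auto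
      also have "\<dots> = (1 - \<epsilon>) * ?L + (1 - \<epsilon>) * (?L * (?L + 4) / (n - ?L - 4))"
        using pos by (simp add: field_simps)
      also have "\<dots> \<le> (1 - \<epsilon>) * ?L + 1 * 1"
        using n(2) eps pos L0 by (intro add_left_mono mult_mono) auto
      finally show ?thesis by simp
    qed
    then have "exp (\<epsilon> * ?L - 1) \<le> exp (?L + - (n * \<omega>))" by (simp add: algebra_simps)
    also have "\<dots> = real n * exp (- (n * \<omega>))" by (simp only: exp_add exp_ln[OF n0])
    also have "\<dots> \<le> (\<Sum>v\<in>V. order_prob E (\<Phi> v))"
    proof -
      have "exp (- (n * \<omega>)) \<le> order_prob E (\<Phi> v)" if "v \<in> V" for v
        unfolding p[OF that] \<omega>_def by (rule avoid_prob_lower[OF tm ca(1)[OF that]])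
      then show ?thesis using sum_bounded_below[of V "exp (- (n * \<omega>))" "\<lambda>v. order_prob E (\<Phi> v)"] by (simp add: card_V)
    qed
    finally show ?thesis by (simp add: \<mu>_def)
  qed
  have \<mu>0: "0 < \<mu>" using \<mu>_ge by (meson exp_gt_zero less_le_trans)
  have pair: "order_prob E (\<lambda>es. \<Phi> u es \<and> \<Phi> v es) \<le> (1 + \<omega>) * (order_prob E (\<Phi> u) * order_prob E (\<Phi> v))"
    if uv: "u \<in> V" "v \<in> V" "u \<noteq> v" for u v
  proof -
    have "A u \<inter> A v \<subseteq> {{u, v}}"
    proof
      fix e assume e: "e \<in> A u \<inter> A v"
      then have "card e = 2" "{u, v} \<subseteq> e" using simple by (auto simp: A_def)
      moreover have "card {u, v} = 2" using uv by simp
      ultimately have "{u, v} = e" by (metis card_subset_eq card.infinite zero_neq_numeral)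
      then show "e \<in> {{u, v}}" by simp
    qed
    then have i: "card (A u \<inter> A v) \<le> 1" using card_mono[of "{{u, v}}" "A u \<inter> A v"] by simp
    have un: "card (A u) + card (A v) = card (A u \<union> A v) + card (A u \<inter> A v)" using AE by (intro card_Un_Int) auto
    have c: "card (A u) + card (A v) - 1 \<le> card (A u \<union> A v)" "card (A u \<union> A v) \<le> 2 * n"
      using i un ca(1)[OF uv(1)] ca(1)[OF uv(2)] by linarith+
    have "order_prob E (\<lambda>es. \<Phi> u es \<and> \<Phi> v es) = order_prob E (\<lambda>es. (A u \<union> A v) \<inter> set (take ?t es) = {})"
      by (rule arg_cong[where f = "order_prob E"]) (auto simp: \<Phi>_def)
    also have "\<dots> = avoid_prob ?m ?t (card (A u \<union> A v))"
      unfolding avoid_prob_def using AE tm c by (intro prob_avoid_exact[OF finite_E]) auto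
    also have "\<dots> \<le> (1 + \<omega>) * (avoid_prob ?m ?t (card (A u)) * avoid_prob ?m ?t (card (A v)))"
      unfolding \<omega>_def by (rule avoid_prob_overlap[OF tm ca(2)[OF uv(2)] ca(1)[OF uv(1)] ca(1)[OF uv(2)] c])
    finally show ?thesis by (simp add: p uv)
  qed
  have "order_prob E (\<lambda>es. \<forall>v\<in>V. deg (set (take ?t es)) v \<noteq> 0) \<le> order_prob E (\<lambda>es. \<forall>v\<in>V. \<not> \<Phi> v es)"
  proof (rule order_prob_mono[OF finite_E])
    fix es assume es: "es \<in> permutations_of_set E" and *: "\<forall>v\<in>V. deg (set (take ?t es)) v \<noteq> 0"
    show "\<forall>v\<in>V. \<not> \<Phi> v es"
    proof
      fix v assume "v \<in> V"
      then have "card {e \<in> set (take ?t es). v \<in> e} \<noteq> 0" using * deg_eq_card_star[OF take_subset[OF es]] by simp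
      then have "{e \<in> set (take ?t es). v \<in> e} \<noteq> {}" by (metis card.empty)
      then show "\<not> \<Phi> v es" using take_subset[OF es] by (auto simp: \<Phi>_def A_def)
    qed
  qed
  also have "\<dots> \<le> 1 / \<mu> + \<omega>" by (rule second_moment[OF finite_E finite_V \<mu>_def \<mu>0 pair \<omega>])
  also have "\<dots> \<le> exp (1 - \<epsilon> * ?L) + ?L / (n - ?L - 4)"
  proof (rule add_mono)
    have "1 / \<mu> \<le> 1 / exp (\<epsilon> * ?L - 1)" using \<mu>_ge by (intro divide_left_mono) (auto intro: mult_pos_pos \<mu>0)
    then show "1 / \<mu> \<le> exp (1 - \<epsilon> * ?L)" by (simp add: exp_diff)
    have "(1 - \<epsilon>) * ?L / (n - ?L - 4) \<le> 1 * ?L / (n - ?L - 4)" using eps L0 pos by (intro divide_right_mono mult_right_mono) auto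
    then show "\<omega> \<le> ?L / (n - ?L - 4)" using \<omega>_le by simp
  qed
  finally show ?thesis .
qed

end

section \<open>The typical edge order\<close>

lemma order_prob_disj: "order_prob E (\<lambda>es. \<Phi> es \<or> \<Psi> es) \<le> order_prob E \<Phi> + order_prob E \<Psi>"
  unfolding order_prob_def Collect_disj_eq by (rule measure_Un_le) auto

lemma order_prob_compl: "finite E \<Longrightarrow> order_prob E (\<lambda>es. \<not> \<Phi> es) = 1 - order_prob E \<Phi>"
  unfolding order_prob_def
  using measure_pmf.prob_compl[of "{es. \<Phi> es}" "pmf_of_set (permutations_of_set E)"]
  by (simp add: Compl_eq[symmetric] Compl_eq_Diff_UNIV Collect_neg_eq)

text \<open>
  With y = \<epsilon> / 256 and \<delta> small in terms of \<epsilon>, summing over J costs only n to the power \<epsilon> / 8. As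
  (1 + 2\<epsilon>)(1 - \<epsilon>) \<ge> 1 + \<epsilon> / 2 for \<epsilon> \<le> 1 / 4, a power of n is gained.
\<close>

lemma close_pair_decay:
  fixes \<epsilon> \<delta> :: real and d n :: nat
  assumes eps: "0 < \<epsilon>" "\<epsilon> \<le> 1 / 4" and \<delta>: "0 < \<delta>" "\<delta> \<le> 1" "2 * \<delta> * ln (256 / \<epsilon>) \<le> \<epsilon> / 16"
    and d: "real d \<le> \<delta> * ln n + 1" and n: "1 \<le> n" "(7 + 2 * ln n) * (8 + ln n) \<le> n"
  shows "4 * real n * (8 * ln n) ^ 4 * ((1 / (\<epsilon> / 256)) ^ (2 * d) * exp (16 * (\<epsilon> / 256) * ln n) *
      exp (- (((1 + 2 * \<epsilon>) * n - (5 + 2 * real d)) * ((1 - \<epsilon>) * ln n / n - 4 * (5 + 2 * real d) / real n ^ 2))))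
    \<le> 4 * exp (1 + 2 * ln (256 / \<epsilon>)) * (8 * ln n) ^ 4 * exp (- (3 * \<epsilon> / 8) * ln n)"
proof -
  let ?L = "ln (real n)" and ?s = "5 + 2 * real d" and ?c = "ln (256 / \<epsilon>)"
  have n0: "0 < real n" and L0: "0 \<le> ?L" using n by auto
  have c0: "0 \<le> ?c" using eps by (intro ln_ge_zero) simp
  have "(1 / (\<epsilon> / 256)) ^ (2 * d) = exp (real (2 * d) * ?c)"
    using eps by (subst exp_of_nat_mult) simp
  moreover have "real (2 * d) * ?c \<le> \<epsilon> / 16 * ?L + 2 * ?c"
  proof -
    have "real (2 * d) * ?c \<le> (2 * (\<delta> * ?L + 1)) * ?c" using d c0 by (intro mult_right_mono) auto
    also have "\<dots> = (2 * \<delta> * ?c) * ?L + 2 * ?c" by (simp add: algebra_simps)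
    also have "\<dots> \<le> \<epsilon> / 16 * ?L + 2 * ?c" using \<delta>(3) L0 by (intro add_right_mono mult_right_mono) auto
    finally show ?thesis .
  qed
  moreover have "(1 + \<epsilon> / 2) * ?L - 1 \<le> ((1 + 2 * \<epsilon>) * n - ?s) * ((1 - \<epsilon>) * ?L / n - 4 * ?s / real n ^ 2)"
  proof -
    have "\<delta> * ?L \<le> 1 * ?L" using \<delta> L0 by (intro mult_right_mono) auto
    then have s: "?s \<le> 7 + 2 * ?L" using d by simp
    have "?s * (8 + ?L) \<le> (7 + 2 * ?L) * (8 + ?L)" using s L0 by (intro mult_right_mono) auto
    then have small: "?s * (8 + ?L) / n \<le> 1" using n(2) n0 by simp
    have "\<epsilon> * (1 / 4) \<ge> \<epsilon> * \<epsilon>" using eps by (intro mult_left_mono) auto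
    then have "1 + \<epsilon> / 2 \<le> (1 + 2 * \<epsilon>) * (1 - \<epsilon>)" by (simp add: algebra_simps)
    then have 1: "(1 + \<epsilon> / 2) * ?L \<le> (1 + 2 * \<epsilon>) * (1 - \<epsilon>) * ?L" using L0 by (rule mult_right_mono)
    have eq: "((1 + 2 * \<epsilon>) * n - ?s) * ((1 - \<epsilon>) * ?L / n - 4 * ?s / real n ^ 2)
      = (1 + 2 * \<epsilon>) * (1 - \<epsilon>) * ?L - (1 + 2 * \<epsilon>) * 4 * (?s / n) - (1 - \<epsilon>) * (?s * ?L / n) + 4 * (?s / n) ^ 2"
      using n0 by (simp add: field_simps power2_eq_square)
    have 2: "(1 + 2 * \<epsilon>) * 4 * (?s / n) \<le> 8 * (?s / n)" using eps n0 by (intro mult_right_mono) auto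
    have 3: "(1 - \<epsilon>) * (?s * ?L / n) \<le> 1 * (?s * ?L / n)" using eps n0 L0 by (intro mult_right_mono) auto
    have 4: "0 \<le> 4 * (?s / n) ^ 2" by simp
    have "8 * (?s / n) + 1 * (?s * ?L / n) = ?s * (8 + ?L) / n" using n0 by (simp add: field_simps)
    then have 5: "8 * (?s / n) + 1 * (?s * ?L / n) \<le> 1" using small by simp
    have "x - 1 \<le> p - q - r + u" if "x \<le> p" "q \<le> y" "r \<le> w" "0 \<le> u" "y + w \<le> 1" for p q r u x y w :: real
      using that by linarith
    from this[OF 1 2 3 4 5] show ?thesis unfolding eq .
  qed
  ultimately have "(1 / (\<epsilon> / 256)) ^ (2 * d) * exp (16 * (\<epsilon> / 256) * ?L) *
      exp (- (((1 + 2 * \<epsilon>) * n - ?s) * ((1 - \<epsilon>) * ?L / n - 4 * ?s / real n ^ 2)))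
    \<le> exp (\<epsilon> / 16 * ?L + 2 * ?c) * exp (\<epsilon> / 16 * ?L) * exp (- ((1 + \<epsilon> / 2) * ?L - 1))"
    by (intro mult_mono) auto
  also have "\<dots> = exp (1 + 2 * ?c) * exp (- (3 * \<epsilon> / 8) * ?L) * exp (- ?L)"
    unfolding exp_add[symmetric] by (rule arg_cong[where f = exp]) (simp add: algebra_simps)
  also have "exp (- ?L) = 1 / n" using n0 by (simp add: exp_minus inverse_eq_divide)
  finally have main: "(1 / (\<epsilon> / 256)) ^ (2 * d) * exp (16 * (\<epsilon> / 256) * ?L) *
      exp (- (((1 + 2 * \<epsilon>) * n - ?s) * ((1 - \<epsilon>) * ?L / n - 4 * ?s / real n ^ 2)))
    \<le> exp (1 + 2 * ?c) * exp (- (3 * \<epsilon> / 8) * ?L) * (1 / n)" .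
  have "4 * real n * (8 * ?L) ^ 4 * ((1 / (\<epsilon> / 256)) ^ (2 * d) * exp (16 * (\<epsilon> / 256) * ?L) *
      exp (- (((1 + 2 * \<epsilon>) * n - ?s) * ((1 - \<epsilon>) * ?L / n - 4 * ?s / real n ^ 2))))
    \<le> 4 * real n * (8 * ?L) ^ 4 * (exp (1 + 2 * ?c) * exp (- (3 * \<epsilon> / 8) * ?L) * (1 / n))"
    by (rule mult_left_mono[OF main]) (use L0 in simp)
  also have "\<dots> = 4 * exp (1 + 2 * ?c) * (8 * ?L) ^ 4 * exp (- (3 * \<epsilon> / 8) * ?L)" using n0 by simp
  finally show ?thesis .
qed

text \<open>
  The first two conditions place \<tau>_2 between the two snapshots, and the last applies to the graph at time \<tau>_2.
\<close>

definition hamiltonian_when_min_degree_2 :: "'a set \<Rightarrow> 'a set set \<Rightarrow> real \<Rightarrow> nat \<Rightarrow> 'a set list \<Rightarrow> bool" where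
  "hamiltonian_when_min_degree_2 V E \<epsilon> n es \<longleftrightarrow>
     (\<exists>v\<in>V. deg (set (take (edge_time (1 - \<epsilon>) n (card E)) es)) v < 2) \<and>
     (\<forall>v\<in>V. 2 \<le> deg (set (take (edge_time 8 n (card E)) es)) v) \<and>
     (\<forall>t. edge_time (1 - \<epsilon>) n (card E) \<le> t \<longrightarrow> t \<le> edge_time 8 n (card E) \<longrightarrow>
        (\<forall>v\<in>V. 2 \<le> deg (set (take t es)) v) \<longrightarrow> hamiltonian (V, set (take t es)))"

context dirac_host
begin

definition cut_family :: "'a set set set" where
  "cut_family = (\<lambda>(S, Y). cut_edges E S Y) ` (Pow V \<times> Pow V)"

lemma card_cut_family: "finite cut_family" "card cut_family \<le> 4 ^ n"
proof -
  have "card (Pow V \<times> Pow V) = 2 ^ n * 2 ^ n" using finite_V by (simp add: card_cartesian_product card_Pow card_V)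
  also have "\<dots> = 4 ^ n" by (simp flip: power_mult_distrib)
  finally show "finite cut_family" "card cut_family \<le> 4 ^ n"
    unfolding cut_family_def using finite_V card_image_le[of "Pow V \<times> Pow V" "\<lambda>(S, Y). cut_edges E S Y"] by auto
qed

text \<open>
  None of the seven bad events occurs: no isolated vertex early, low degree late, low degree vertices close together, a dense
  spot, or a failure of one of the three searches (for cut edges, rotation edges and boosters).
\<close>

lemma hamiltonian_when_min_degree_2_if_typical:
  fixes \<kappa> \<theta>s \<theta>2 :: real and d h :: nat
  assumes es: "es \<in> permutations_of_set E" and d: "2 \<le> d" and k: "0 < \<kappa>" "\<kappa> \<le> 1 / 2"
    and \<theta>: "\<theta>s \<le> 1 - \<epsilon>" "\<theta>2 \<le> 1 - \<epsilon>"
    and h: "h = edge_time \<theta>s n (card E) + n * d + 2 * n"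
    and B1: "\<not> (\<forall>v\<in>V. deg (snapshot (1 - \<epsilon>) es) v \<noteq> 0)"
    and B2: "\<not> (\<exists>v\<in>V. deg (snapshot 8 es) v < 2)"
    and B3: "\<not> (\<exists>vs. gpath (snapshot 8 es) vs \<and> 2 \<le> length vs \<and> length vs \<le> 5 \<and>
      deg (snapshot (1 - \<epsilon>) es) (hd vs) < d \<and> deg (snapshot (1 - \<epsilon>) es) (last vs) < d)"
    and B4: "\<not> (\<exists>U\<subseteq>V. U \<noteq> {} \<and> real (card U) \<le> \<kappa> * n \<and>
      d * card U \<le> 12 * card {e \<in> snapshot 8 es. e \<subseteq> U})"
    and B5: "\<not> avoids (\<lambda>F. cut_family) 0 (\<kappa> * \<epsilon> / 48) \<theta>s es"
    and B6: "\<not> avoids rotation_family h (\<epsilon>\<^sup>2 / 32) \<theta>2 es"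
    and B7: "\<not> avoids booster_family (h + edge_time \<theta>2 n (card E)) (\<epsilon> / 32) (1 - \<epsilon>) es"
  shows "hamiltonian_when_min_degree_2 V E \<epsilon> n es"
  unfolding hamiltonian_when_min_degree_2_def
proof (intro conjI allI impI)
  let ?G = "\<lambda>\<theta>. snapshot \<theta> es"
  show "\<exists>v\<in>V. deg (?G (1 - \<epsilon>)) v < 2"
  proof -
    obtain v where "v \<in> V" "deg (?G (1 - \<epsilon>)) v = 0" using B1 by blast
    then show ?thesis by (intro bexI[of _ v]) auto
  qed
  show "\<forall>v\<in>V. 2 \<le> deg (?G 8) v" using B2 by (auto simp: not_less)
  fix t assume t: "edge_time (1 - \<epsilon>) n (card E) \<le> t" "t \<le> edge_time 8 n (card E)"
    and deg2: "\<forall>v\<in>V. 2 \<le> deg (set (take t es)) v"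
  have n1: "1 \<le> n" using large by simp
  have c: "card (?G \<theta>) \<le> edge_time \<theta> n (card E)" for \<theta>
    using card_length[of "take (edge_time \<theta> n (card E)) es"] by simp
  show "hamiltonian (V, set (take t es))"
  proof (rule hamiltonian_of_typical[where \<kappa> = \<kappa> and d = d])
    show "?G (1 - \<epsilon>) \<subseteq> set (take t es)" "set (take t es) \<subseteq> ?G 8"
      using t by (auto intro!: set_take_subset_set_take)
    show "?G \<theta>s \<subseteq> ?G (1 - \<epsilon>)" "?G \<theta>2 \<subseteq> ?G (1 - \<epsilon>)"
      using \<theta> n1 by (auto intro!: set_take_subset_set_take edge_time_mono)
    show "?G 8 \<subseteq> E" by (rule take_subset[OF es])
    show "2 \<le> deg (set (take t es)) v" if "v \<in> V" for v using deg2 that by blast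
    show "\<not> (deg (?G (1 - \<epsilon>)) (hd vs) < d \<and> deg (?G (1 - \<epsilon>)) (last vs) < d)"
      if "gpath (?G 8) vs" "2 \<le> length vs" "length vs \<le> 5" for vs using B3 that by blast
    show "12 * card {e \<in> ?G 8. e \<subseteq> U} < d * card U" if "U \<subseteq> V" "U \<noteq> {}" "real (card U) \<le> \<kappa> * n" for U
      using B4 that by (meson not_less)
    show "cut_edges E S Y \<inter> ?G \<theta>s \<noteq> {}"
      if "S \<subseteq> V" "Y \<subseteq> V" "S \<inter> Y = {}" "\<kappa> * \<epsilon> / 48 * real n ^ 2 \<le> card (cut_edges E S Y)" for S Y
    proof
      assume *: "cut_edges E S Y \<inter> ?G \<theta>s = {}"
      have "cut_edges E S Y \<in> cut_family" unfolding cut_family_def using that by (intro image_eqI[of _ _ "(S, Y)"]) auto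
      moreover have "cut_edges E S Y \<subseteq> E - {}" by (auto simp: cut_edges_def)
      ultimately show False using B5 * that(4) unfolding avoids_def by (metis card.empty empty_subsetI le_refl)
    qed
    show "X \<inter> ?G \<theta>2 \<noteq> {}" if "H \<subseteq> ?G 8" "card H \<le> card (?G \<theta>s) + n * d + 2 * n" "X \<in> rotation_family H" "X \<subseteq> E - H"
      "\<epsilon>\<^sup>2 / 32 * real n ^ 2 \<le> card X" for H X
    proof -
      have "card H \<le> h" using that(2) c[of \<theta>s] h by linarith
      then show ?thesis using B6 that unfolding avoids_def by blast
    qed
    show "X \<inter> ?G (1 - \<epsilon>) \<noteq> {}" if "F \<subseteq> ?G 8" "card F \<le> card (?G \<theta>s) + n * d + 2 * n + card (?G \<theta>2)" "X \<in> booster_family F" "X \<subseteq> E - F"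
      "\<epsilon> / 32 * real n ^ 2 \<le> card X" for F X
    proof -
      have "card F \<le> h + edge_time \<theta>2 n (card E)" using that(2) c[of \<theta>s] c[of \<theta>2] h by linarith
      then show ?thesis using B7 that unfolding avoids_def by blast
    qed
  qed (use d k in auto)
qed

end

text \<open>
  Uniform in the host, so that for a sequence of hosts the constants \<alpha> and b depend on \<eta> and \<theta> only.
\<close>

definition sprinkled :: "real \<Rightarrow> real \<Rightarrow> real \<Rightarrow> (nat \<Rightarrow> real) \<Rightarrow> nat \<Rightarrow> 'a set \<Rightarrow> 'a set set \<Rightarrow> real \<Rightarrow> bool" where
  "sprinkled \<eta> \<theta> \<alpha> b n V E \<epsilon> \<longleftrightarrow> (\<forall>XX h. dirac_host V E \<epsilon> n \<longrightarrow>
       (\<forall>F\<subseteq>E. finite (XX F) \<and> real (card (XX F)) \<le> real n * 4 ^ n * 4 ^ card F) \<longrightarrow>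
       real h \<le> \<alpha> * (n * ln n) \<longrightarrow> order_prob E (dirac_host.avoids E n XX h \<eta> \<theta>) \<le> b n)"

lemma sprinkledD:
  assumes "sprinkled \<eta> \<theta> \<alpha> b n V E \<epsilon>" "dirac_host V E \<epsilon> n"
    and "\<And>F. F \<subseteq> E \<Longrightarrow> finite (XX F) \<and> real (card (XX F)) \<le> real n * 4 ^ n * 4 ^ card F"
    and "real h \<le> \<alpha> * (n * ln n)"
  shows "order_prob E (dirac_host.avoids E n XX h \<eta> \<theta>) \<le> b n"
  using assms unfolding sprinkled_def by blast

lemma sprinkled_whp:
  fixes \<eta> \<theta> :: real
  assumes "0 < \<eta>" "0 < \<theta>"
  obtains \<alpha> b where "0 < \<alpha>" "b \<longlonglongrightarrow> 0" "\<forall>\<^sub>F n in sequentially. \<forall>(V :: 'a set) E \<epsilon>. sprinkled \<eta> \<theta> \<alpha> b n V E \<epsilon>"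
proof -
  obtain x \<alpha> where x: "0 < x" "x \<le> 1" and \<alpha>: "0 < \<alpha>" "8 * \<alpha> \<le> \<theta>"
    and c: "\<alpha> * ln (1 / x) + 16 * x + 4 * \<eta> * \<alpha> \<le> \<eta> * \<theta> / 2"
    using sprinkling_constants[OF assms] by blast
  define b where "b n = real n * 4 ^ n * exp (- (\<eta> * \<theta> / 2) * (n * ln n) + 4 * \<eta>)" for n :: nat
  have "0 < \<eta> * \<theta> / 2" using assms by simp
  from superexponential_tendsto_0[OF this] have b: "b \<longlonglongrightarrow> 0" unfolding b_def .
  have "\<forall>\<^sub>F n in sequentially. 8 * ln (real n) \<le> real n" by real_asymp
  moreover have "\<forall>\<^sub>F n in sequentially. \<theta> * ln (real n) \<le> real n" by real_asymp
  moreover have "\<forall>\<^sub>F n in sequentially. 1 \<le> \<theta> / 8 * (real n * ln (real n))" using assms by real_asymp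
  ultimately have "\<forall>\<^sub>F n in sequentially. \<forall>(V :: 'a set) E \<epsilon>. sprinkled \<eta> \<theta> \<alpha> b n V E \<epsilon>"
  proof eventually_elim
    case (elim n)
    show ?case unfolding sprinkled_def
    proof (intro allI impI)
      fix V :: "'a set" and E \<epsilon> and XX :: "'a set set \<Rightarrow> 'a set set set" and h
      assume *: "dirac_host V E \<epsilon> n" "\<forall>F\<subseteq>E. finite (XX F) \<and> real (card (XX F)) \<le> real n * 4 ^ n * 4 ^ card F"
        "real h \<le> \<alpha> * (n * ln n)"
      interpret dirac_host V E \<epsilon> n by (rule *(1))
      show "order_prob E (avoids XX h \<eta> \<theta>) \<le> b n"
        unfolding b_def by (rule sprinkling_explicit[OF assms x \<alpha> c elim _ *(3)]) (use * in blast)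
    qed
  qed
  then show ?thesis using that \<alpha>(1) b by blast
qed

text \<open>
  The constants are chosen backwards. The final search for boosters bounds the density \<theta>2 of the snapshot that supplies
  rotation edges; the search for these bounds the size \<alpha> of the sparse graphs H; this bounds \<theta>s and \<delta>, and
  \<delta> determines \<kappa>, the relative size up to which sets expand by \<open>prob_dense_spot\<close>. The search for cut edges has to
  succeed for empty F only and imposes no further condition.
\<close>

lemma hamiltonian_when_min_degree_2_whp:
  fixes \<epsilon> :: real
  assumes eps: "0 < \<epsilon>" "\<epsilon> \<le> 1 / 4"
  obtains b where "b \<longlonglongrightarrow> 0"
    "\<forall>\<^sub>F n in sequentially. \<forall>(V :: 'a set) E. dirac_host V E \<epsilon> n \<longrightarrow>
       order_prob E (\<lambda>es. \<not> hamiltonian_when_min_degree_2 V E \<epsilon> n es) \<le> b n"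
proof -
  have e: "0 < \<epsilon> / 32" "0 < 1 - \<epsilon>" "0 < \<epsilon>\<^sup>2 / 32" using eps by auto
  \<comment> \<open>Boosters, found in the snapshot of density 1 - \<epsilon>.\<close>
  obtain \<alpha>3 b7 where \<alpha>3: "0 < \<alpha>3" and b7: "b7 \<longlonglongrightarrow> 0"
    and ev7: "\<forall>\<^sub>F n in sequentially. \<forall>(V :: 'a set) E \<epsilon>'. sprinkled (\<epsilon> / 32) (1 - \<epsilon>) \<alpha>3 b7 n V E \<epsilon>'"
    using sprinkled_whp[OF e(1,2), where 'a = 'a] by blast
  define \<theta>2 where "\<theta>2 = min \<alpha>3 (1 - \<epsilon>)"
  have \<theta>2: "0 < \<theta>2" "\<theta>2 \<le> \<alpha>3" "\<theta>2 \<le> 1 - \<epsilon>" using \<alpha>3 e by (auto simp: \<theta>2_def)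
  \<comment> \<open>Rotation edges, found in the snapshot of density \<theta>2.\<close>
  obtain \<alpha>2 b6 where \<alpha>2: "0 < \<alpha>2" and b6: "b6 \<longlonglongrightarrow> 0"
    and ev6: "\<forall>\<^sub>F n in sequentially. \<forall>(V :: 'a set) E \<epsilon>'. sprinkled (\<epsilon>\<^sup>2 / 32) \<theta>2 \<alpha>2 b6 n V E \<epsilon>'"
    using sprinkled_whp[OF e(3) \<theta>2(1), where 'a = 'a] by blast
  define \<alpha> where "\<alpha> = min \<alpha>2 (\<alpha>3 / 2)"
  have \<alpha>: "0 < \<alpha>" "\<alpha> \<le> \<alpha>2" "\<alpha> \<le> \<alpha>3 / 2" using \<alpha>2 \<alpha>3 by (auto simp: \<alpha>_def)
  define \<theta>s where "\<theta>s = min (\<alpha> / 2) (1 - \<epsilon>)"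
  have \<theta>s: "0 < \<theta>s" "\<theta>s \<le> \<alpha> / 2" "\<theta>s \<le> 1 - \<epsilon>"
    unfolding \<theta>s_def by (use \<alpha>(1) e(2) in simp, rule min.cobounded1, rule min.cobounded2)
  define lc where "lc = ln (256 / \<epsilon>)"
  have lc: "0 < lc" unfolding lc_def using eps by (intro ln_gt_zero) simp
  define \<delta> where "\<delta> = min (min 1 (\<alpha> / 4)) (\<epsilon> / 32 / lc)"
  have \<delta>: "0 < \<delta>" "\<delta> \<le> 1" "\<delta> \<le> \<alpha> / 4" using \<alpha> lc eps by (auto simp: \<delta>_def)
  have "\<delta> \<le> \<epsilon> / 32 / lc" by (simp add: \<delta>_def)
  then have "\<delta> * lc \<le> \<epsilon> / 32" using lc by (simp add: pos_le_divide_eq)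
  then have \<delta>lc: "2 * \<delta> * ln (256 / \<epsilon>) \<le> \<epsilon> / 16" by (simp add: lc_def)
  define \<kappa> where "\<kappa> = \<delta> / (48 * exp 2)"
  have \<kappa>: "0 < \<kappa>" "\<kappa> \<le> 1 / 2"
  proof -
    show "0 < \<kappa>" using \<delta> by (simp add: \<kappa>_def)
    have "\<kappa> \<le> \<delta> / 48" unfolding \<kappa>_def using \<delta> by (intro divide_left_mono) auto
    then show "\<kappa> \<le> 1 / 2" using \<delta> by linarith
  qed
  have e5: "0 < \<kappa> * \<epsilon> / 48" using \<kappa> eps by simp
  \<comment> \<open>Edges across large cuts, found in the snapshot of density \<theta>s.\<close>
  obtain \<alpha>5 b5 where \<alpha>5: "0 < \<alpha>5" and b5: "b5 \<longlonglongrightarrow> 0"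
    and ev5: "\<forall>\<^sub>F n in sequentially. \<forall>(V :: 'a set) E \<epsilon>'. sprinkled (\<kappa> * \<epsilon> / 48) \<theta>s \<alpha>5 b5 n V E \<epsilon>'"
    using sprinkled_whp[OF e5 \<theta>s(1), where 'a = 'a] by blast
  define b1 where "b1 n = exp (1 - \<epsilon> * ln n) + ln n / (n - ln n - 4)" for n :: nat
  define b2 where "b2 n = real n * (real n * exp 1) * exp (- ((real n / 2 - 1) * (8 * ln n / n - 8 / real n ^ 2)))" for n :: nat
  define b3 where "b3 n = 4 * exp (1 + 2 * ln (256 / \<epsilon>)) * (8 * ln n) ^ 4 * exp (- (3 * \<epsilon> / 8) * ln n)" for n :: nat
  define b4 where "b4 n = 2 * (exp 3 * (48 / \<delta>) * exp (- (\<delta> / 12 * ln n)))" for n :: nat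
  define b where "b n = b1 n + (b2 n + (b3 n + (b4 n + (b5 n + (b6 n + b7 n)))))" for n
  have l1: "b1 \<longlonglongrightarrow> 0" unfolding b1_def using eps by real_asymp
  have l2: "b2 \<longlonglongrightarrow> 0" unfolding b2_def by real_asymp
  have l3: "b3 \<longlonglongrightarrow> 0" unfolding b3_def using eps by real_asymp
  have l4: "b4 \<longlonglongrightarrow> 0" unfolding b4_def using \<delta> by real_asymp
  have "b \<longlonglongrightarrow> 0 + (0 + (0 + (0 + (0 + (0 + 0)))))"
    unfolding b_def by (intro tendsto_add l1 l2 l3 l4 b5 b6 b7)
  then have b: "b \<longlonglongrightarrow> 0" by simp
  have "\<forall>\<^sub>F n in sequentially. 8 * ln (real n) \<le> real n" by real_asymp
  moreover have "\<forall>\<^sub>F n in sequentially. (2::real) \<le> real n * ln (real n)" by real_asymp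
  moreover have "\<forall>\<^sub>F n in sequentially. 7 + 2 * ln (real n) \<le> 3 / 16 * (real n * ln (real n))" by real_asymp
  moreover have "\<forall>\<^sub>F n in sequentially. 7 + 2 * ln (real n) \<le> real n" by real_asymp
  moreover have "\<forall>\<^sub>F n in sequentially. (1::real) \<le> 8 * ln (real n)" by real_asymp
  moreover have "\<forall>\<^sub>F n in sequentially. (7 + 2 * ln (real n)) * (8 + ln (real n)) \<le> real n" by real_asymp
  moreover have "\<forall>\<^sub>F n in sequentially. 12 \<le> \<delta> * ln (real n)" using \<delta> by real_asymp
  moreover have "\<forall>\<^sub>F n in sequentially. b4 n < 1"
    using l4 by (rule order_tendstoD(2)) simp
  moreover have "\<forall>\<^sub>F n in sequentially. 0 < real n - ln (real n) - 8" by real_asymp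
  moreover have "\<forall>\<^sub>F n in sequentially. ln (real n) * (ln (real n) + 4) / (real n - ln (real n) - 4) \<le> 1" by real_asymp
  moreover have "\<forall>\<^sub>F n in sequentially. 3 * real n \<le> \<alpha> / 2 * (real n * ln (real n))" using \<alpha> by real_asymp
  ultimately have "\<forall>\<^sub>F n in sequentially. \<forall>(V :: 'a set) E. dirac_host V E \<epsilon> n \<longrightarrow>
       order_prob E (\<lambda>es. \<not> hamiltonian_when_min_degree_2 V E \<epsilon> n es) \<le> b n"
    using ev5 ev6 ev7
  proof eventually_elim
    case (elim n)
    show ?case
    proof (intro allI impI)
      fix V :: "'a set" and E assume host: "dirac_host V E \<epsilon> n"
      interpret dirac_host V E \<epsilon> n by (rule host)
      let ?L = "ln (real n)"
      define d where "d = nat \<lceil>\<delta> * ?L\<rceil>"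
      have d: "\<delta> * ?L \<le> real d" "real d \<le> \<delta> * ?L + 1" using elim(7) unfolding d_def by linarith+
      have L0: "0 \<le> ?L" using large by simp
      have nL0: "0 \<le> real n * ?L" using L0 by simp
      have "\<delta> * ?L \<le> 1 * ?L" using \<delta> L0 by (intro mult_right_mono) auto
      then have dL: "real d \<le> ?L + 1" using d by linarith
      have d2: "2 \<le> d" using d(1) elim(7) by linarith
      define h where "h = edge_time \<theta>s n (card E) + n * d + 2 * n"
      have hle: "real h \<le> \<alpha> * (n * ?L)"
      proof -
        have "real (edge_time \<theta>s n (card E)) \<le> \<theta>s / 2 * (n * ?L)" using \<theta>s by (intro edge_time_upper) auto
        also have "\<dots> \<le> \<alpha> / 4 * (n * ?L)" using \<theta>s nL0 by (intro mult_right_mono) auto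
        finally have 1: "real (edge_time \<theta>s n (card E)) \<le> \<alpha> / 4 * (n * ?L)" .
        have "real n * d \<le> real n * (\<delta> * ?L + 1)" using d by (intro mult_left_mono) auto
        also have "\<dots> = \<delta> * (n * ?L) + n" by (simp add: algebra_simps)
        also have "\<dots> \<le> \<alpha> / 4 * (n * ?L) + n" using \<delta> nL0 by (intro add_right_mono mult_right_mono) auto
        finally have 2: "real n * d \<le> \<alpha> / 4 * (n * ?L) + n" .
        have "real h = real (edge_time \<theta>s n (card E)) + real n * d + 2 * n" by (simp add: h_def)
        then show ?thesis using 1 2 elim(11) by linarith
      qed
      define B1 where "B1 es \<longleftrightarrow> (\<forall>v\<in>V. deg (snapshot (1 - \<epsilon>) es) v \<noteq> 0)" for es :: "'a set list"
      define B2 where "B2 es \<longleftrightarrow> (\<exists>v\<in>V. deg (snapshot 8 es) v < 2)" for es :: "'a set list"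
      define B3 where "B3 es \<longleftrightarrow> (\<exists>vs. gpath (snapshot 8 es) vs \<and> 2 \<le> length vs \<and> length vs \<le> 5 \<and>
        deg (snapshot (1 - \<epsilon>) es) (hd vs) < d \<and> deg (snapshot (1 - \<epsilon>) es) (last vs) < d)" for es :: "'a set list"
      define B4 where "B4 es \<longleftrightarrow> (\<exists>U\<subseteq>V. U \<noteq> {} \<and> real (card U) \<le> \<kappa> * n \<and> d * card U \<le> 12 * card {e \<in> snapshot 8 es. e \<subseteq> U})" for es :: "'a set list"
      define B5 where "B5 = avoids (\<lambda>F. cut_family) 0 (\<kappa> * \<epsilon> / 48) \<theta>s"
      define B6 where "B6 = avoids rotation_family h (\<epsilon>\<^sup>2 / 32) \<theta>2"
      define B7 where "B7 = avoids booster_family (h + edge_time \<theta>2 n (card E)) (\<epsilon> / 32) (1 - \<epsilon>)"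
      have p1: "order_prob E B1 \<le> b1 n"
        unfolding B1_def b1_def by (rule prob_no_isolated[OF elim(9,10)])
      have p2: "order_prob E B2 \<le> b2 n"
        unfolding B2_def b2_def
      proof (rule prob_small_degree[OF elim(1)])
        show "1 \<le> edge_time 8 n (card E)" using edge_time_lower[of 8] elim(2) by simp
      qed
      have p3: "order_prob E B3 \<le> b3 n"
      proof -
        have "order_prob E B3 \<le> 4 * real n * (8 * ln n) ^ 4 * ((1 / (\<epsilon> / 256)) ^ (2 * d) * exp (16 * (\<epsilon> / 256) * ln n) *
          exp (- (((1 + 2 * \<epsilon>) * n - (5 + 2 * real d)) * ((1 - \<epsilon>) * ln n / n - 4 * (5 + 2 * real d) / real n ^ 2))))"
          unfolding B3_def
        proof (rule prob_close_pair)
          have "3 / 16 * (n * ?L) \<le> (1 - \<epsilon>) / 4 * (n * ?L)" using eps nL0 by (intro mult_right_mono) auto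
          then have "7 + 2 * ?L - 1 \<le> real (edge_time (1 - \<epsilon>) n (card E))"
            using edge_time_lower[of "1 - \<epsilon>"] e elim(3) by linarith
          then have "real (4 + 2 * d) \<le> real (edge_time (1 - \<epsilon>) n (card E))" using dL by simp
          then show "4 + 2 * d \<le> edge_time (1 - \<epsilon>) n (card E)" by linarith
          show "real (5 + 2 * d) \<le> n" using dL elim(4) by simp
        qed (use eps elim in auto)
        also have "\<dots> \<le> b3 n" unfolding b3_def
          by (rule close_pair_decay[OF eps \<delta>(1,2) \<delta>lc d(2) _ elim(6)]) (use large in simp)
        finally show ?thesis .
      qed
      have p4: "order_prob E B4 \<le> b4 n"
        unfolding B4_def b4_def \<kappa>_def
        by (rule prob_dense_spot[OF \<delta>(1) d(1) elim(7) elim(1)]) (use elim(8) in \<open>simp add: b4_def\<close>)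
      have n4: "real (2 ^ n) \<le> 4 ^ n" by (simp add: power_mono)
      have ge1: "1 \<le> real n" "(1::real) \<le> 4 ^ k" for k using large by auto
      have p5: "order_prob E B5 \<le> b5 n"
      proof -
        have "real (card cut_family) \<le> real n * 4 ^ n * 4 ^ card F" for F :: "'a set set"
        proof -
          have "real (card cut_family) \<le> 4 ^ n" using card_cut_family(2) by (metis of_nat_le_iff of_nat_numeral of_nat_power)
          also have "\<dots> \<le> real n * 4 ^ n" using ge1 by simp
          also have "\<dots> \<le> real n * 4 ^ n * 4 ^ card F" using mult_left_mono[OF ge1(2)[of "card F"], of "real n * 4 ^ n"] by simp
          finally show ?thesis .
        qed
        then show ?thesis unfolding B5_def using card_cut_family(1) \<alpha>5 nL0
          by (intro sprinkledD[OF elim(12)[rule_format] host]) auto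
      qed
      have p6: "order_prob E B6 \<le> b6 n"
      proof -
        have "real (card (rotation_family F)) \<le> real n * 4 ^ n * 4 ^ card F" for F
        proof -
          have "real (card (rotation_family F)) \<le> real n * real (2 ^ n)" using card_rotation_family(2)[of F] by (metis of_nat_le_iff of_nat_mult)
          also have "\<dots> \<le> real n * 4 ^ n" using n4 by (intro mult_left_mono) auto
          also have "\<dots> \<le> real n * 4 ^ n * 4 ^ card F" using mult_left_mono[OF ge1(2)[of "card F"], of "real n * 4 ^ n"] by simp
          finally show ?thesis .
        qed
        moreover have "real h \<le> \<alpha>2 * (n * ?L)" using hle mult_right_mono[OF \<alpha>(2) nL0] by linarith
        ultimately show ?thesis unfolding B6_def using card_rotation_family(1)
          by (intro sprinkledD[OF elim(13)[rule_format] host]) auto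
      qed
      have p7: "order_prob E B7 \<le> b7 n"
      proof -
        have "finite (booster_family F) \<and> real (card (booster_family F)) \<le> real n * 4 ^ n * 4 ^ card F" if "F \<subseteq> E" for F
        proof -
          have f: "finite (booster_family F)" "card (booster_family F) \<le> 4 ^ card F"
            using card_booster_family[OF finite_subset[OF that finite_E]] by auto
          have "real (card (booster_family F)) \<le> 1 * 4 ^ card F" using f(2) by (metis mult_1 of_nat_le_iff of_nat_numeral of_nat_power)
          also have "\<dots> \<le> (real n * 4 ^ n) * 4 ^ card F"
            using mult_mono[OF ge1(1) ge1(2)[of n]] by (intro mult_right_mono) auto
          finally show ?thesis using f(1) by simp
        qed
        moreover have "real (h + edge_time \<theta>2 n (card E)) \<le> \<alpha>3 * (n * ?L)"
        proof -
          have "real (edge_time \<theta>2 n (card E)) \<le> \<theta>2 / 2 * (n * ?L)" using \<theta>2 by (intro edge_time_upper) auto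
          also have "\<dots> \<le> \<alpha>3 / 2 * (n * ?L)" using \<theta>2 nL0 by (intro mult_right_mono) auto
          finally have "real (edge_time \<theta>2 n (card E)) \<le> \<alpha>3 / 2 * (n * ?L)" .
          moreover have "\<alpha> * (n * ?L) \<le> \<alpha>3 / 2 * (n * ?L)" using \<alpha> nL0 by (intro mult_right_mono) auto
          moreover have "\<alpha>3 * (n * ?L) = \<alpha>3 / 2 * (n * ?L) + \<alpha>3 / 2 * (n * ?L)" by simp
          ultimately show ?thesis unfolding of_nat_add using hle by linarith
        qed
        ultimately show ?thesis unfolding B7_def
          by (intro sprinkledD[OF elim(14)[rule_format] host]) auto
      qed
      have "order_prob E (\<lambda>es. \<not> hamiltonian_when_min_degree_2 V E \<epsilon> n es)
         \<le> order_prob E (\<lambda>es. B1 es \<or> B2 es \<or> B3 es \<or> B4 es \<or> B5 es \<or> B6 es \<or> B7 es)"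
      proof (rule order_prob_mono[OF finite_E], rule ccontr)
        fix es assume es: "es \<in> permutations_of_set E" and no: "\<not> hamiltonian_when_min_degree_2 V E \<epsilon> n es"
          and "\<not> (B1 es \<or> B2 es \<or> B3 es \<or> B4 es \<or> B5 es \<or> B6 es \<or> B7 es)"
        then have "\<not> B1 es" "\<not> B2 es" "\<not> B3 es" "\<not> B4 es" "\<not> B5 es" "\<not> B6 es" "\<not> B7 es" by auto
        then have "hamiltonian_when_min_degree_2 V E \<epsilon> n es"
          unfolding B1_def B2_def B3_def B4_def B5_def B6_def B7_def
          by (rule hamiltonian_when_min_degree_2_if_typical[OF es d2 \<kappa> \<theta>s(3) \<theta>2(3) h_def])
        then show False using no by simp
      qed
      also have "\<dots> \<le> b n"
        unfolding b_def
        by (intro order_trans[OF order_prob_disj add_mono] p1 p2 p3 p4 p5 p6 p7)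
      finally show "order_prob E (\<lambda>es. \<not> hamiltonian_when_min_degree_2 V E \<epsilon> n es) \<le> b n" .
    qed
  qed
  then show ?thesis using that b by blast
qed

section \<open>The hitting times\<close>

lemma min_degree_ge_iff:
  assumes "finite V" "V \<noteq> {}" "\<And>e. e \<in> H \<Longrightarrow> card e = 2"
  shows "k \<le> min_degree (V, H) \<longleftrightarrow> (\<forall>v\<in>V. k \<le> deg H v)"
  unfolding min_degree_def using assms deg_eq_card_edges[OF assms(3)] by (auto simp: degree_def)

context dirac_host
begin

lemma hamiltonian_deg_ge_2:
  assumes "hamiltonian (V, H)" "H \<subseteq> E" "v \<in> V"
  shows "2 \<le> deg H v"
proof -
  obtain vs where vs: "is_cycle (V, H) vs" "set vs = V" using assms(1) by (auto simp: hamiltonian_def)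
  let ?l = "length vs"
  have l: "3 \<le> ?l" "distinct vs" and ed: "\<And>i. i < ?l \<Longrightarrow> {vs ! i, vs ! (Suc i mod ?l)} \<in> H"
    using vs by (auto simp: is_cycle_def)
  obtain i where i: "i < ?l" "vs ! i = v" using assms(3) vs(2) by (metis in_set_conv_nth)
  define s where "s = Suc i mod ?l"
  define p where "p = (if i = 0 then ?l - 1 else i - 1)"
  have p: "p < ?l" "Suc p mod ?l = i" using i l by (auto simp: p_def)
  have "s \<noteq> p" "s < ?l"
    using i l by (auto simp: s_def p_def mod_Suc)
  then have ne: "vs ! s \<noteq> vs ! p" using l(2) p(1) by (simp add: nth_eq_iff_index_eq)
  have "{v, vs ! s} \<in> H" using ed[OF i(1)] i(2) by (simp add: s_def)
  moreover have "{v, vs ! p} \<in> H" using ed[OF p(1)] p(2) i(2) by (simp add: insert_commute)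
  ultimately have "{vs ! s, vs ! p} \<subseteq> {z. {v, z} \<in> H}" by auto
  then have "card {vs ! s, vs ! p} \<le> deg H v" unfolding deg_def using finite_nbrs[OF assms(2)] by (rule card_mono[rotated])
  then show ?thesis using ne by simp
qed

text \<open>
  Minimum degree at least two is a monotone property and necessary for a Hamilton cycle. So both hitting times
  equal the first time at which it holds.
\<close>

lemma hitting_times_coincide:
  assumes es: "es \<in> permutations_of_set E" and n: "8 * ln n \<le> n"
    and good: "hamiltonian_when_min_degree_2 V E \<epsilon> n es"
  shows "tau_H (V, E) es = tau_2 (V, E) es"
proof -
  let ?G = "\<lambda>t. set (take t es)"
  let ?t0 = "edge_time (1 - \<epsilon>) n (card E)" and ?t1 = "edge_time 8 n (card E)"
  define P where "P t \<longleftrightarrow> (\<forall>v\<in>V. 2 \<le> deg (?G t) v)" for t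
  have GE: "?G t \<subseteq> E" for t by (rule take_subset[OF es])
  have Vne: "V \<noteq> {}" using card_V large by auto
  have P_iff: "2 \<le> min_degree (process_at (V, E) es t) \<longleftrightarrow> P t" for t
    unfolding P_def process_at_def fst_conv by (rule min_degree_ge_iff[OF finite_V Vne]) (use GE simple in blast)
  have P_mono: "P t \<Longrightarrow> t \<le> t' \<Longrightarrow> P t'" for t t'
    unfolding P_def using deg_mono[OF set_take_subset_set_take GE, of t t'] le_trans by blast
  have P1: "P ?t1" and P0: "\<not> P ?t0"
    and ham: "\<And>t. ?t0 \<le> t \<Longrightarrow> t \<le> ?t1 \<Longrightarrow> P t \<Longrightarrow> hamiltonian (V, ?G t)"
    using good unfolding hamiltonian_when_min_degree_2_def P_def by (auto simp: not_le)
  define \<tau> where "\<tau> = (LEAST t. P t)"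
  have \<tau>: "P \<tau>" "\<And>t. P t \<Longrightarrow> \<tau> \<le> t" unfolding \<tau>_def using P1 by (auto intro: LeastI Least_le)
  have "\<tau> \<le> ?t1" using \<tau>(2) P1 .
  moreover have "?t0 \<le> \<tau>" using P0 P_mono[OF \<tau>(1)] by (meson nat_le_linear)
  ultimately have hamt: "hamiltonian (V, ?G \<tau>)" using ham \<tau>(1) by blast
  have \<tau>m: "\<tau> \<le> card E" using \<open>\<tau> \<le> ?t1\<close> edge_time_le_card[of 8] n by simp
  have "tau_2 (V, E) es = enat \<tau>"
    unfolding tau_2_def hitting_time_def P_iff
  proof (rule Inf_eqI)
    show "enat \<tau> \<le> i" if "i \<in> {enat t |t. t \<le> card (snd (V, E)) \<and> P t}" for i using that \<tau>(2) by auto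
    show "y \<le> enat \<tau>" if "\<And>i. i \<in> {enat t |t. t \<le> card (snd (V, E)) \<and> P t} \<Longrightarrow> y \<le> i" for y
      using that[of "enat \<tau>"] \<tau>m \<tau>(1) by auto
  qed
  moreover have "tau_H (V, E) es = enat \<tau>"
    unfolding tau_H_def hitting_time_def
  proof (rule Inf_eqI)
    show "enat \<tau> \<le> i" if "i \<in> {enat t |t. t \<le> card (snd (V, E)) \<and> hamiltonian (process_at (V, E) es t)}" for i
    proof -
      obtain t where t: "i = enat t" "hamiltonian (V, ?G t)" using \<open>i \<in> _\<close> by (auto simp: process_at_def)
      then have "P t" unfolding P_def using hamiltonian_deg_ge_2[OF t(2) GE] by blast
      then show ?thesis using \<tau>(2) t(1) by simp
    qed
    show "y \<le> enat \<tau>" if "\<And>i. i \<in> {enat t |t. t \<le> card (snd (V, E)) \<and> hamiltonian (process_at (V, E) es t)} \<Longrightarrow> y \<le> i" for y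
      using that[of "enat \<tau>"] \<tau>m hamt by (auto simp: process_at_def)
  qed
  ultimately show ?thesis by simp
qed

end

theorem theorem1:
  fixes \<beta> :: real and \<Gamma> :: "nat \<Rightarrow> 'a graph"
  assumes "\<beta> > 1/2"
    and "\<And>n. finite_simple_graph (\<Gamma> n)"
    and "\<And>n. card (verts (\<Gamma> n)) = n"
    and "\<forall>\<^sub>F n in sequentially. real (min_degree (\<Gamma> n)) \<ge> \<beta> * real n"
  shows "(\<lambda>n. measure_pmf.prob (edge_order (\<Gamma> n)) {es. tau_H (\<Gamma> n) es = tau_2 (\<Gamma> n) es})
           \<longlonglongrightarrow> 1"
proof -
  \<comment> \<open>Replacing \<beta> by a smaller value above 1/2 only weakens the hypothesis.\<close>
  define \<epsilon> where "\<epsilon> = min (\<beta> - 1 / 2) (1 / 4)"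
  have eps: "0 < \<epsilon>" "\<epsilon> \<le> 1 / 4" "\<epsilon> \<le> \<beta> - 1 / 2"
    unfolding \<epsilon>_def by (use assms(1) in simp, rule min.cobounded2, rule min.cobounded1)
  obtain b where b: "b \<longlonglongrightarrow> 0" and
    ev: "\<forall>\<^sub>F n in sequentially. \<forall>(V :: 'a set) E. dirac_host V E \<epsilon> n \<longrightarrow>
       order_prob E (\<lambda>es. \<not> hamiltonian_when_min_degree_2 V E \<epsilon> n es) \<le> b n"
    using hamiltonian_when_min_degree_2_whp[OF eps(1,2), where 'a = 'a] by blast
  let ?p = "\<lambda>n. measure_pmf.prob (edge_order (\<Gamma> n)) {es. tau_H (\<Gamma> n) es = tau_2 (\<Gamma> n) es}"
  have "\<forall>\<^sub>F n in sequentially. 8 * ln (real n) \<le> real n" by real_asymp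
  then have lower: "\<forall>\<^sub>F n in sequentially. 1 - b n \<le> ?p n"
    using ev assms(4) eventually_ge_at_top[of 24]
  proof eventually_elim
    case (elim n)
    obtain V E where VE: "\<Gamma> n = (V, E)" by (cases "\<Gamma> n")
    have simple: "finite V" "\<And>e. e \<in> E \<Longrightarrow> e \<subseteq> V \<and> card e = 2" and cV: "card V = n"
      using assms(2,3)[of n] by (auto simp: finite_simple_graph_def VE)
    have Vne: "V \<noteq> {}" using cV elim(4) by auto
    have degs: "(1 / 2 + \<epsilon>) * n \<le> real (card {z. {v, z} \<in> E})" if "v \<in> V" for v
    proof -
      have "(1 / 2 + \<epsilon>) * n \<le> \<beta> * n" using eps(3) by (intro mult_right_mono) auto
      also have "\<dots> \<le> min_degree (V, E)" using elim(3) by (simp add: VE)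
      also have "\<dots> \<le> deg E v"
        using min_degree_ge_iff[OF simple(1) Vne, of E "min_degree (V, E)"] simple(2) that by simp
      finally show ?thesis by (simp add: deg_def)
    qed
    interpret dirac_host V E \<epsilon> n
      by unfold_locales (use simple cV eps degs elim(4) in auto)
    have "1 - b n \<le> 1 - order_prob E (\<lambda>es. \<not> hamiltonian_when_min_degree_2 V E \<epsilon> n es)"
      using elim(2) dirac_host_axioms by simp
    also have "\<dots> = order_prob E (hamiltonian_when_min_degree_2 V E \<epsilon> n)"
      using order_prob_compl[of E "hamiltonian_when_min_degree_2 V E \<epsilon> n"] finite_E by simp
    also have "\<dots> \<le> order_prob E (\<lambda>es. tau_H (V, E) es = tau_2 (V, E) es)"
      by (rule order_prob_mono[OF finite_E]) (use hitting_times_coincide elim(1) in blast)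
    finally show ?case by (simp add: order_prob_def edge_order_def VE)
  qed
  have upper: "\<forall>\<^sub>F n in sequentially. ?p n \<le> 1" by simp
  have lim: "(\<lambda>n. 1 - b n) \<longlonglongrightarrow> 1" using tendsto_diff[OF tendsto_const b, of 1] by simp
  show ?thesis by (rule real_tendsto_sandwich[OF lower upper lim tendsto_const])
qed

end
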